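(* Let $d\ge 3$ and $\alpha\in(-1,1)$ be such that $2/(1-\alpha)$ is a positive integer, and suppose $$\frac{v_x}{v_y}\le\frac{d+2}{d(1+\alpha)}.$$ Then under $\alpha$-divergence loss the Bayesian predictive density with respect to the harmonic prior, $$\hat p_H(y\mid x;\alpha)=\frac{m_H^{1/\beta}(\gamma x+(1-\gamma)y,\,v_x\gamma)}{E_{Z_1}\!\left[m_H^{1/\beta}(x+\xi Z_1,\,v_x\gamma)\right]}\,\phi(y-x,v_y/\gamma),$$ satisfies $R_\alpha(\mu;\hat p_H)\le R_\alpha(\mu;\hat p_U)$ for every $\mu\in\mathbb{R}^d$, i.e. it dominates the best invariant predictive density $\hat p_U(y\mid x;\alpha)=\phi(y-x,v_y/\gamma)$.
   Context: $v_x,v_y>0$ known; $X\sim N_d(\mu,v_xI)$, $Y\sim N_d(\mu,v_yI)$ independent; $\phi(\cdot,\sigma^2)$ is the $N_d(0,\sigma^2I)$ density. $\beta=(1-\alpha)/2$, $\gamma=1/(1+\beta v_x/v_y)$, $\xi=(1-\gamma)(v_y/\gamma)^{1/2}$, $Z_1\sim N_d(0,I)$. $m_H(w,v)=\int\phi(w-\mu,v)\|\mu\|^{-(d-2)}d\mu$. The $\alpha$-divergence loss is $D_\alpha=\int f_\alpha\!\left(\hat p(y\mid x)/\phi(y-\mu,v_y)\right)\phi(y-\mu,v_y)\,dy$ with $f_\alpha(z)=\frac{4}{1-\alpha^2}(1-z^{(1+\alpha)/2})$, and the risk is $R_\alpha(\mu;\hat p)=\int D_\alpha\,\phi(x-\mu,v_x)\,dx$.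 *)

theory Defs
  imports "HOL-Analysis.Analysis"
begin

definition phi :: "real ^ 'n \<Rightarrow> real \<Rightarrow> real" where
  "phi x s2 = (2 * pi * s2) powr (- real CARD('n) / 2) * exp (- (norm x)\<^sup>2 / (2 * s2))"

definition m_H :: "real ^ 'n \<Rightarrow> real \<Rightarrow> real" where
  "m_H w v = (\<integral>\<mu>. phi (w - \<mu>) v * norm \<mu> powr (- (real CARD('n) - 2)) \<partial>lborel)"

definition beta_of :: "real \<Rightarrow> real" where
  "beta_of \<alpha> = (1 - \<alpha>) / 2"

definition gamma_of :: "real \<Rightarrow> real \<Rightarrow> real \<Rightarrow> real" where
  "gamma_of \<alpha> vx vy = 1 / (1 + beta_of \<alpha> * vx / vy)"

definition xi_of :: "real \<Rightarrow> real \<Rightarrow> real \<Rightarrow> real" where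
  "xi_of \<alpha> vx vy = (1 - gamma_of \<alpha> vx vy) * sqrt (vy / gamma_of \<alpha> vx vy)"

definition f_alpha :: "real \<Rightarrow> real \<Rightarrow> real" where
  "f_alpha \<alpha> z = 4 / (1 - \<alpha>\<^sup>2) * (1 - z powr ((1 + \<alpha>) / 2))"

definition D_alpha :: "real \<Rightarrow> real \<Rightarrow> real ^ 'n \<Rightarrow> (real ^ 'n \<Rightarrow> real) \<Rightarrow> real" where
  "D_alpha \<alpha> vy \<mu> q =
     (\<integral>y. f_alpha \<alpha> (q y / phi (y - \<mu>) vy) * phi (y - \<mu>) vy \<partial>lborel)"

text \<open>Risk of a predictive density p (p x y = p(y | x)).\<close>
definition risk_alpha :: "real \<Rightarrow> real \<Rightarrow> real \<Rightarrow> real ^ 'n \<Rightarrow>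
    (real ^ 'n \<Rightarrow> real ^ 'n \<Rightarrow> real) \<Rightarrow> real" where
  "risk_alpha \<alpha> vx vy \<mu> p = (\<integral>x. D_alpha \<alpha> vy \<mu> (p x) * phi (x - \<mu>) vx \<partial>lborel)"

definition p_U :: "real \<Rightarrow> real \<Rightarrow> real \<Rightarrow> real ^ 'n \<Rightarrow> real ^ 'n \<Rightarrow> real" where
  "p_U \<alpha> vx vy x y = phi (y - x) (vy / gamma_of \<alpha> vx vy)"

text \<open>Bayesian predictive density w.r.t. the harmonic prior; the expectation over
  Z_1 ~ N_d(0,I) is written as an integral against phi(z,1).\<close>
definition p_H :: "real \<Rightarrow> real \<Rightarrow> real \<Rightarrow> real ^ 'n \<Rightarrow> real ^ 'n \<Rightarrow> real" where
  "p_H \<alpha> vx vy x y =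
     (let \<beta> = beta_of \<alpha>; \<gamma> = gamma_of \<alpha> vx vy; \<xi> = xi_of \<alpha> vx vy in
       m_H (\<gamma> *\<^sub>R x + (1 - \<gamma>) *\<^sub>R y) (vx * \<gamma>) powr (1 / \<beta>)
       / (\<integral>z. m_H (x + \<xi> *\<^sub>R z) (vx * \<gamma>) powr (1 / \<beta>) * phi z 1 \<partial>lborel)
       * phi (y - x) (vy / \<gamma>))"

end

theory Submission
  imports Defs "HOL-Probability.Probability"
begin

text \<open>
  Put $k = 1/\beta$, $a = d/2 - 1$, $v = \gamma v_x$ and $s = \xi^2$. Completing squares, the joint
  weight $\hat p_U^{1-\beta} \phi(y-\mu,v_y)^\beta \phi(x-\mu,v_x)$ is a multiple of
  $\phi(w-\mu,v)\,\phi(y-x,v_y/\gamma)$ with $w = \gamma x + (1-\gamma) y$. So with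
  $u_t = E[m_H^k(\cdot + \sqrt t Z)]$ it is enough to show, pointwise in $w$, that
  $E[u_s^{-(1-1/k)}(w + \xi Z)] \ge m_H(w)^{-(k-1)}$. The function
  $t \mapsto E[u_t^{-(1-1/k)}(w + \sqrt t Z)]$ interpolates between the two sides, and its derivative
  is nonnegative as soon as $u_t^{1/(2k)}$ is superharmonic for $t \le s$.

  The harmonic prior is a mixture of centred Gaussians, and so
  $m_H(w,v) = c \int_0^{1/v} \theta^{a-1} e^{-\theta |w|^2/2}\,d\theta$. As $k$ is an integer, $u_t$ is
  explicit: an integral of $(1+t\Theta)^{-d/2} e^{-\eta |x|^2/2}$, with
  $\eta = \Theta/(1+t\Theta)$, against the $k$-fold convolution of $\theta^{a-1} d\theta$
  on $[0,1/v]$. Superharmonicity becomes the inequality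
  $r\,(E[\eta^2] - (1-\frac{1}{2k}) E[\eta]^2) \le d\,E[\eta]$ for the tilted law. It follows
  from an integration by parts in $\Theta$, whose boundary term has a sign by a Chebyshev-type
  argument, together with $E[\eta\Theta] \le \frac{d}{d+2} \frac{k}{v} E[\eta]$; the last bound is
  where the hypothesis on $v_x/v_y$, i.e. $k(k-1)s/v \le \frac{d+2}{2d}$, enters.
\<close>

section \<open>Differentiation under the integral sign\<close>

text \<open>Since (m^k)^(1 - 1/k) = m^(k-1), the risk integrand of the harmonic density is that of
  the invariant one times m_H(w)^(k-1) u_s(x)^(-p) with p = 1 - 1/k. Given w, the point x = w -
  (1-\<gamma>)(y - x) is Gaussian around w with variance s, which is why w can be frozen. Let Lap be
  the Laplacian. As u_t solves d/dt u = (1/2) Lap u, and averaging over w + sqrt(t) Z contributes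
  another (1/2) Lap, the derivative of E[u_t^(-p)(w + sqrt(t) Z)] is -p E[u^(-p-2) (u Lap u -
  ((p+1)/2) |grad u|^2)]. Because (p+1)/2 = 1 - 1/(2k), the bracket is a positive multiple of Lap
  u^(1/(2k)): this is the origin of the exponent. At t = 0 that function is a multiple of sqrt(m_H),
  superharmonic because m_H is. Smoothing m_H^k destroys this soft argument, and the explicit
  mixture is what recovers superharmonicity for t up to s.\<close>

lemma has_real_derivative_integral:
  fixes f f' :: "real \<Rightarrow> 'b \<Rightarrow> real"
  assumes \<delta>: "\<delta> > 0"
    and int: "\<And>x. \<bar>x - x0\<bar> < \<delta> \<Longrightarrow> integrable M (f x)"
    and der: "AE \<omega> in M. \<forall>x. \<bar>x - x0\<bar> < \<delta> \<longrightarrow>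
        ((\<lambda>x. f x \<omega>) has_real_derivative f' x \<omega>) (at x) \<and> \<bar>f' x \<omega>\<bar> \<le> g \<omega>"
    and g: "integrable M g"
    and f': "f' x0 \<in> borel_measurable M"
  shows "((\<lambda>x. \<integral>\<omega>. f x \<omega> \<partial>M) has_real_derivative (\<integral>\<omega>. f' x0 \<omega> \<partial>M)) (at x0)"
  unfolding DERIV_def tendsto_at_iff_sequentially
proof (intro allI impI)
  fix X :: "nat \<Rightarrow> real" assume X0: "\<forall>i. X i \<in> UNIV - {0}" and X: "X \<longlonglongrightarrow> 0"
  let ?q = "\<lambda>i \<omega>. (f (x0 + X i) \<omega> - f x0 \<omega>) / X i"
  have "eventually (\<lambda>i. \<bar>X i\<bar> < \<delta>) sequentially"
    using tendstoD[OF X \<delta>] by (simp add: dist_real_def)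
  then obtain N where N: "\<And>i. i \<ge> N \<Longrightarrow> \<bar>X i\<bar> < \<delta>"
    unfolding eventually_sequentially by blast
  have int2: "integrable M (f (x0 + X (i + N)))" "integrable M (f x0)" for i
    using N[of "i + N"] \<delta> by (auto intro!: int)
  \<comment> \<open>Dominated convergence along an arbitrary null sequence, shifted by
    \<open>N\<close> so that every point stays in the neighbourhood where the bound \<open>g\<close>
    holds.\<close>
  have "(\<lambda>i. \<integral>\<omega>. ?q (i + N) \<omega> \<partial>M) \<longlonglongrightarrow> (\<integral>\<omega>. f' x0 \<omega> \<partial>M)"
  proof (rule integral_dominated_convergence[where w = g])
    show "?q (i + N) \<in> borel_measurable M" for i
      using int2 by (intro borel_measurable_divide borel_measurable_diff) auto
    show "AE \<omega> in M. (\<lambda>i. ?q (i + N) \<omega>) \<longlonglongrightarrow> f' x0 \<omega>"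
      using der
    proof eventually_elim
      case (elim \<omega>)
      hence "DERIV (\<lambda>x. f x \<omega>) x0 :> f' x0 \<omega>" using \<delta> by auto
      hence "(\<lambda>i. ?q i \<omega>) \<longlonglongrightarrow> f' x0 \<omega>"
        unfolding DERIV_def tendsto_at_iff_sequentially using X0 X by (auto simp: o_def)
      thus ?case by (rule LIMSEQ_ignore_initial_segment)
    qed
    show "AE \<omega> in M. norm (?q (i + N) \<omega>) \<le> g \<omega>" for i
      using der
    proof eventually_elim
      case (elim \<omega>)
      let ?h = "X (i + N)"
      have h: "?h \<noteq> 0" "\<bar>?h\<bar> < \<delta>" using X0 N[of "i + N"] by auto
      \<comment> \<open>Mean value inequality: the bound on the derivative passes to the difference
        quotient. This needs one null set that serves all x at once.\<close>
      have "norm (f (x0 + ?h) \<omega> - f x0 \<omega>) \<le> g \<omega> * norm (x0 + ?h - x0)"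
      proof (rule field_differentiable_bound[where S = "ball x0 \<delta>" and f' = "\<lambda>x. f' x \<omega>"])
        fix x assume "x \<in> ball x0 \<delta>"
        hence "\<bar>x - x0\<bar> < \<delta>" by (simp add: dist_real_def abs_minus_commute)
        thus "((\<lambda>x. f x \<omega>) has_field_derivative f' x \<omega>) (at x within ball x0 \<delta>)"
          "norm (f' x \<omega>) \<le> g \<omega>"
          using elim by (auto intro: has_field_derivative_at_within)
      qed (use h \<delta> in \<open>auto simp: dist_real_def\<close>)
      thus ?case using h by (simp add: field_simps)
    qed
  qed (use g f' in auto)
  moreover have "(\<integral>\<omega>. ?q (i + N) \<omega> \<partial>M)
      = ((\<integral>\<omega>. f (x0 + X (i + N)) \<omega> \<partial>M) - (\<integral>\<omega>. f x0 \<omega> \<partial>M)) / X (i + N)" for i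
    using int2 by simp
  ultimately have "(\<lambda>i. ((\<integral>\<omega>. f (x0 + X (i + N)) \<omega> \<partial>M) - (\<integral>\<omega>. f x0 \<omega> \<partial>M)) / X (i + N))
      \<longlonglongrightarrow> (\<integral>\<omega>. f' x0 \<omega> \<partial>M)" by (simp only:)
  thus "((\<lambda>h. ((\<integral>\<omega>. f (x0 + h) \<omega> \<partial>M) - (\<integral>\<omega>. f x0 \<omega> \<partial>M)) / h) \<circ> X)
      \<longlonglongrightarrow> (\<integral>\<omega>. f' x0 \<omega> \<partial>M)"
    unfolding o_def by (rule LIMSEQ_offset)
qed

section \<open>Convolution powers of a power density\<close>

definition power_measure :: "real \<Rightarrow> real \<Rightarrow> real measure" where
  "power_measure a B = density lborel (\<lambda>\<theta>. ennreal (indicator {0..B} \<theta> * \<theta> powr (a - 1)))"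

text \<open>The sum of k independent coordinates, left unnormalised, with total mass (B^a/a)^k.
  Power 0 is the Dirac mass at 0, so the faces of a one-dimensional cube are covered too.\<close>

primrec power_conv :: "real \<Rightarrow> real \<Rightarrow> nat \<Rightarrow> real measure" where
  "power_conv a B 0 = return borel 0"
| "power_conv a B (Suc k) =
     distr (power_measure a B \<Otimes>\<^sub>M power_conv a B k) borel (\<lambda>(x, y). x + y)"

lemma continuous_on_atLeast_bounded:
  fixes f :: "real \<Rightarrow> real"
  assumes "continuous_on {0..} f"
  obtains C where "\<And>x. 0 \<le> x \<Longrightarrow> x \<le> c \<Longrightarrow> \<bar>f x\<bar> \<le> C"
proof -
  have "compact (f ` {0..c})"
    by (intro compact_continuous_image continuous_on_subset[OF assms]) auto
  then obtain C where "\<forall>y\<in>f ` {0..c}. norm y \<le> C"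
    using compact_imp_bounded bounded_iff by metis
  thus ?thesis by (intro that[of C]) auto
qed

locale power_mix =
  fixes a B :: real
  assumes a: "a > 0" and B: "B > 0"
begin

abbreviation "P \<equiv> power_measure a B"
abbreviation "Q \<equiv> power_conv a B"

lemma sets_P [measurable_cong, simp]: "sets P = sets borel" and space_P [simp]: "space P = UNIV"
  by (simp_all add: power_measure_def)

lemma sets_Q [measurable_cong, simp]: "sets (Q k) = sets borel"
  by (cases k) simp_all

lemma space_Q [simp]: "space (Q k) = UNIV"
  by (cases k) simp_all

lemma nn_integral_powr: "(\<integral>\<^sup>+\<theta>. ennreal (indicator {0..B} \<theta> * \<theta> powr (a - 1)) \<partial>lborel) = ennreal (B powr a / a)"
proof -
  have "((\<lambda>x. x powr (a - 1)) has_integral (B powr (a - 1 + 1) / (a - 1 + 1))) {0..B}"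
    using a B by (intro has_integral_powr_from_0) auto
  hence "((\<lambda>x. x powr (a - 1) * indicator {0..B} x) has_integral (B powr a / a)) UNIV"
    by (subst (asm) has_integral_restrict_UNIV[symmetric])
       (simp add: indicator_def of_bool_def if_distrib cong: if_cong)
  hence "(\<integral>\<^sup>+x. ennreal (x powr (a - 1) * indicator {0..B} x) \<partial>lborel) = ennreal (B powr a / a)"
    by (intro nn_integral_has_integral_lborel) auto
  thus ?thesis by (simp add: mult.commute)
qed

lemma emeasure_P_UNIV: "emeasure P UNIV = ennreal (B powr a / a)"
  unfolding power_measure_def by (subst emeasure_density) (simp_all add: nn_integral_powr)

lemma finite_P: "finite_measure P"
  by (rule finite_measureI) (simp add: emeasure_P_UNIV)

sublocale P: finite_measure P by (rule finite_P)

lemma AE_P: "AE x in P. 0 < x \<and> x \<le> B"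
proof -
  have "AE x in lborel. x \<noteq> (0::real)" by (rule AE_lborel_singleton)
  hence "AE x in lborel. 0 < ennreal (indicator {0..B} x * x powr (a - 1)) \<longrightarrow> 0 < x \<and> x \<le> B"
    by eventually_elim (auto simp: indicator_def split: if_splits)
  thus ?thesis unfolding power_measure_def by (subst AE_density) auto
qed

lemma integrable_P:
  assumes "f \<in> borel_measurable borel" "\<And>x. 0 \<le> x \<Longrightarrow> x \<le> B \<Longrightarrow> \<bar>f x\<bar> \<le> (C::real)"
  shows "integrable P (f :: real \<Rightarrow> real)"
proof (rule P.integrable_const_bound[where B = C])
  show "AE x in P. norm (f x) \<le> C" using AE_P by eventually_elim (use assms in auto)
qed (use assms in measurable)

lemma finite_Q: "finite_measure (Q k)"
proof (induction k)
  case 0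
  show ?case by (simp add: prob_space_return prob_space.finite_measure)
next
  case (Suc k)
  interpret Qk: finite_measure "Q k" by fact
  have "finite_measure (P \<Otimes>\<^sub>M Q k)"
    by (rule finite_measure_pair_measure) (rule Suc, rule finite_P)
  thus ?case by (simp add: finite_measure.finite_measure_distr)
qed

sublocale Q: finite_measure "Q k" for k by (rule finite_Q)
sublocale PQ: pair_sigma_finite P "Q k" for k ..

lemma AE_Q: "AE x in Q k. 0 \<le> x \<and> x \<le> real k * B"
proof (induction k)
  case 0
  show ?case by (simp only: power_conv.simps) (subst AE_return, auto)
next
  case (Suc k)
  have "AE p in P \<Otimes>\<^sub>M Q k. 0 \<le> fst p + snd p \<and> fst p + snd p \<le> real (Suc k) * B"
  proof (rule PQ.AE_pair_measure)
    show "AE x in P. AE y in Q k. 0 \<le> fst (x, y) + snd (x, y) \<and> fst (x, y) + snd (x, y) \<le> real (Suc k) * B"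
      using AE_P
    proof eventually_elim
      case (elim x)
      show ?case using Suc by eventually_elim (use elim in \<open>auto simp: algebra_simps\<close>)
    qed
  qed measurable
  thus ?case
    by (simp only: power_conv.simps) (subst AE_distr_iff, auto simp: case_prod_unfold)
qed

lemma integrable_Q:
  assumes "f \<in> borel_measurable borel" "\<And>x. 0 \<le> x \<Longrightarrow> x \<le> real k * B \<Longrightarrow> \<bar>f x\<bar> \<le> (C::real)"
  shows "integrable (Q k) (f :: real \<Rightarrow> real)"
proof (rule Q.integrable_const_bound[where B = C])
  show "AE x in Q k. norm (f x) \<le> C" using AE_Q by eventually_elim (use assms in auto)
qed (use assms in measurable)

lemma integrable_Q_continuous:
  assumes "f \<in> borel_measurable borel" "continuous_on {0..} f"
  shows "integrable (Q k) (f :: real \<Rightarrow> real)"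
proof -
  obtain C where "\<And>x. 0 \<le> x \<Longrightarrow> x \<le> real k * B \<Longrightarrow> \<bar>f x\<bar> \<le> C"
    using continuous_on_atLeast_bounded[OF assms(2)] by blast
  thus ?thesis by (rule integrable_Q[OF assms(1)])
qed

lemma integrable_PQ:
  assumes [measurable]: "f \<in> borel_measurable (borel \<Otimes>\<^sub>M borel)"
    and "\<And>x y. 0 \<le> x \<Longrightarrow> x \<le> B \<Longrightarrow> 0 \<le> y \<Longrightarrow> y \<le> real k * B \<Longrightarrow> \<bar>f (x, y)\<bar> \<le> C"
  shows "integrable (P \<Otimes>\<^sub>M Q k) (f :: real \<times> real \<Rightarrow> real)"
proof -
  interpret PQf: finite_measure "P \<Otimes>\<^sub>M Q k"
    by (rule finite_measure_pair_measure) (rule finite_Q, rule finite_P)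
  show ?thesis
  proof (rule PQf.integrable_const_bound[where B = C])
    show "AE p in P \<Otimes>\<^sub>M Q k. norm (f p) \<le> C"
    proof (rule PQ.AE_pair_measure)
      show "AE x in P. AE y in Q k. norm (f (x, y)) \<le> C"
        using AE_P
      proof eventually_elim
        case (elim x)
        show ?case using AE_Q by eventually_elim (use elim assms in auto)
      qed
    qed measurable
  qed measurable
qed

section \<open>Fubini and integration by parts for the convolution powers\<close>

lemma integral_Q_Suc:
  assumes f[measurable]: "f \<in> borel_measurable borel"
    and b: "\<And>x. 0 \<le> x \<Longrightarrow> x \<le> real (Suc k) * B \<Longrightarrow> \<bar>f x\<bar> \<le> (C::real)"
  shows "(\<integral>x. f x \<partial>Q (Suc k)) = (\<integral>\<theta>. (\<integral>S. f (\<theta> + S) \<partial>Q k) \<partial>P)"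
    and "integrable P (\<lambda>\<theta>. \<integral>S. f (\<theta> + S) \<partial>Q k)"
proof -
  have int: "integrable (P \<Otimes>\<^sub>M Q k) (\<lambda>(x, y). f (x + y))"
    by (rule integrable_PQ[where C = C]) (use b in \<open>auto simp: algebra_simps\<close>)
  have "(\<integral>x. f x \<partial>Q (Suc k)) = (\<integral>(x, y). f (x + y) \<partial>(P \<Otimes>\<^sub>M Q k))"
    by (simp add: integral_distr case_prod_unfold)
  thus "(\<integral>x. f x \<partial>Q (Suc k)) = (\<integral>\<theta>. (\<integral>S. f (\<theta> + S) \<partial>Q k) \<partial>P)"
    using PQ.integral_fst[OF int] by simp
  show "integrable P (\<lambda>\<theta>. \<integral>S. f (\<theta> + S) \<partial>Q k)"
    using PQ.integrable_fst'[OF int] by simp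
qed

declare power_conv.simps(2) [simp del]

text \<open>The density \<theta>^(a-1) times a h + \<theta> h' is the derivative of \<theta>^a
  h(\<theta>). As a > 0 the boundary term at 0 vanishes and only the one at B survives.\<close>

lemma integral_P_by_parts:
  assumes [measurable]: "h \<in> borel_measurable borel" "h' \<in> borel_measurable borel"
    and der: "\<And>x. x \<ge> 0 \<Longrightarrow> (h has_real_derivative h' x) (at x within {0..})"
    and cont: "continuous_on {0..} h'"
  shows "(\<integral>\<theta>. a * h \<theta> + \<theta> * h' \<theta> \<partial>P) = B powr a * h B"
proof -
  have ch: "continuous_on {0..} h"
    using der by (intro DERIV_continuous_on) auto
  define g where "g = (\<lambda>\<theta>. a * h \<theta> + \<theta> * h' \<theta>)"
  have [measurable]: "g \<in> borel_measurable borel" by (simp add: g_def)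
  have "continuous_on {0..} g" unfolding g_def by (intro continuous_intros ch cont)
  then obtain C where C: "\<And>x. 0 \<le> x \<Longrightarrow> x \<le> B \<Longrightarrow> \<bar>g x\<bar> \<le> C"
    using continuous_on_atLeast_bounded by blast
  have intg: "integrable P g" by (rule integrable_P[where C = C]) (use C in auto)
  have intL: "integrable lborel (\<lambda>x. (indicator {0..B} x * x powr (a - 1)) * g x)"
    using intg unfolding power_measure_def by (subst (asm) integrable_density) auto
  have "(\<integral>\<theta>. g \<theta> \<partial>P) = (\<integral>x. (indicator {0..B} x * x powr (a - 1)) * g x \<partial>lborel)"
    unfolding power_measure_def by (subst integral_density) auto
  also have "\<dots> = B powr a * h B"
  proof -
    \<comment> \<open>For a < 1 the derivative is singular at 0, so differentiability is used in the
      open interval only, with continuity of the primitive at the ends.\<close>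
    have "((\<lambda>x. x powr (a - 1) * g x) has_integral (B powr a * h B - 0 powr a * h 0)) {0..B}"
    proof (rule fundamental_theorem_of_calculus_interior)
      show "continuous_on {0..B} (\<lambda>x. x powr a * h x)"
        using a by (intro continuous_intros continuous_on_powr' continuous_on_subset[OF ch]) auto
      fix x assume x: "x \<in> {0<..<B}"
      have "(h has_real_derivative h' x) (at x)"
        using der[of x] x at_within_interior[of x "{0..}"] by auto
      hence "((\<lambda>x. x powr a * h x) has_real_derivative (a * x powr (a - 1) * h x + h' x * x powr a)) (at x)"
        using x by (auto intro!: derivative_eq_intros simp: field_simps)
      moreover have "x powr a = x powr (a - 1) * x"
        using x by (simp add: powr_diff)
      ultimately show "((\<lambda>x. x powr a * h x) has_vector_derivative x powr (a - 1) * g x) (at x)"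
        unfolding has_real_derivative_iff_has_vector_derivative[symmetric] g_def
        by (simp add: algebra_simps)
    qed (use B in auto)
    hence "((\<lambda>x. (indicator {0..B} x * x powr (a - 1)) * g x) has_integral (B powr a * h B)) UNIV"
      by (subst (asm) has_integral_restrict_UNIV[symmetric])
         (simp add: indicator_def of_bool_def if_distrib if_distribR cong: if_cong)
    moreover have "((\<lambda>x. (indicator {0..B} x * x powr (a - 1)) * g x) has_integral
        (\<integral>x. (indicator {0..B} x * x powr (a - 1)) * g x \<partial>lborel)) UNIV"
      by (rule has_integral_integral_lborel[OF intL])
    ultimately show ?thesis by (rule has_integral_unique[symmetric])
  qed
  finally show ?thesis by (simp add: g_def)
qed

text \<open>Applied to a function of the sum, x d/dx is the sum of the fields \<theta>_i
  d/d\<theta>_i on the cube [0, B]^k. Each coordinate contributes one multiple of a and one face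
  \<theta>_i = B, on which the remaining sum has law \<open>Q (k - 1)\<close>. For k = 0 the factor
  k kills the truncated index.\<close>

lemma integral_Q_by_parts:
  assumes "h \<in> borel_measurable borel" "h' \<in> borel_measurable borel"
    and "\<And>x. x \<ge> 0 \<Longrightarrow> (h has_real_derivative h' x) (at x within {0..})"
    and "continuous_on {0..} h'"
  shows "(\<integral>x. real k * a * h x + x * h' x \<partial>Q k) = real k * B powr a * (\<integral>x. h (x + B) \<partial>Q (k - 1))"
  using assms
proof (induction k arbitrary: h h')
  case 0
  note [measurable] = 0(1,2)
  have "(\<integral>x. real 0 * a * h x + x * h' x \<partial>return borel 0) = real 0 * a * h 0 + 0 * h' 0"
    by (rule integral_return) auto
  thus ?case by simp
next
  case (Suc k)
  note [measurable] = Suc.prems(1,2) and der = Suc.prems(3) and ch' = Suc.prems(4)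
  have ch: "continuous_on {0..} h"
    using der by (intro DERIV_continuous_on) auto
  have ch2: "continuous_on {0..} (\<lambda>x. h (x + s))" "continuous_on {0..} (\<lambda>x. h' (x + s))" if "s \<ge> 0" for s
    using that
    by (auto intro!: continuous_on_compose2[OF ch] continuous_on_compose2[OF ch'] continuous_intros)
  have der2: "((\<lambda>x. h (x + s)) has_real_derivative h' (x + s)) (at x within {0..})"
    if "s \<ge> 0" "x \<ge> 0" for s x
  proof -
    have "((h \<circ> (\<lambda>x. x + s)) has_real_derivative h' (x + s) * 1) (at x within {0..})"
    proof (rule DERIV_image_chain)
      show "(h has_real_derivative h' (x + s)) (at (x + s) within (\<lambda>x. x + s) ` {0..})"
        by (rule has_field_derivative_subset[OF der]) (use that in auto)
    qed (auto intro!: derivative_eq_intros)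
    thus ?thesis by (simp add: o_def)
  qed
  let ?c = "real (Suc k) * B"
  obtain C where C: "\<And>x. 0 \<le> x \<Longrightarrow> x \<le> ?c \<Longrightarrow> \<bar>h x\<bar> \<le> C"
    using continuous_on_atLeast_bounded[OF ch] by blast
  obtain C' where C': "\<And>x. 0 \<le> x \<Longrightarrow> x \<le> ?c \<Longrightarrow> \<bar>h' x\<bar> \<le> C'"
    using continuous_on_atLeast_bounded[OF ch'] by blast
  have bnd: "\<bar>h (x + y)\<bar> \<le> C" "\<bar>x * h' (x + y)\<bar> \<le> B * C'" "\<bar>y * h' (x + y)\<bar> \<le> (real k * B) * C'"
    if "0 \<le> x" "x \<le> B" "0 \<le> y" "y \<le> real k * B" for x y
  proof -
    have *: "0 \<le> x + y" "x + y \<le> ?c" using that by (auto simp: algebra_simps)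
    show "\<bar>h (x + y)\<bar> \<le> C" using C[OF *] .
    show "\<bar>x * h' (x + y)\<bar> \<le> B * C'"
      unfolding abs_mult using that C'[OF *] by (intro mult_mono) auto
    show "\<bar>y * h' (x + y)\<bar> \<le> (real k * B) * C'"
      unfolding abs_mult using that C'[OF *] by (intro mult_mono) (auto simp: B less_imp_le)
  qed
  have I: "integrable (P \<Otimes>\<^sub>M Q k) (\<lambda>(x, y). h (x + y))"
    "integrable (P \<Otimes>\<^sub>M Q k) (\<lambda>(x, y). x * h' (x + y))"
    "integrable (P \<Otimes>\<^sub>M Q k) (\<lambda>(x, y). y * h' (x + y))"
    by (rule integrable_PQ[where C = C] integrable_PQ[where C = "B * C'"]
          integrable_PQ[where C = "(real k * B) * C'"]; use bnd in \<open>auto simp: case_prod_unfold\<close>)+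
  \<comment> \<open>The factor x + y in front of h' is split: \<open>?f1\<close> is integrated by
    parts in the new coordinate and gives its face, \<open>?f2\<close> is the induction hypothesis
    for h shifted by that coordinate.\<close>
  let ?f1 = "\<lambda>x y. a * h (x + y) + x * h' (x + y)"
  let ?f2 = "\<lambda>x y. real k * a * h (x + y) + y * h' (x + y)"
  have I1: "integrable (P \<Otimes>\<^sub>M Q k) (\<lambda>(x, y). ?f1 x y)"
    using Bochner_Integration.integrable_add[OF integrable_mult_right[OF I(1), of a] I(2)]
    by (simp add: case_prod_unfold)
  have I2: "integrable (P \<Otimes>\<^sub>M Q k) (\<lambda>(x, y). ?f2 x y)"
    using Bochner_Integration.integrable_add[OF integrable_mult_right[OF I(1), of "real k * a"] I(3)]
    by (simp add: case_prod_unfold)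
  have "(\<integral>x. real (Suc k) * a * h x + x * h' x \<partial>Q (Suc k))
      = (\<integral>p. (case p of (x, y) \<Rightarrow> ?f1 x y) + (case p of (x, y) \<Rightarrow> ?f2 x y) \<partial>(P \<Otimes>\<^sub>M Q k))"
    by (simp add: power_conv.simps(2) integral_distr case_prod_unfold algebra_simps)
  also have "\<dots> = (\<integral>p. (case p of (x, y) \<Rightarrow> ?f1 x y) \<partial>(P \<Otimes>\<^sub>M Q k))
      + (\<integral>p. (case p of (x, y) \<Rightarrow> ?f2 x y) \<partial>(P \<Otimes>\<^sub>M Q k))"
    by (rule Bochner_Integration.integral_add[OF I1 I2])
  also have "(\<integral>p. (case p of (x, y) \<Rightarrow> ?f1 x y) \<partial>(P \<Otimes>\<^sub>M Q k)) = (\<integral>y. (\<integral>x. ?f1 x y \<partial>P) \<partial>Q k)"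
    using PQ.integral_snd[OF I1] by simp
  also have "\<dots> = (\<integral>y. B powr a * h (y + B) \<partial>Q k)"
  proof (rule integral_cong_AE)
    show "AE y in Q k. (\<integral>x. ?f1 x y \<partial>P) = B powr a * h (y + B)"
      using AE_Q
    proof eventually_elim
      case (elim y)
      thus ?case
        using integral_P_by_parts[of "\<lambda>x. h (x + y)" "\<lambda>x. h' (x + y)"] der2[of y] ch2[of y]
        by (simp add: add.commute)
    qed
  qed measurable
  also have "(\<integral>p. (case p of (x, y) \<Rightarrow> ?f2 x y) \<partial>(P \<Otimes>\<^sub>M Q k)) = (\<integral>x. (\<integral>y. ?f2 x y \<partial>Q k) \<partial>P)"
    using PQ.integral_fst[OF I2] by simp
  also have "\<dots> = (\<integral>x. real k * B powr a * (\<integral>y. h (x + y + B) \<partial>Q (k - 1)) \<partial>P)"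
  proof (rule integral_cong_AE)
    show "AE x in P. (\<integral>y. ?f2 x y \<partial>Q k) = real k * B powr a * (\<integral>y. h (x + y + B) \<partial>Q (k - 1))"
      using AE_P
    proof eventually_elim
      case (elim x)
      thus ?case
        using Suc.IH[of "\<lambda>y. h (y + x)" "\<lambda>y. h' (y + x)"] der2[of x] ch2[of x]
        by (simp add: add_ac)
    qed
  qed measurable
  \<comment> \<open>The new coordinate and the k - 1 remaining ones recombine to \<open>Q k\<close>;
    for k = 0 both sides vanish.\<close>
  also have "\<dots> = real k * B powr a * (\<integral>x. h (x + B) \<partial>Q k)"
  proof (cases k)
    case (Suc l)
    obtain C2 where C2: "\<And>x. 0 \<le> x \<Longrightarrow> x \<le> ?c \<Longrightarrow> \<bar>h (x + B)\<bar> \<le> C2"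
      using continuous_on_atLeast_bounded[OF ch2(1)[of B]] B by auto
    have "(\<integral>x. h (x + B) \<partial>Q (Suc l)) = (\<integral>x. (\<integral>y. h (x + y + B) \<partial>Q l) \<partial>P)"
      by (rule integral_Q_Suc(1)[where C = C2])
         (use C2 Suc B in \<open>auto simp: algebra_simps intro: order_trans\<close>)
    thus ?thesis using Suc by simp
  qed simp
  also have "(\<integral>y. B powr a * h (y + B) \<partial>Q k) = B powr a * (\<integral>y. h (y + B) \<partial>Q k)"
    by simp
  finally show ?case by (simp add: algebra_simps)
qed

section \<open>Total mass and first two moments\<close>

lemma P_moments:
  "(\<integral>\<theta>. 1 \<partial>P) = B powr a / a"
  "(\<integral>\<theta>. \<theta> \<partial>P) = B powr a / a * (a * B / (a + 1))"
  "(\<integral>\<theta>. \<theta>\<^sup>2 \<partial>P) = B powr a / a * (a * B\<^sup>2 / (a + 2))"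
  "integrable P (\<lambda>\<theta>. \<theta>)" "integrable P (\<lambda>\<theta>. \<theta>\<^sup>2)"
proof -
  show i: "integrable P (\<lambda>\<theta>. \<theta>)" "integrable P (\<lambda>\<theta>. \<theta>\<^sup>2)"
    by (rule integrable_P[where C = B] integrable_P[where C = "B\<^sup>2"];
        auto intro: power_mono)+
  have "(\<integral>\<theta>. a * 1 + \<theta> * 0 \<partial>P) = B powr a * 1"
    by (rule integral_P_by_parts) (auto intro!: derivative_eq_intros continuous_intros)
  thus "(\<integral>\<theta>. 1 \<partial>P) = B powr a / a"
    using a by (simp add: field_simps)
  have "(\<integral>\<theta>. a * \<theta> + \<theta> * 1 \<partial>P) = B powr a * B"
    by (rule integral_P_by_parts) (auto intro!: derivative_eq_intros continuous_intros)
  moreover have "(\<integral>\<theta>. a * \<theta> + \<theta> * 1 \<partial>P) = (a + 1) * (\<integral>\<theta>. \<theta> \<partial>P)"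
    using i by (simp add: algebra_simps)
  ultimately show "(\<integral>\<theta>. \<theta> \<partial>P) = B powr a / a * (a * B / (a + 1))"
    using a by (simp add: field_simps)
  have "(\<integral>\<theta>. a * \<theta>\<^sup>2 + \<theta> * (2 * \<theta>) \<partial>P) = B powr a * B\<^sup>2"
    by (rule integral_P_by_parts) (auto intro!: derivative_eq_intros continuous_intros)
  moreover have "(\<integral>\<theta>. a * \<theta>\<^sup>2 + \<theta> * (2 * \<theta>) \<partial>P) = (a + 2) * (\<integral>\<theta>. \<theta>\<^sup>2 \<partial>P)"
    by (subst integral_mult_right_zero[symmetric])
       (intro Bochner_Integration.integral_cong refl, simp add: algebra_simps power2_eq_square)
  ultimately have "(\<integral>\<theta>. \<theta>\<^sup>2 \<partial>P) = B powr a * B\<^sup>2 / (a + 2)"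
    using a by (simp add: eq_divide_eq mult.commute)
  thus "(\<integral>\<theta>. \<theta>\<^sup>2 \<partial>P) = B powr a / a * (a * B\<^sup>2 / (a + 2))"
    using a by simp
qed

lemma integrable_Q_power: "integrable (Q k) (\<lambda>x. x ^ j)"
  by (rule integrable_Q_continuous) (auto intro!: continuous_intros)

text \<open>With m = aB/(a+1) and n = aB^2/(a+2) the normalised moments of one coordinate,
  independence gives k m for the mean and k diagonal plus k(k-1) cross terms for the square.\<close>

lemma Q_moments:
  "(\<integral>x. 1 \<partial>Q k) = (B powr a / a) ^ k"
  "(\<integral>x. x \<partial>Q k) = (B powr a / a) ^ k * (real k * (a * B / (a + 1)))"
  "(\<integral>x. x\<^sup>2 \<partial>Q k) = (B powr a / a) ^ k *
     (real k * (a * B\<^sup>2 / (a + 2)) + real k * (real k - 1) * (a * B / (a + 1))\<^sup>2)"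
proof (induction k)
  case 0
  show "(\<integral>x. 1 \<partial>Q 0) = (B powr a / a) ^ 0"
    "(\<integral>x. x \<partial>Q 0) = (B powr a / a) ^ 0 * (real 0 * (a * B / (a + 1)))"
    "(\<integral>x. x\<^sup>2 \<partial>Q 0) = (B powr a / a) ^ 0 *
     (real 0 * (a * B\<^sup>2 / (a + 2)) + real 0 * (real 0 - 1) * (a * B / (a + 1))\<^sup>2)"
    using integral_return[of "0::real" borel "\<lambda>x. x ^ 0 :: real"]
      integral_return[of "0::real" borel "\<lambda>x. x"] integral_return[of "0::real" borel "\<lambda>x. x\<^sup>2"]
    by simp_all
next
  case (Suc k)
  define c where "c = B powr a / a"
  define m where "m = a * B / (a + 1)"
  define n where "n = a * B\<^sup>2 / (a + 2)"
  have P: "(\<integral>\<theta>. 1 \<partial>P) = c" "(\<integral>\<theta>. \<theta> \<partial>P) = c * m" "(\<integral>\<theta>. \<theta>\<^sup>2 \<partial>P) = c * n"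
    unfolding c_def m_def n_def by (rule P_moments)+
  note IH = Suc.IH[folded c_def m_def n_def]
  note iQ [simp] = integrable_Q_power[of k 1, simplified] integrable_Q_power[of k 2]
  note iP [simp] = P_moments(4,5)
  have "(\<integral>x. 1 \<partial>Q (Suc k)) = (\<integral>\<theta>. (\<integral>S. (1::real) \<partial>Q k) \<partial>P)"
    by (rule integral_Q_Suc(1)[where C = 1 and f = "\<lambda>_. 1"]) auto
  also have "\<dots> = c ^ k * (\<integral>\<theta>. 1 \<partial>P)" unfolding IH by simp
  finally show "(\<integral>x. 1 \<partial>Q (Suc k)) = (B powr a / a) ^ Suc k"
    unfolding P c_def by simp
  have "(\<integral>x. x \<partial>Q (Suc k)) = (\<integral>\<theta>. (\<integral>S. \<theta> + S \<partial>Q k) \<partial>P)"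
    by (rule integral_Q_Suc(1)[where C = "real (Suc k) * B"]) auto
  also have "\<dots> = (\<integral>\<theta>. \<theta> * (\<integral>S. 1 \<partial>Q k) + (\<integral>S. S \<partial>Q k) * 1 \<partial>P)"
    by simp
  also have "\<dots> = c ^ k * (\<integral>\<theta>. \<theta> \<partial>P) + c ^ k * (real k * m) * (\<integral>\<theta>. 1 \<partial>P)"
    unfolding IH by simp
  also have "\<dots> = c ^ Suc k * (real (Suc k) * m)" unfolding P by (simp add: algebra_simps)
  finally show "(\<integral>x. x \<partial>Q (Suc k)) = (B powr a / a) ^ Suc k * (real (Suc k) * (a * B / (a + 1)))"
    by (simp add: c_def m_def)
  have "(\<integral>x. x\<^sup>2 \<partial>Q (Suc k)) = (\<integral>\<theta>. (\<integral>S. (\<theta> + S)\<^sup>2 \<partial>Q k) \<partial>P)"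
    by (rule integral_Q_Suc(1)[where C = "(real (Suc k) * B)\<^sup>2"]) (auto intro: power_mono)
  also have "\<dots> = (\<integral>\<theta>. \<theta>\<^sup>2 * (\<integral>S. 1 \<partial>Q k) + 2 * (\<integral>S. S \<partial>Q k) * \<theta> + (\<integral>S. S\<^sup>2 \<partial>Q k) * 1 \<partial>P)"
    by (simp add: power2_sum)
  also have "\<dots> = c ^ k * (\<integral>\<theta>. \<theta>\<^sup>2 \<partial>P) + 2 * (c ^ k * (real k * m)) * (\<integral>\<theta>. \<theta> \<partial>P)
      + c ^ k * (real k * n + real k * (real k - 1) * m\<^sup>2) * (\<integral>\<theta>. 1 \<partial>P)"
    unfolding IH by simp
  also have "\<dots> = c ^ Suc k * (real (Suc k) * n + real (Suc k) * (real (Suc k) - 1) * m\<^sup>2)"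
    unfolding P by (simp add: algebra_simps power2_eq_square)
  finally show "(\<integral>x. x\<^sup>2 \<partial>Q (Suc k)) = (B powr a / a) ^ Suc k *
     (real (Suc k) * (a * B\<^sup>2 / (a + 2)) + real (Suc k) * (real (Suc k) - 1) * (a * B / (a + 1))\<^sup>2)"
    by (simp add: c_def m_def n_def)
qed

text \<open>Replacing m^2 by n in the cross terms bounds the normalised second moment by k^2 n, and
  n = (a+1)/(a+2) B m. For d = 2a + 2 the factor (a+1)/(a+2) is d/(d+2).\<close>

lemma Q_second_moment_le:
  "(\<integral>x. x\<^sup>2 \<partial>Q k) \<le> (a + 1) / (a + 2) * real k * B * (\<integral>x. x \<partial>Q k)"
proof -
  define c where "c = (B powr a / a) ^ k"
  have c: "c \<ge> 0" unfolding c_def using a B by simp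
  \<comment> \<open>Jensen for a single coordinate, which comes down to a(a+2) <= (a+1)^2.\<close>
  have "(a * B / (a + 1))\<^sup>2 \<le> a * B\<^sup>2 / (a + 2)"
  proof -
    have "a\<^sup>2 / (a + 1)\<^sup>2 \<le> a / (a + 2)"
      using a by (simp add: divide_simps) (simp add: algebra_simps power2_eq_square)
    hence "a\<^sup>2 / (a + 1)\<^sup>2 * B\<^sup>2 \<le> a / (a + 2) * B\<^sup>2" by (rule mult_right_mono) simp
    thus ?thesis by (simp add: power_divide power_mult_distrib)
  qed
  hence "real k * (real k - 1) * (a * B / (a + 1))\<^sup>2 \<le> real k * (real k - 1) * (a * B\<^sup>2 / (a + 2))"
    by (rule mult_left_mono) (cases k, auto)
  hence "real k * (a * B\<^sup>2 / (a + 2)) + real k * (real k - 1) * (a * B / (a + 1))\<^sup>2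
      \<le> real k * (a * B\<^sup>2 / (a + 2)) + real k * (real k - 1) * (a * B\<^sup>2 / (a + 2))"
    by (rule add_left_mono)
  also have "\<dots> = real k * (real k * (a * B\<^sup>2 / (a + 2)))"
    by (simp add: left_diff_distrib right_diff_distrib diff_divide_distrib)
  finally have "c * (real k * (a * B\<^sup>2 / (a + 2)) + real k * (real k - 1) * (a * B / (a + 1))\<^sup>2)
      \<le> c * (real k * (real k * (a * B\<^sup>2 / (a + 2))))"
    using c by (rule mult_left_mono)
  also have "\<dots> = (a + 1) / (a + 2) * real k * B * (c * (real k * (a * B / (a + 1))))"
    using a by (simp add: divide_simps) (simp add: algebra_simps power2_eq_square)
  finally show ?thesis unfolding Q_moments c_def .
qed

end

section \<open>The superharmonicity inequality\<close>

text \<open>A Gaussian factor of precision x has precision 1/(1/x + t) after smoothing with variance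
  t. The form without 1/x also covers x = 0.\<close>

definition eta :: "real \<Rightarrow> real \<Rightarrow> real" where
  "eta t x = x / (1 + t * x)"

lemma one_plus_mult_nz: "t \<ge> 0 \<Longrightarrow> x \<ge> 0 \<Longrightarrow> 1 + t * x \<noteq> (0::real)"
  using add_pos_nonneg[of 1 "t * x"] by auto

lemma eta_nonneg: "t \<ge> 0 \<Longrightarrow> x \<ge> 0 \<Longrightarrow> eta t x \<ge> 0"
  by (simp add: eta_def)

lemma eta_le: "t \<ge> 0 \<Longrightarrow> x \<ge> 0 \<Longrightarrow> eta t x \<le> x"
  by (simp add: eta_def divide_le_eq add_pos_nonneg algebra_simps)

lemma eta_le_iff:
  assumes "t \<ge> 0" "x \<ge> 0" "y \<ge> 0"
  shows "eta t x \<le> eta t y \<longleftrightarrow> x \<le> y"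
proof -
  have "1 + t * x > 0" "1 + t * y > 0" using assms by (auto intro: add_pos_nonneg)
  thus ?thesis unfolding eta_def by (simp add: field_simps)
qed

text \<open>Used to trade the first moment of \<Theta> for those of \<open>eta\<close> and of
  \<open>eta\<close> times \<Theta>.\<close>

lemma eta_eq:
  assumes "t \<ge> 0" "x \<ge> 0"
  shows "x = eta t x + t * (eta t x * x)"
proof -
  have "eta t x * (1 + t * x) = x"
    using add_pos_nonneg[of 1 "t * x"] assms by (simp add: eta_def)
  thus ?thesis by (simp add: algebra_simps)
qed

lemma eta_measurable [measurable]: "eta t \<in> borel_measurable borel"
  unfolding eta_def by measurable

lemma continuous_on_eta: "t \<ge> 0 \<Longrightarrow> continuous_on {0..} (eta t)"
  unfolding eta_def using one_plus_mult_nz[of t] by (intro continuous_intros) auto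

context power_mix
begin

text \<open>With a + 1 = d/2 and r = |x|^2 this is the Gaussian exp(-\<Theta> |x|^2 / 2) convolved
  with N(0, tI). Radial functions are handled throughout as functions of the real variable
  r.\<close>

definition wt :: "real \<Rightarrow> real \<Rightarrow> real \<Rightarrow> real" where
  "wt t r x = (1 + t * x) powr (- (a + 1)) * exp (- (eta t x * r / 2))"

lemma wt_measurable [measurable]: "wt t r \<in> borel_measurable borel"
  unfolding wt_def by measurable

lemma continuous_on_wt: "t \<ge> 0 \<Longrightarrow> continuous_on {0..} (wt t r)"
  unfolding wt_def using one_plus_mult_nz[of t]
  by (intro continuous_intros continuous_on_eta) auto

lemma wt_pos: "t \<ge> 0 \<Longrightarrow> x \<ge> 0 \<Longrightarrow> wt t r x > 0"
  using add_pos_nonneg[of 1 "t * x"] by (simp add: wt_def)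

lemma wt_antimono:
  assumes "t \<ge> 0" "r \<ge> 0" "0 \<le> x" "x \<le> y"
  shows "wt t r y \<le> wt t r x"
  unfolding wt_def
proof (intro mult_mono)
  have "1 + t * x > 0" "t * x \<le> t * y" using assms by (auto intro: add_pos_nonneg mult_left_mono)
  thus "(1 + t * y) powr (- (a + 1)) \<le> (1 + t * x) powr (- (a + 1))"
    using a by (intro powr_mono2') auto
  show "exp (- (eta t y * r / 2)) \<le> exp (- (eta t x * r / 2))"
    using assms eta_le_iff[of t x y] by (auto intro: mult_right_mono)
qed auto

lemma DERIV_wt:
  assumes "t \<ge> 0" "x \<ge> 0"
  shows "(wt t r has_real_derivative
    wt t r x * (- (a + 1) * t / (1 + t * x) - r / 2 / (1 + t * x)\<^sup>2)) (at x within X)"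
proof -
  have pos: "1 + t * x > 0" using assms by (auto intro: add_pos_nonneg)
  have e: "(eta t has_real_derivative 1 / (1 + t * x)\<^sup>2) (at x within X)"
    unfolding eta_def using pos
    by (auto intro!: derivative_eq_intros simp: power2_eq_square field_simps)
  have p: "((\<lambda>x. (1 + t * x) powr (- (a + 1))) has_real_derivative
      (1 + t * x) powr (- (a + 1)) * (- (a + 1) * t / (1 + t * x))) (at x within X)"
  proof (rule has_field_derivative_at_within)
    have "((\<lambda>x. 1 + t * x) has_real_derivative t) (at x)"
      by (auto intro!: derivative_eq_intros)
    from DERIV_fun_powr[OF this pos, of "- (a + 1)"]
    show "((\<lambda>x. (1 + t * x) powr (- (a + 1))) has_real_derivative
      (1 + t * x) powr (- (a + 1)) * (- (a + 1) * t / (1 + t * x))) (at x)"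
      using pos powr_diff[of "1 + t * x" "- (a + 1)" 1] by (simp add: mult_ac)
  qed
  show ?thesis unfolding wt_def
    by (rule derivative_eq_intros p e refl | simp)+ (simp add: algebra_simps)
qed

text \<open>
  Up to the constant $c^k$, \<open>U k 0 t\<close> at $r = |x|^2$ is $u_t(x)$, and the quotient
  \<open>U k j t r / U k 0 t r\<close> is the moment $E[\eta^j]$ under the tilted law.
\<close>

definition U :: "nat \<Rightarrow> nat \<Rightarrow> real \<Rightarrow> real \<Rightarrow> real" where
  "U k j t r = (\<integral>x. eta t x ^ j * wt t r x \<partial>Q k)"

lemma integrable_Q_wt:
  assumes "t \<ge> 0" "continuous_on {0..} f" "f \<in> borel_measurable borel"
  shows "integrable (Q k) (\<lambda>x. f x * wt t r x)"
  using assms by (intro integrable_Q_continuous continuous_intros continuous_on_wt) auto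

lemma integrable_U: "t \<ge> 0 \<Longrightarrow> integrable (Q k) (\<lambda>x. eta t x ^ j * wt t r x)"
  by (intro integrable_Q_wt continuous_intros continuous_on_eta) auto

lemma Q_integral_mono:
  assumes "integrable (Q k) f" "integrable (Q k) g"
    and "\<And>x. 0 \<le> x \<Longrightarrow> x \<le> real k * B \<Longrightarrow> f x \<le> g x"
  shows "(\<integral>x. f x \<partial>Q k) \<le> (\<integral>x. (g x :: real) \<partial>Q k)"
proof (rule integral_mono_AE[OF assms(1,2)])
  show "AE x in Q k. f x \<le> g x" using AE_Q by eventually_elim (use assms(3) in auto)
qed

lemma U_nonneg: "t \<ge> 0 \<Longrightarrow> U k j t r \<ge> 0"
  using Q_integral_mono[of k "\<lambda>_. 0", OF _ integrable_U[of t k j r]] eta_nonneg[of t] wt_pos[of t _ r]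
  unfolding U_def by (simp add: less_imp_le)

text \<open>On the support \<open>eta\<close> is at most x, hence at most kB. This is what later
  makes every derivative of U comparable with U itself.\<close>

lemma U_Suc_le:
  assumes "t \<ge> 0"
  shows "U k (Suc j) t r \<le> real k * B * U k j t r"
proof -
  have "U k (Suc j) t r \<le> (\<integral>x. real k * B * (eta t x ^ j * wt t r x) \<partial>Q k)"
    unfolding U_def
  proof (rule Q_integral_mono)
    fix x assume x: "0 \<le> x" "x \<le> real k * B"
    have "eta t x * (eta t x ^ j * wt t r x) \<le> (real k * B) * (eta t x ^ j * wt t r x)"
      using assms x eta_le[of t x] eta_nonneg[of t x] wt_pos[of t x r]
      by (intro mult_right_mono) auto
    thus "eta t x ^ Suc j * wt t r x \<le> real k * B * (eta t x ^ j * wt t r x)"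
      by (simp add: mult.assoc)
  qed (use integrable_U[OF assms, of k "Suc j" r] integrable_U[OF assms, of k j r] in auto)
  thus ?thesis by (simp add: U_def)
qed

text \<open>The weight attains a positive minimum on the compact support, and the measure has
  positive mass.\<close>

lemma U_0_pos:
  assumes "t \<ge> 0"
  shows "U k 0 t r > 0"
proof -
  have c: "continuous_on {0..real k * B} (wt t r)"
    using continuous_on_wt[OF assms] by (rule continuous_on_subset) auto
  have "{0..real k * B} \<noteq> {}" using B by auto
  then obtain x0 where x0: "x0 \<in> {0..real k * B}" "\<And>x. x \<in> {0..real k * B} \<Longrightarrow> wt t r x0 \<le> wt t r x"
    using continuous_attains_inf[OF _ _ c] by auto
  have "(\<integral>x. wt t r x0 * 1 \<partial>Q k) \<le> U k 0 t r"
    unfolding U_def using integrable_U[OF assms, of k 0 r] x0 by (intro Q_integral_mono) auto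
  moreover have "(\<integral>x. wt t r x0 * 1 \<partial>Q k) = wt t r x0 * (B powr a / a) ^ k"
    by (subst integral_mult_right_zero) (simp only: Q_moments)
  moreover have "wt t r x0 * (B powr a / a) ^ k > 0"
    using wt_pos[of t x0 r] x0 assms a B by auto
  ultimately show ?thesis by linarith
qed

text \<open>The quotient equals f^(a+1) / (1 + t(S + B)) times exp(g r / 2), where f is the quotient
  of the two linear factors and g the difference of the two \<open>eta\<close> values. As \<theta>
  <= B, both f and g decrease in S, and so does 1 / (1 + t(S + B)).\<close>

lemma wt_ratio_antimono:
  assumes t: "t \<ge> 0" and r: "r \<ge> 0" and \<theta>: "0 \<le> \<theta>" "\<theta> \<le> B" and S: "0 \<le> S" "S \<le> S'"
  shows "wt t r (\<theta> + S') / ((1 + t * (S' + B)) * wt t r (S' + B))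
    \<le> wt t r (\<theta> + S) / ((1 + t * (S + B)) * wt t r (S + B))"
proof -
  define f where "f = (\<lambda>S. 1 + t * (B - \<theta>) / (1 + t * (\<theta> + S)))"
  define g where "g = (\<lambda>S. (B - \<theta>) / ((1 + t * (S + B)) * (1 + t * (\<theta> + S))))"
  have eq: "wt t r (\<theta> + S) / ((1 + t * (S + B)) * wt t r (S + B))
      = f S powr (a + 1) / (1 + t * (S + B)) * exp (g S * r / 2)" if "S \<ge> 0" for S
  proof -
    have p: "1 + t * (\<theta> + S) > 0" "1 + t * (S + B) > 0"
      using that t \<theta> B by (auto intro!: add_pos_nonneg mult_nonneg_nonneg)
    have f: "f S = (1 + t * (S + B)) / (1 + t * (\<theta> + S))"
      using p by (simp add: f_def field_simps)
    have g: "g S = eta t (S + B) - eta t (\<theta> + S)"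
    proof -
      have "eta t (S + B) - eta t (\<theta> + S)
          = ((S + B) * (1 + t * (\<theta> + S)) - (\<theta> + S) * (1 + t * (S + B))) / ((1 + t * (S + B)) * (1 + t * (\<theta> + S)))"
        unfolding eta_def using p by (subst diff_frac_eq) auto
      also have "(S + B) * (1 + t * (\<theta> + S)) - (\<theta> + S) * (1 + t * (S + B)) = B - \<theta>"
        by (simp add: algebra_simps)
      finally show ?thesis by (simp add: g_def)
    qed
    have "f S powr (a + 1) = (1 + t * (\<theta> + S)) powr (- (a + 1)) / (1 + t * (S + B)) powr (- (a + 1))"
      unfolding f powr_minus using p by (simp add: powr_divide) (simp add: divide_inverse mult.commute)
    moreover have "exp (g S * r / 2) = exp (- (eta t (\<theta> + S) * r / 2)) / exp (- (eta t (S + B) * r / 2))"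
      unfolding g exp_diff[symmetric] by (simp add: algebra_simps diff_divide_distrib)
    ultimately show ?thesis by (simp add: wt_def)
  qed
  have p: "1 + t * (\<theta> + S) > 0" "1 + t * (S + B) > 0"
    using S t \<theta> B by (auto intro!: add_pos_nonneg mult_nonneg_nonneg)
  have q: "1 + t * (\<theta> + S) \<le> 1 + t * (\<theta> + S')" "1 + t * (S + B) \<le> 1 + t * (S' + B)"
    using S t by (auto intro!: mult_left_mono)
  have "f S' \<le> f S" unfolding f_def using p q t \<theta>
    by (intro add_left_mono divide_left_mono) auto
  moreover have "f S' > 0" unfolding f_def using p q t \<theta>
    by (intro add_pos_nonneg divide_nonneg_nonneg mult_nonneg_nonneg) linarith+
  ultimately have 1: "f S' powr (a + 1) \<le> f S powr (a + 1)" using a by (intro powr_mono2) auto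
  have "g S' \<le> g S" unfolding g_def using p q t \<theta>
    by (intro divide_left_mono mult_mono mult_pos_pos) auto
  hence 2: "exp (g S' * r / 2) \<le> exp (g S * r / 2)" using r by (auto intro: mult_right_mono)
  have "f S' powr (a + 1) / (1 + t * (S' + B)) * exp (g S' * r / 2)
      \<le> f S powr (a + 1) / (1 + t * (S + B)) * exp (g S * r / 2)"
    using 1 2 p q by (intro mult_mono frac_le) auto
  thus ?thesis using eq[of S] eq[of S'] S by simp
qed

text \<open>
  The faces $\theta_i = B$ of the cube carry more of the mass at large $\Theta$ than the cube does: with
  $S$ the sum of the other coordinates, the ratio of the interior weight to the boundary weight
  decreases in $S$, so it can be frozen at the point where $\eta$ equals its mean.
\<close>

lemma boundary_term_nonneg:
  assumes t: "t \<ge> 0" and r: "r \<ge> 0" and e: "e \<le> U (Suc k) 1 t r / U (Suc k) 0 t r"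
  shows "0 \<le> (\<integral>S. (eta t (S + B) - e) * ((1 + t * (S + B)) * wt t r (S + B)) \<partial>Q k)"
proof -
  note contB = continuous_on_compose2[OF continuous_on_eta[OF t]] continuous_on_compose2[OF continuous_on_wt[OF t]]
  define e' where "e' = U (Suc k) 1 t r / U (Suc k) 0 t r"
  let ?b = "\<lambda>S. (eta t (S + B) - e') * ((1 + t * (S + B)) * wt t r (S + B))"
  have ib: "integrable (Q k) (\<lambda>S. (eta t (S + B) - c) * ((1 + t * (S + B)) * wt t r (S + B)))" for c
    using B by (intro integrable_Q_continuous continuous_intros contB) auto
  have U0: "U (Suc k) 0 t r > 0" using U_0_pos[OF t] .
  define KB where "KB = real (Suc k) * B"
  have KB: "KB > 0" using B by (simp add: KB_def)
  \<comment> \<open>The mean lies in the range of \<open>eta\<close>, below 1/t when t > 0, so that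
    it can be inverted below.\<close>
  have e'le: "e' \<le> eta t KB"
  proof -
    have "U (Suc k) 1 t r \<le> (\<integral>x. eta t KB * (eta t x ^ 0 * wt t r x) \<partial>Q (Suc k))"
      unfolding U_def
    proof (rule Q_integral_mono)
      fix x assume "0 \<le> x" "x \<le> real (Suc k) * B"
      hence "eta t x \<le> eta t KB" "wt t r x > 0"
        using eta_le_iff[OF t, of x KB] wt_pos[OF t, of x r] KB by (auto simp: KB_def)
      thus "eta t x ^ 1 * wt t r x \<le> eta t KB * (eta t x ^ 0 * wt t r x)"
        by simp
    qed (use integrable_U[OF t, of "Suc k" 1 r] integrable_U[OF t, of "Suc k" 0 r] in auto)
    also have "\<dots> = eta t KB * U (Suc k) 0 t r" by (simp add: U_def)
    finally show ?thesis using U0 by (simp add: e'_def divide_le_eq)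
  qed
  have "0 \<le> (\<integral>S. ?b S \<partial>Q k)"
  proof (cases "e' \<le> eta t B")
    case True
    \<comment> \<open>If the mean is at most the value at S = 0, the integrand has a constant
      sign.\<close>
    have "(\<integral>S. 0 \<partial>Q k) \<le> (\<integral>S. ?b S \<partial>Q k)"
    proof (rule Q_integral_mono[OF _ ib])
      fix S :: real assume S: "0 \<le> S"
      have "e' \<le> eta t (S + B)" using True eta_le_iff[OF t, of B "S + B"] S B by auto
      thus "0 \<le> ?b S" using wt_pos[OF t, of "S + B" r] S B t by (auto intro!: mult_nonneg_nonneg)
    qed auto
    thus ?thesis by simp
  next
    case False
    \<comment> \<open>The preimage of the mean under \<open>eta\<close>. With
      \<open>S0 = T - B\<close>, the integrand \<open>?b\<close> is nonpositive for S below
      \<open>S0\<close> and nonnegative above it.\<close>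
    define T where "T = e' / (1 - t * e')"
    have "0 < e'" using False eta_nonneg[OF t, of B] B by simp
    have "t * e' \<le> t * eta t KB" using e'le t by (rule mult_left_mono)
    also have "\<dots> < 1"
      using add_pos_nonneg[of 1 "t * KB"] t KB by (simp add: eta_def)
    finally have te: "1 - t * e' > 0" by simp
    hence T: "T > 0" using \<open>0 < e'\<close> by (simp add: T_def)
    have "1 + t * T = 1 / (1 - t * e')" using te by (simp add: T_def field_simps)
    hence etaT: "eta t T = e'" using te by (simp add: eta_def T_def)
    have TB: "T \<ge> B" using False eta_le_iff[OF t, of T B] T B etaT by auto
    define S0 where "S0 = T - B"
    have S0: "S0 \<ge> 0" "S0 + B = T" using TB by (auto simp: S0_def)
    show ?thesis
    proof (rule ccontr)
      assume "\<not> ?thesis"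
      \<comment> \<open>A negative face integral would force every slice \<open>G\<close> of the
        cube to be negative, with a gap uniform in \<theta>. But the slices integrate to the centred
        moment of \<open>eta\<close> under the tilted law, which is zero.\<close>
      hence neg: "(\<integral>S. ?b S \<partial>Q k) < 0" by simp
      define G where "G = (\<lambda>\<theta>. \<integral>S. (eta t (\<theta> + S) - e') * wt t r (\<theta> + S) \<partial>Q k)"
      have contG: "continuous_on {0..} (\<lambda>x. (eta t x - e') * wt t r x)"
        by (intro continuous_intros continuous_on_eta[OF t] continuous_on_wt[OF t])
      then obtain C where C: "\<And>x. 0 \<le> x \<Longrightarrow> x \<le> KB \<Longrightarrow> \<bar>(eta t x - e') * wt t r x\<bar> \<le> C"
        using continuous_on_atLeast_bounded by blast
      have "(\<integral>x. (eta t x - e') * wt t r x \<partial>Q (Suc k)) = (\<integral>\<theta>. G \<theta> \<partial>P)"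
        unfolding G_def by (rule integral_Q_Suc(1)[where C = C]) (use C in \<open>auto simp: KB_def\<close>)
      moreover have "(\<integral>x. (eta t x - e') * wt t r x \<partial>Q (Suc k)) = U (Suc k) 1 t r - e' * U (Suc k) 0 t r"
        using integrable_U[OF t, of "Suc k" 1 r] integrable_U[OF t, of "Suc k" 0 r]
        by (simp add: U_def left_diff_distrib del: power_conv.simps)
      moreover have "\<dots> = 0" using U0 by (simp add: e'_def)
      ultimately have "(\<integral>\<theta>. G \<theta> \<partial>P) = 0" by simp
      have intG: "integrable P G"
        unfolding G_def by (rule integral_Q_Suc(2)[where C = C]) (use C in \<open>auto simp: KB_def\<close>)
      define c0 where "c0 = 1 / (1 + t * T)"
      have c0: "c0 > 0" using T t by (simp add: c0_def add_pos_nonneg)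
      have G: "G \<theta> \<le> c0 * (\<integral>S. ?b S \<partial>Q k)" if \<theta>: "0 \<le> \<theta>" "\<theta> \<le> B" for \<theta>
      proof -
        define R where "R = (\<lambda>S. wt t r (\<theta> + S) / ((1 + t * (S + B)) * wt t r (S + B)))"
        have "G \<theta> \<le> (\<integral>S. R S0 * ?b S \<partial>Q k)"
          unfolding G_def
        proof (rule Q_integral_mono)
          show "integrable (Q k) (\<lambda>S. (eta t (\<theta> + S) - e') * wt t r (\<theta> + S))"
            using \<theta> by (intro integrable_Q_continuous continuous_intros contB) auto
          show "integrable (Q k) (\<lambda>S. R S0 * ?b S)" using ib by auto
        next
          fix S :: real assume S: "0 \<le> S"
          have p: "(1 + t * (S + B)) * wt t r (S + B) > 0"
            using wt_pos[OF t, of "S + B" r] S B t by (auto intro!: mult_pos_pos add_pos_nonneg)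
          \<comment> \<open>Moving the slice to the face \<theta> = B can only raise
            \<open>eta\<close>.\<close>
          have "(eta t (\<theta> + S) - e') * wt t r (\<theta> + S) \<le> (eta t (S + B) - e') * wt t r (\<theta> + S)"
            using eta_le_iff[OF t, of "\<theta> + S" "S + B"] S \<theta> B wt_pos[OF t, of "\<theta> + S" r]
            by (intro mult_right_mono) auto
          also have "\<dots> = (eta t (S + B) - e') * (R S * ((1 + t * (S + B)) * wt t r (S + B)))"
            using p by (intro arg_cong[where f = "(*) _"] nonzero_eq_divide_eq[THEN iffD1, symmetric])
              (auto simp: R_def)
          also have "\<dots> = R S * ?b S" by (simp only: mult_ac)
          \<comment> \<open>Chebyshev argument: \<open>R\<close> decreases while \<open>?b\<close>
            changes sign from minus to plus at \<open>S0\<close>, so freezing \<open>R\<close> there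
            can only increase the product.\<close>
          also have "\<dots> \<le> R S0 * ?b S"
          proof (cases "S \<ge> S0")
            case True
            hence "R S \<le> R S0" unfolding R_def using wt_ratio_antimono[OF t r \<theta> S0(1)] by blast
            moreover have "e' \<le> eta t (S + B)"
              using True S0 T eta_le_iff[OF t, of T "S + B"] etaT by auto
            ultimately show ?thesis using p by (intro mult_right_mono mult_nonneg_nonneg[OF _ less_imp_le[OF p]]) auto
          next
            case False
            hence "R S0 \<le> R S" unfolding R_def using wt_ratio_antimono[OF t r \<theta> S] by simp
            moreover have "eta t (S + B) \<le> e'"
              using False S0 T S B eta_le_iff[OF t, of "S + B" T] etaT by auto
            ultimately show ?thesis by (intro mult_right_mono_neg mult_nonpos_nonneg[OF _ less_imp_le[OF p]]) auto
          qed
          finally show "(eta t (\<theta> + S) - e') * wt t r (\<theta> + S) \<le> R S0 * ?b S" .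
        qed
        also have "\<dots> = R S0 * (\<integral>S. ?b S \<partial>Q k)" by simp
        also have "\<dots> \<le> c0 * (\<integral>S. ?b S \<partial>Q k)"
        proof (rule mult_right_mono_neg)
          \<comment> \<open>Since \<theta> + S0 <= T, dropping the quotient of weights leaves the
            lower bound \<open>c0\<close> for \<open>R S0\<close>. It is free of \<theta>, and
            multiplying the negative integral by it gives the uniform gap.\<close>
          have "wt t r T \<le> wt t r (\<theta> + S0)"
            using wt_antimono[OF t r, of "\<theta> + S0" T] \<theta> S0 by auto
          moreover have "wt t r T > 0" "1 + t * T > 0"
            using wt_pos[OF t, of T r] T t by (auto simp: add_pos_nonneg)
          ultimately have "wt t r T / ((1 + t * T) * wt t r T) \<le> wt t r (\<theta> + S0) / ((1 + t * T) * wt t r T)"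
            by (intro divide_right_mono) auto
          thus "c0 \<le> R S0" unfolding R_def c0_def S0
            using \<open>wt t r T > 0\<close> by simp
        qed (use neg in simp)
        finally show ?thesis .
      qed
      have "(\<integral>\<theta>. G \<theta> \<partial>P) \<le> (\<integral>\<theta>. c0 * (\<integral>S. ?b S \<partial>Q k) * 1 \<partial>P)"
      proof (rule integral_mono_AE[OF intG])
        show "AE \<theta> in P. G \<theta> \<le> c0 * (\<integral>S. ?b S \<partial>Q k) * 1"
          using AE_P by eventually_elim (use G in auto)
      qed auto
      also have "\<dots> = c0 * (\<integral>S. ?b S \<partial>Q k) * (B powr a / a)"
        by (subst integral_mult_right_zero) (simp only: P_moments)
      also have "\<dots> < 0" using c0 neg a B by (intro mult_neg_pos mult_pos_neg) auto
      finally show False using \<open>(\<integral>\<theta>. G \<theta> \<partial>P) = 0\<close> by simp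
    qed
  qed
  \<comment> \<open>Lowering the centring from the mean to e raises the integrand; the slack is
    needed because e will be a fraction of the mean.\<close>
  also have "\<dots> \<le> (\<integral>S. (eta t (S + B) - e) * ((1 + t * (S + B)) * wt t r (S + B)) \<partial>Q k)"
  proof (rule Q_integral_mono[OF ib ib])
    fix S :: real assume S: "0 \<le> S"
    show "?b S \<le> (eta t (S + B) - e) * ((1 + t * (S + B)) * wt t r (S + B))"
      using e wt_pos[OF t, of "S + B" r] S B t
      by (intro mult_right_mono mult_nonneg_nonneg) (auto simp: e'_def)
  qed
  finally show ?thesis .
qed

text \<open>In terms of \<omega> = wt / (1 + t x) the two integrands are x^2 \<omega> and x
  \<omega>. As \<omega> decreases, the weight favours small x, and the unweighted second moment
  bound survives.\<close>

lemma weighted_moment_le: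
  assumes t: "t \<ge> 0" and r: "r \<ge> 0"
  shows "(\<integral>x. (x * eta t x) * wt t r x \<partial>Q k) \<le> (a + 1) / (a + 2) * real k * B * U k 1 t r"
proof -
  define c where "c = (a + 1) / (a + 2) * real k * B"
  have c: "c \<ge> 0" using a B by (simp add: c_def)
  define \<omega> where "\<omega> = (\<lambda>x. wt t r x / (1 + t * x))"
  have anti: "\<omega> y \<le> \<omega> x" if "0 \<le> x" "x \<le> y" for x y
    unfolding \<omega>_def using that wt_antimono[OF t r that] wt_pos[OF t, of y r] t
    by (intro frac_le) (auto intro!: add_pos_nonneg mult_left_mono)
  have iT: "integrable (Q k) (\<lambda>x. (x * eta t x) * wt t r x)"
    using t by (intro integrable_Q_wt continuous_intros continuous_on_eta) auto
  have "(\<integral>x. (x * eta t x) * wt t r x - c * (eta t x ^ 1 * wt t r x) \<partial>Q k)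
      \<le> (\<integral>x. \<omega> c * (x\<^sup>2 - c * x ^ 1) \<partial>Q k)"
  proof (rule Q_integral_mono)
    fix x :: real assume x: "0 \<le> x"
    \<comment> \<open>The factor x - c changes sign at c, so a decreasing weight may be replaced by
      its value there.\<close>
    have "x * ((x - c) * \<omega> x) \<le> x * ((x - c) * \<omega> c)"
    proof (rule mult_left_mono)
      show "(x - c) * \<omega> x \<le> (x - c) * \<omega> c"
        using anti[of x c] anti[of c x] x c
        by (cases "x \<le> c") (auto intro: mult_left_mono mult_left_mono_neg)
    qed (use x in auto)
    moreover have "(x * eta t x) * wt t r x - c * (eta t x ^ 1 * wt t r x) = x * ((x - c) * \<omega> x)"
      by (simp add: eta_def \<omega>_def algebra_simps diff_divide_distrib)
    ultimately show "(x * eta t x) * wt t r x - c * (eta t x ^ 1 * wt t r x) \<le> \<omega> c * (x\<^sup>2 - c * x ^ 1)"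
      by (simp add: algebra_simps power2_eq_square)
  next
    show "integrable (Q k) (\<lambda>x. (x * eta t x) * wt t r x - c * (eta t x ^ 1 * wt t r x))"
      using iT integrable_U[OF t, of k 1 r] by auto
    show "integrable (Q k) (\<lambda>x. \<omega> c * (x\<^sup>2 - c * x ^ 1))"
      by (intro integrable_mult_right Bochner_Integration.integrable_diff integrable_Q_power)
  qed
  also have "\<dots> = \<omega> c * ((\<integral>x. x\<^sup>2 \<partial>Q k) - c * (\<integral>x. x \<partial>Q k))"
    using integrable_Q_power[of k 1] integrable_Q_power[of k 2] by simp
  also have "\<dots> \<le> 0"
  proof (rule mult_nonneg_nonpos)
    show "\<omega> c \<ge> 0" using wt_pos[OF t c, of r] t c by (simp add: \<omega>_def)
  qed (use Q_second_moment_le[of k] in \<open>simp add: c_def\<close>)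
  finally show ?thesis
    unfolding c_def[symmetric] using iT integrable_U[OF t, of k 1 r] by (simp add: U_def)
qed

text \<open>For u(x) = \<open>U k 0 t\<close> at r = |x|^2 the gradient is -x \<open>U k 1\<close>
  and the Laplacian is r \<open>U k 2\<close> - d \<open>U k 1\<close> with d = 2a + 2. The claim is
  therefore u Lap u <= (1 - 1/(2k)) |grad u|^2, superharmonicity of u^(1/(2k)).\<close>

theorem U_inequality:
  assumes t: "t \<ge> 0" and r: "r \<ge> 0" and k: "k \<ge> 1"
    and tk: "t * (real k * (real k - 1)) * B \<le> (a + 2) / (2 * (a + 1))"
  shows "r * (U k 0 t r * U k 2 t r - (1 - 1 / (2 * real k)) * (U k 1 t r)\<^sup>2)
    \<le> (2 * a + 2) * (U k 0 t r * U k 1 t r)"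
proof -
  define \<kappa> where "\<kappa> = 1 - 1 / (2 * real k)"
  have \<kappa>: "0 \<le> \<kappa>" "\<kappa> \<le> 1" using k by (auto simp: \<kappa>_def field_simps)
  define I0 where "I0 = U k 0 t r"
  define I1 where "I1 = U k 1 t r"
  define I2 where "I2 = U k 2 t r"
  define T where "T = (\<integral>x. (x * eta t x) * wt t r x \<partial>Q k)"
  define X where "X = (\<integral>x. x * wt t r x \<partial>Q k)"
  have I0: "I0 > 0" unfolding I0_def by (rule U_0_pos[OF t])
  have I1: "I1 \<ge> 0" unfolding I1_def by (rule U_nonneg[OF t])
  \<comment> \<open>Chosen so that \<open>I2 - e * I1\<close> is the left-hand side of the claim
    divided by r \<open>I0\<close>. Since \<kappa> <= 1 it does not exceed the mean, as the boundary
    term requires.\<close>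
  define e where "e = \<kappa> * (I1 / I0)"
  have e0: "e \<ge> 0" using \<kappa> I0 I1 by (simp add: e_def)
  have eI0: "e * I0 = \<kappa> * I1" using I0 by (simp add: e_def)
  have iT: "integrable (Q k) (\<lambda>x. (x * eta t x) * wt t r x)"
    using t by (intro integrable_Q_wt continuous_intros continuous_on_eta) auto
  have iX: "integrable (Q k) (\<lambda>x. x * wt t r x)"
    using t by (intro integrable_Q_wt continuous_intros) auto
  note iU = integrable_U[OF t, of k 0 r] integrable_U[OF t, of k 1 r] integrable_U[OF t, of k 2 r]
  have X: "X = I1 + t * T"
  proof -
    have "X = (\<integral>x. eta t x ^ 1 * wt t r x + t * ((x * eta t x) * wt t r x) \<partial>Q k)"
      unfolding X_def
    proof (rule integral_cong_AE)
      show "AE x in Q k. x * wt t r x = eta t x ^ 1 * wt t r x + t * ((x * eta t x) * wt t r x)"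
        using AE_Q
      proof eventually_elim
        case (elim x)
        thus ?case using arg_cong[OF eta_eq[OF t, of x], of "\<lambda>y. y * wt t r x"]
          by (simp add: algebra_simps)
      qed
    qed measurable
    also have "\<dots> = I1 + t * T"
      using iT iU by (simp add: I1_def U_def T_def)
    finally show ?thesis .
  qed
  have X0: "X \<ge> 0"
    using Q_integral_mono[of k "\<lambda>_. 0", OF _ iX] wt_pos[OF t, of _ r] by (simp add: X_def less_imp_le)
  \<comment> \<open>The test function is (eta - e)(1 + t x) wt, written without denominators. The
    factor 1 + t x cancels one power in the derivative of \<open>eta\<close>, so that the r-term
    becomes eta (eta - e) wt.\<close>
  define h where "h = (\<lambda>x. (x - e * (1 + t * x)) * wt t r x)"
  define h' where "h' = (\<lambda>x. (1 - e * t) * wt t r x + (x - e * (1 + t * x)) *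
    (wt t r x * (- (a + 1) * t / (1 + t * x) - r / 2 / (1 + t * x)\<^sup>2)))"
  have nz: "1 + t * x \<noteq> 0" if "x \<ge> 0" for x using add_pos_nonneg[of 1 "t * x"] t that by auto
  have "(\<integral>x. real k * a * h x + x * h' x \<partial>Q k) = real k * B powr a * (\<integral>x. h (x + B) \<partial>Q (k - 1))"
  proof (rule integral_Q_by_parts)
    show "(h has_real_derivative h' x) (at x within {0..})" if "x \<ge> 0" for x
      unfolding h_def h'_def
      by (rule derivative_eq_intros DERIV_wt[OF t that] refl | simp add: algebra_simps)+
    show "continuous_on {0..} h'"
      unfolding h'_def using nz by (intro continuous_intros continuous_on_wt[OF t]) auto
  qed (simp_all add: h_def h'_def)
  also have "\<dots> \<ge> 0"
  proof -
    obtain l where l: "k = Suc l" using k by (cases k) auto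
    have "(\<integral>x. h (x + B) \<partial>Q l) = (\<integral>S. (eta t (S + B) - e) * ((1 + t * (S + B)) * wt t r (S + B)) \<partial>Q l)"
    proof (rule integral_cong_AE)
      show "AE x in Q l. h (x + B) = (eta t (x + B) - e) * ((1 + t * (x + B)) * wt t r (x + B))"
        using AE_Q
      proof eventually_elim
        case (elim x)
        hence "eta t (x + B) * (1 + t * (x + B)) = x + B" using nz[of "x + B"] B by (simp add: eta_def)
        hence "x + B - e * (1 + t * (x + B)) = (eta t (x + B) - e) * (1 + t * (x + B))"
          by (simp add: algebra_simps)
        thus ?case unfolding h_def by simp
      qed
    qed (simp_all add: h_def)
    also have "\<dots> \<ge> 0"
    proof (rule boundary_term_nonneg[OF t r])
      show "e \<le> U (Suc l) 1 t r / U (Suc l) 0 t r"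
        using \<kappa> I0 I1 unfolding e_def l[symmetric] I0_def[symmetric] I1_def[symmetric]
        by (intro mult_left_le_one_le) auto
    qed
    finally show ?thesis using l by (intro mult_nonneg_nonneg) auto
  qed
  finally have "0 \<le> (\<integral>x. real k * a * h x + x * h' x \<partial>Q k)" .
  \<comment> \<open>Pointwise on the support: substituting x = eta (1 + t x) removes all
    denominators from x h'.\<close>
  also have "\<dots> = (\<integral>x. (real k * a * (1 - e * t) + 1 - e * t + (a + 1) * e * t) * (x * wt t r x)
      - real k * a * e * (eta t x ^ 0 * wt t r x) - (a + 1) * t * ((x * eta t x) * wt t r x)
      - (r / 2) * (eta t x ^ 2 * wt t r x) + (r / 2) * e * (eta t x ^ 1 * wt t r x) \<partial>Q k)"
  proof (rule integral_cong_AE)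
    show "AE x in Q k. real k * a * h x + x * h' x
      = (real k * a * (1 - e * t) + 1 - e * t + (a + 1) * e * t) * (x * wt t r x)
      - real k * a * e * (eta t x ^ 0 * wt t r x) - (a + 1) * t * ((x * eta t x) * wt t r x)
      - (r / 2) * (eta t x ^ 2 * wt t r x) + (r / 2) * e * (eta t x ^ 1 * wt t r x)"
      using AE_Q
    proof eventually_elim
      case (elim x)
      define y where "y = 1 + t * x"
      define n where "n = eta t x"
      have y: "y \<noteq> 0" using nz[of x] elim by (simp add: y_def)
      have n: "x = n * y" using y by (simp add: n_def eta_def y_def)
      have "x * ((x - e * y) * (wt t r x * (- (a + 1) * t / y - r / 2 / y\<^sup>2)))
          = wt t r x * (x * (n - e) * (- (a + 1) * t) - (r / 2) * n * (n - e))"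
        using y unfolding n by (simp add: field_simps power2_eq_square)
      hence "real k * a * h x + x * h' x = wt t r x * (real k * a * (x - e * (1 + t * x))
          + x * (1 - e * t) + (x * (n - e) * (- (a + 1) * t) - (r / 2) * n * (n - e)))"
        unfolding h_def h'_def y_def by (simp add: algebra_simps)
      moreover define q where "q = r / 2"
      ultimately show ?case unfolding n_def[symmetric] q_def[symmetric]
        by (simp add: algebra_simps power2_eq_square)
    qed
  qed (simp_all add: h_def h'_def)
  also have "\<dots> = (real k * a * (1 - e * t) + 1 - e * t + (a + 1) * e * t) * X
      - real k * a * (e * I0) - (a + 1) * t * T - (r / 2) * I2 + (r / 2) * e * I1"
    using iU iT iX unfolding X_def T_def I0_def I1_def I2_def U_def by simp
  finally have "0 \<le> (real k * a * (1 - e * t) + 1 - e * t + (a + 1) * e * t) * (I1 + t * T)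
      - real k * a * (\<kappa> * I1) - (a + 1) * t * T - (r / 2) * I2 + (r / 2) * e * I1"
    unfolding eI0 X .
  moreover define q where "q = r / 2"
  \<comment> \<open>The multiples of tT add up to k a + 1 from \<open>X\<close> less a + 1 from
    differentiating the weight, that is (k - 1) a.\<close>
  ultimately have "(r / 2) * (I2 - e * I1) \<le> real k * a * (1 - \<kappa>) * I1 + I1 + (real k - 1) * a * t * T
      - (real k - 1) * a * t * e * X"
    unfolding X q_def[symmetric] by (simp add: algebra_simps)
  moreover have "real k * a * (1 - \<kappa>) = a / 2" using k by (simp add: \<kappa>_def)
  ultimately have "(r / 2) * (I2 - e * I1) \<le> a / 2 * I1 + I1 + (real k - 1) * a * t * T
      - (real k - 1) * a * t * e * X" by simp
  moreover have "(real k - 1) * a * t * e * X \<ge> 0"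
    using k a t e0 X0 by (intro mult_nonneg_nonneg) auto
  moreover have "(real k - 1) * a * t * T \<le> a / 2 * I1"
  proof -
    have "T \<le> (a + 1) / (a + 2) * real k * B * I1"
      unfolding T_def I1_def by (rule weighted_moment_le[OF t r])
    hence "(real k - 1) * a * t * T \<le> (real k - 1) * a * t * ((a + 1) / (a + 2) * real k * B * I1)"
      using k a t by (intro mult_left_mono) auto
    also have "\<dots> = a * I1 * ((a + 1) / (a + 2)) * (t * (real k * (real k - 1)) * B)"
      by (simp only: mult_ac)
    also have "\<dots> \<le> a * I1 * ((a + 1) / (a + 2)) * ((a + 2) / (2 * (a + 1)))"
      using tk a I1 by (intro mult_left_mono) auto
    also have "\<dots> = a * I1 * ((a + 1) / (a + 2) * ((a + 2) / (2 * (a + 1))))"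
      by (simp only: mult.assoc)
    also have "(a + 1) / (a + 2) * ((a + 2) / (2 * (a + 1))) = 1 / 2"
      using a by (simp add: divide_simps)
    also have "a * I1 * (1 / 2) = a / 2 * I1" by simp
    finally show ?thesis .
  qed
  \<comment> \<open>The budget is exactly d/2 = a + 1: a/2 from 1 - \<kappa>, 1 from differentiating
    the linear factor of \<open>h\<close>, and a/2 from the bound on t.\<close>
  ultimately have "(r / 2) * (I2 - e * I1) \<le> a / 2 * I1 + I1 + a / 2 * I1" by linarith
  hence "(r / 2) * (I2 - e * I1) \<le> (a + 1) * I1" by (simp add: algebra_simps)
  hence "(r / 2) * (I2 - e * I1) * (2 * I0) \<le> (a + 1) * I1 * (2 * I0)"
    using I0 by (intro mult_right_mono) auto
  hence "r * (I0 * I2 - (e * I0) * I1) \<le> (2 * a + 2) * (I0 * I1)"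
    by (simp add: algebra_simps)
  thus ?thesis unfolding eI0 \<kappa>_def[symmetric] I0_def[symmetric] I1_def[symmetric] I2_def[symmetric]
    by (simp add: power2_eq_square mult.assoc)
qed

end

section \<open>Gaussian integrals\<close>

lemma phi_measurable [measurable]:
  assumes "f \<in> borel_measurable M"
  shows "(\<lambda>x. phi (f x) s) \<in> borel_measurable M"
proof (rule measurable_compose[OF assms])
  show "(\<lambda>x. phi x s) \<in> borel_measurable borel"
    unfolding phi_def divide_inverse by (intro borel_measurable_continuous_onI continuous_intros)
qed

lemma phi_nonneg: "phi x s \<ge> 0"
  by (simp add: phi_def)

lemma phi_pos: "s > 0 \<Longrightarrow> phi x s > 0"
  by (simp add: phi_def)

lemma phi_minus: "phi (- x) s = phi x s"
  by (simp add: phi_def)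

lemma phi_eq_prod_normal_density:
  fixes x :: "real ^ 'n"
  assumes "s > 0"
  shows "phi x s = (\<Prod>b\<in>Basis. normal_density 0 (sqrt s) (x \<bullet> b))"
proof -
  have "(\<Prod>b\<in>(Basis :: (real ^ 'n) set). normal_density 0 (sqrt s) (x \<bullet> b))
      = (1 / sqrt (2 * pi * s)) ^ CARD('n) * exp (- (\<Sum>b\<in>Basis. (x \<bullet> b)\<^sup>2) / (2 * s))"
    using assms unfolding normal_density_def
    by (simp add: prod.distrib exp_sum[symmetric] sum_negf sum_divide_distrib[symmetric] prod_dividef power_divide)
  also have "(1 / sqrt (2 * pi * s)) ^ CARD('n) = (2 * pi * s) powr (- real CARD('n) / 2)"
  proof -
    have "1 / sqrt (2 * pi * s) = (2 * pi * s) powr (- (1 / 2))"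
      using assms by (simp add: powr_minus_divide powr_half_sqrt)
    hence "(1 / sqrt (2 * pi * s)) ^ CARD('n) = ((2 * pi * s) powr (- (1 / 2))) powr real CARD('n)"
      using assms by (simp add: powr_realpow)
    thus ?thesis by (simp add: powr_powr)
  qed
  also have "(\<Sum>b\<in>Basis. (x \<bullet> b)\<^sup>2) = (norm x)\<^sup>2"
    unfolding power2_norm_eq_inner by (subst euclidean_inner) (simp add: power2_eq_square)
  finally show ?thesis by (simp add: phi_def)
qed

lemma nn_integral_phi:
  assumes "s > 0"
  shows "(\<integral>\<^sup>+x. ennreal (phi (x :: real ^ 'n) s) \<partial>lborel) = 1"
proof -
  have "(\<integral>\<^sup>+x. ennreal (phi (x :: real ^ 'n) s) \<partial>lborel)
      = (\<integral>\<^sup>+x. (\<Prod>b\<in>Basis. ennreal (normal_density 0 (sqrt s) (x \<bullet> b))) \<partial>(lborel :: (real ^ 'n) measure))"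
    using assms by (simp add: phi_eq_prod_normal_density prod_ennreal)
  also have "\<dots> = (\<Prod>b\<in>(Basis :: (real ^ 'n) set). \<integral>\<^sup>+x. ennreal (normal_density 0 (sqrt s) x) \<partial>lborel)"
    by (rule nn_integral_lborel_prod) auto
  also have "(\<integral>\<^sup>+x. ennreal (normal_density 0 (sqrt s) x) \<partial>lborel) = 1"
    using assms by (subst nn_integral_eq_integral) auto
  finally show ?thesis by simp
qed

lemma integrable_phi:
  assumes "s > 0"
  shows "integrable lborel (\<lambda>x :: real ^ 'n. phi x s)"
proof (rule integrableI_nonneg)
  show "(\<integral>\<^sup>+x. ennreal (phi (x :: real ^ 'n) s) \<partial>lborel) < \<infinity>"
    by (simp only: nn_integral_phi[OF assms]) simp
  show "AE x :: real ^ 'n in lborel. 0 \<le> phi x s"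
    by (rule AE_I2, rule phi_nonneg)
qed measurable

lemma integral_phi:
  assumes "s > 0"
  shows "(\<integral>x. phi (x :: real ^ 'n) s \<partial>lborel) = 1"
proof -
  have "(\<integral>\<^sup>+x. ennreal (phi (x :: real ^ 'n) s) \<partial>lborel) = ennreal (\<integral>x. phi (x :: real ^ 'n) s \<partial>lborel)"
    by (rule nn_integral_eq_integral[OF integrable_phi[OF assms]]) (simp add: phi_nonneg)
  thus ?thesis by (simp only: nn_integral_phi[OF assms]) simp
qed

lemma nn_integral_affine:
  fixes f :: "'a::euclidean_space \<Rightarrow> ennreal"
  assumes [measurable]: "f \<in> borel_measurable borel" and c: "c \<noteq> 0"
  shows "(\<integral>\<^sup>+x. f x \<partial>lborel) = ennreal (\<bar>c\<bar> ^ DIM('a)) * (\<integral>\<^sup>+x. f (t + c *\<^sub>R x) \<partial>lborel)"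
  by (subst lborel_affine[OF c, of t])
     (simp add: nn_integral_density nn_integral_distr nn_integral_cmult)

lemma nn_integral_translate:
  fixes f :: "'a::euclidean_space \<Rightarrow> ennreal"
  assumes [measurable]: "f \<in> borel_measurable borel"
  shows "(\<integral>\<^sup>+x. f (x + t) \<partial>lborel) = (\<integral>\<^sup>+x. f x \<partial>lborel)"
  using nn_integral_affine[of f 1 t] by (simp add: add.commute)

lemma lborel_integral_affine:
  fixes f :: "'a::euclidean_space \<Rightarrow> real"
  assumes [measurable]: "f \<in> borel_measurable borel" and c: "c \<noteq> 0"
  shows "(\<integral>x. f x \<partial>lborel) = \<bar>c\<bar> ^ DIM('a) * (\<integral>x. f (t + c *\<^sub>R x) \<partial>lborel)"
proof -
  have "(\<integral>x. f x \<partial>lborel)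
      = (\<integral>x. f x \<partial>density (distr lborel borel (\<lambda>x::'a. t + c *\<^sub>R x)) (\<lambda>_. ennreal (\<bar>c\<bar> ^ DIM('a))))"
    by (subst lborel_affine[OF c, of t, symmetric]) (rule refl)
  also have "\<dots> = \<bar>c\<bar> ^ DIM('a) * (\<integral>x. f (t + c *\<^sub>R x) \<partial>lborel)"
    by (subst integral_density) (auto simp: integral_distr)
  finally show ?thesis .
qed

lemma lborel_integral_translate:
  fixes f :: "'a::euclidean_space \<Rightarrow> real"
  assumes [measurable]: "f \<in> borel_measurable borel"
  shows "(\<integral>x. f (x + t) \<partial>lborel) = (\<integral>x. f x \<partial>lborel)"
  using lborel_integral_affine[of f 1 t] by (simp add: add.commute)

lemma phi_scale:
  fixes z :: "real ^ 'n"
  assumes "s > 0"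
  shows "sqrt s ^ CARD('n) * phi (sqrt s *\<^sub>R z) s = phi z 1"
proof -
  have "sqrt s ^ CARD('n) * (2 * pi * s) powr (- real CARD('n) / 2) = (2 * pi) powr (- real CARD('n) / 2)"
  proof -
    have "sqrt s ^ CARD('n) = s powr (real CARD('n) / 2)"
      using assms by (simp add: powr_half_sqrt[symmetric] powr_powr flip: powr_realpow)
    thus ?thesis using assms by (simp add: powr_mult powr_minus field_simps)
  qed
  moreover have "(norm (sqrt s *\<^sub>R z))\<^sup>2 / (2 * s) = (norm z)\<^sup>2 / 2"
    using assms by (simp add: power_mult_distrib)
  ultimately show ?thesis by (simp add: phi_def mult.assoc[symmetric])
qed

lemma integrable_exp_norm:
  assumes c: "c > 0"
  shows "integrable lborel (\<lambda>x :: real ^ 'n. exp (- c * (norm x)\<^sup>2))"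
proof -
  define s where "s = 1 / (2 * c)"
  have s: "s > 0" using c by (simp add: s_def)
  define K where "K = (2 * pi * s) powr (- real CARD('n) / 2)"
  have K: "K > 0" using s by (simp add: K_def)
  have eq: "phi x s / K = exp (- c * (norm x)\<^sup>2)" for x :: "real ^ 'n"
    unfolding phi_def K_def[symmetric] using K c by (simp add: s_def mult.commute)
  have "integrable lborel (\<lambda>x :: real ^ 'n. phi x s / K)"
    by (rule integrable_divide[OF integrable_phi[OF s]])
  thus ?thesis by (simp only: eq)
qed

text \<open>Bayes' rule for a Gaussian observation w of x with prior precision \<theta>: the
  right-hand side is marginal times posterior, with posterior mean w/(1 + v \<theta>) and variance
  v/(1 + v \<theta>).\<close>

lemma gaussian_product:
  fixes w x :: "real ^ 'n"
  assumes v: "v > 0" and \<theta>: "\<theta> \<ge> 0"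
  shows "phi (w - x) v * exp (- (\<theta> * (norm x)\<^sup>2 / 2))
    = (1 + v * \<theta>) powr (- real CARD('n) / 2) * exp (- (eta v \<theta> * (norm w)\<^sup>2 / 2))
      * phi (x - (1 / (1 + v * \<theta>)) *\<^sub>R w) (v / (1 + v * \<theta>))"
proof -
  define y where "y = 1 + v * \<theta>"
  have y: "y > 0" using v \<theta> by (simp add: y_def add_pos_nonneg)
  have 1: "(2 * pi * v) powr (- real CARD('n) / 2)
      = y powr (- real CARD('n) / 2) * (2 * pi * (v / y)) powr (- real CARD('n) / 2)"
    using y v by (subst powr_mult[symmetric]) auto
  have 2: "(norm (w - x))\<^sup>2 / (2 * v) + \<theta> * (norm x)\<^sup>2 / 2
      = \<theta> / y * (norm w)\<^sup>2 / 2 + (norm (x - (1 / y) *\<^sub>R w))\<^sup>2 / (2 * (v / y))"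
  proof -
    define W where "W = w \<bullet> w" define Z where "Z = x \<bullet> x" define V where "V = w \<bullet> x"
    have e1: "(norm (w - x))\<^sup>2 = W - 2 * V + Z"
      by (simp add: power2_norm_eq_inner inner_diff_left inner_diff_right W_def Z_def V_def inner_commute)
    have e2: "(norm (x - (1 / y) *\<^sub>R w))\<^sup>2 = Z - 2 * V / y + W / y\<^sup>2"
      by (simp add: power2_norm_eq_inner inner_diff_left inner_diff_right W_def Z_def V_def inner_commute)
         (simp add: power2_eq_square)
    have \<theta>y: "\<theta> = (y - 1) / v" using v by (simp add: y_def)
    have e3: "(norm w)\<^sup>2 = W" "(norm x)\<^sup>2 = Z" by (simp_all add: power2_norm_eq_inner W_def Z_def)
    show ?thesis unfolding e1 e2 e3 \<theta>y using y v
      by (simp add: divide_simps) (simp add: algebra_simps power2_eq_square)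
  qed
  have "phi (w - x) v * exp (- (\<theta> * (norm x)\<^sup>2 / 2))
      = (2 * pi * v) powr (- real CARD('n) / 2) * exp (- ((norm (w - x))\<^sup>2 / (2 * v) + \<theta> * (norm x)\<^sup>2 / 2))"
    by (simp add: phi_def exp_add[symmetric] minus_add_distrib)
  also have "\<dots> = y powr (- real CARD('n) / 2) * exp (- (\<theta> / y * (norm w)\<^sup>2 / 2)) * phi (x - (1 / y) *\<^sub>R w) (v / y)"
    unfolding 1 2 by (simp only: phi_def minus_add_distrib exp_add minus_divide_left mult_ac)
  finally show ?thesis by (simp add: y_def eta_def)
qed

lemma nn_integral_phi_translate:
  fixes w :: "real ^ 'n"
  shows "s > 0 \<Longrightarrow> (\<integral>\<^sup>+x. ennreal (phi (x - w) s) \<partial>lborel) = 1"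
  using nn_integral_translate[of "\<lambda>x. ennreal (phi x s)" "- w"] nn_integral_phi[of s] by simp

lemma integrable_phi_translate:
  fixes w :: "real ^ 'n"
  assumes "s > 0"
  shows "integrable lborel (\<lambda>x. phi (x - w) s)"
  using integrable_phi[OF assms] by (subst (asm) lborel_distr_plus[of "- w", symmetric])
    (simp add: integrable_distr_eq)

lemma integral_phi_translate:
  fixes w :: "real ^ 'n"
  shows "s > 0 \<Longrightarrow> (\<integral>x. phi (x - w) s \<partial>lborel) = 1"
  using lborel_integral_translate[of "\<lambda>x. phi x s" "- w"] integral_phi[of s, where 'n = 'n] by simp

lemma nn_integral_gaussian_product:
  fixes w :: "real ^ 'n"
  assumes v: "v > 0" and \<theta>: "\<theta> \<ge> 0"
  shows "(\<integral>\<^sup>+x. ennreal (phi (w - x) v * exp (- (\<theta> * (norm x)\<^sup>2 / 2))) \<partial>lborel)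
    = ennreal ((1 + v * \<theta>) powr (- real CARD('n) / 2) * exp (- (eta v \<theta> * (norm w)\<^sup>2 / 2)))"
proof -
  have "v / (1 + v * \<theta>) > 0" using v \<theta> by (simp add: add_pos_nonneg)
  from nn_integral_phi_translate[OF this, of "(1 / (1 + v * \<theta>)) *\<^sub>R w"] show ?thesis
    unfolding gaussian_product[OF assms]
    by (simp add: ennreal_mult'' phi_nonneg nn_integral_cmult)
qed

section \<open>Derivatives and growth of the mixtures\<close>

context power_mix
begin

lemma wt_le_exp:
  assumes "t \<ge> 0" "0 \<le> x" "x \<le> real k * B" "\<bar>r\<bar> \<le> C"
  shows "wt t r x \<le> exp (real k * B * C / 2)"
proof -
  have y: "1 + t * x \<ge> 1" using assms by simp
  have e: "0 \<le> eta t x" "eta t x \<le> real k * B"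
    using eta_nonneg[of t x] eta_le[of t x] assms by auto
  have "(1 + t * x) powr (- (a + 1)) \<le> (1 + t * x) powr 0"
    using y a by (intro powr_mono) auto
  hence "(1 + t * x) powr (- (a + 1)) \<le> 1" using y by auto
  moreover have "- (eta t x * r / 2) \<le> real k * B * C / 2"
  proof -
    have "- (eta t x * r) \<le> eta t x * \<bar>r\<bar>" using e by (simp add: abs_if)
    also have "\<dots> \<le> real k * B * C" using e assms by (intro mult_mono) auto
    finally show ?thesis by simp
  qed
  hence "exp (- (eta t x * r / 2)) \<le> exp (real k * B * C / 2)" by simp
  ultimately have "(1 + t * x) powr (- (a + 1)) * exp (- (eta t x * r / 2)) \<le> 1 * exp (real k * B * C / 2)"
    by (intro mult_mono) auto
  thus ?thesis by (simp add: wt_def)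
qed

lemma DERIV_U:
  assumes t: "t \<ge> 0"
  shows "(U k j t has_real_derivative - (U k (Suc j) t r / 2)) (at r)"
proof -
  define C where "C = (real k * B) ^ Suc j * exp (real k * B * (\<bar>r\<bar> + 1) / 2)"
  have "((\<lambda>r. \<integral>x. eta t x ^ j * wt t r x \<partial>Q k) has_real_derivative
      (\<integral>x. - (1/2) * (eta t x ^ Suc j * wt t r x) \<partial>Q k)) (at r)"
  proof (rule has_real_derivative_integral[where \<delta> = 1 and g = "\<lambda>_. C"])
    show "integrable (Q k) (\<lambda>x. eta t x ^ j * wt t r' x)" for r' by (rule integrable_U[OF t])
    show "AE x in Q k. \<forall>r'. \<bar>r' - r\<bar> < 1 \<longrightarrow> ((\<lambda>r. eta t x ^ j * wt t r x) has_real_derivative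
        - (1/2) * (eta t x ^ Suc j * wt t r' x)) (at r') \<and> \<bar>- (1/2) * (eta t x ^ Suc j * wt t r' x)\<bar> \<le> C"
      using AE_Q
    proof (eventually_elim, intro allI impI conjI)
      fix x r' :: real assume x: "0 \<le> x \<and> x \<le> real k * B" and r': "\<bar>r' - r\<bar> < 1"
      show "((\<lambda>r. eta t x ^ j * wt t r x) has_real_derivative
        - (1/2) * (eta t x ^ Suc j * wt t r' x)) (at r')"
        unfolding wt_def by (auto intro!: derivative_eq_intros)
      have e: "0 \<le> eta t x" "eta t x \<le> real k * B"
        using eta_nonneg[of t x] eta_le[of t x] t x by auto
      have w: "0 \<le> wt t r' x" "wt t r' x \<le> exp (real k * B * (\<bar>r\<bar> + 1) / 2)"
        using wt_le_exp[OF t, of x k r' "\<bar>r\<bar> + 1"] wt_pos[OF t, of x r'] x r' by auto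
      have "eta t x ^ Suc j * wt t r' x \<le> C"
        unfolding C_def using e w by (intro mult_mono power_mono) auto
      moreover have "0 \<le> eta t x ^ Suc j * wt t r' x"
        using e w by (intro mult_nonneg_nonneg) auto
      ultimately show "\<bar>- (1/2) * (eta t x ^ Suc j * wt t r' x)\<bar> \<le> C" by simp
    qed
  qed auto
  thus ?thesis by (simp add: U_def[abs_def])
qed

lemma U_measurable [measurable]: "t \<ge> 0 \<Longrightarrow> U k j t \<in> borel_measurable borel"
  by (intro borel_measurable_continuous_onI continuous_at_imp_continuous_on ballI DERIV_isCont[OF DERIV_U])

text \<open>In t, the logarithm of 1 + t x has derivative \<open>eta\<close> and \<open>eta\<close>
  has derivative -eta^2; the first bracket is thus half the Laplacian, the heat equation for U. Time
  is \<epsilon>^2 so that the path w + \<epsilon> z stays smooth at time 0.\<close>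

lemma DERIV_U_path:
  assumes \<rho>: "\<And>\<epsilon>. (\<rho> has_real_derivative \<rho>' \<epsilon>) (at \<epsilon>)" and \<rho>': "continuous_on UNIV \<rho>'"
  shows "((\<lambda>\<epsilon>. U k 0 (\<epsilon>\<^sup>2) (\<rho> \<epsilon>)) has_real_derivative
    2 * \<epsilon> * (- (a + 1) * U k 1 (\<epsilon>\<^sup>2) (\<rho> \<epsilon>) + \<rho> \<epsilon> / 2 * U k 2 (\<epsilon>\<^sup>2) (\<rho> \<epsilon>))
      - \<rho>' \<epsilon> / 2 * U k 1 (\<epsilon>\<^sup>2) (\<rho> \<epsilon>)) (at \<epsilon>)"
proof -
  define J where "J = {\<epsilon> - 1..\<epsilon> + 1}"
  have c\<rho>: "continuous_on J \<rho>" by (rule DERIV_continuous_on) (rule has_field_derivative_at_within[OF \<rho>])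
  have "compact (\<rho> ` J)" "compact (\<rho>' ` J)"
    by (intro compact_continuous_image c\<rho> continuous_on_subset[OF \<rho>']; simp add: J_def)+
  hence "bounded (\<rho> ` J)" "bounded (\<rho>' ` J)" by (simp_all add: compact_imp_bounded)
  then obtain C1 C2 where C1: "\<And>s. s \<in> J \<Longrightarrow> \<bar>\<rho> s\<bar> \<le> C1" and C2: "\<And>s. s \<in> J \<Longrightarrow> \<bar>\<rho>' s\<bar> \<le> C2"
    unfolding bounded_iff by (auto simp del: atLeastAtMost_iff)
  define M where "M = real k * B"
  have M: "M \<ge> 0" using B by (simp add: M_def)
  let ?f' = "\<lambda>s x. 2 * s * (- (a + 1) * (eta (s\<^sup>2) x ^ 1 * wt (s\<^sup>2) (\<rho> s) x)
        + \<rho> s / 2 * (eta (s\<^sup>2) x ^ 2 * wt (s\<^sup>2) (\<rho> s) x)) - \<rho>' s / 2 * (eta (s\<^sup>2) x ^ 1 * wt (s\<^sup>2) (\<rho> s) x)"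
  define C where "C = (2 * (\<bar>\<epsilon>\<bar> + 1) * ((a + 1) * M + C1 / 2 * M\<^sup>2) + C2 / 2 * M) * exp (M * C1 / 2)"
  have "((\<lambda>s. \<integral>x. eta (s\<^sup>2) x ^ 0 * wt (s\<^sup>2) (\<rho> s) x \<partial>Q k) has_real_derivative (\<integral>x. ?f' \<epsilon> x \<partial>Q k)) (at \<epsilon>)"
  proof (rule has_real_derivative_integral[where \<delta> = 1 and g = "\<lambda>_. C"])
    show "integrable (Q k) (\<lambda>x. eta (s\<^sup>2) x ^ 0 * wt (s\<^sup>2) (\<rho> s) x)" for s by (rule integrable_U) simp
    show "AE x in Q k. \<forall>s. \<bar>s - \<epsilon>\<bar> < 1 \<longrightarrow> ((\<lambda>s. eta (s\<^sup>2) x ^ 0 * wt (s\<^sup>2) (\<rho> s) x) has_real_derivative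
        ?f' s x) (at s) \<and> \<bar>?f' s x\<bar> \<le> C"
      using AE_Q
    proof (eventually_elim, intro allI impI conjI)
      fix x s :: real assume x: "0 \<le> x \<and> x \<le> real k * B" and s: "\<bar>s - \<epsilon>\<bar> < 1"
      have sJ: "s \<in> J" using s by (auto simp: J_def)
      have pos: "1 + s\<^sup>2 * x > 0" using x by (simp add: add_pos_nonneg)
      have y: "((\<lambda>s. 1 + s\<^sup>2 * x) has_real_derivative 2 * s * x) (at s)"
        by (auto intro!: derivative_eq_intros)
      have p: "((\<lambda>s. (1 + s\<^sup>2 * x) powr (- (a + 1))) has_real_derivative
          (1 + s\<^sup>2 * x) powr (- (a + 1)) * (- (a + 1) * (2 * s) * eta (s\<^sup>2) x)) (at s)"
      proof (rule DERIV_cong[OF DERIV_fun_powr[OF y pos, of "- (a + 1)"]])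
        have "(1 + s\<^sup>2 * x) powr (- (a + 1) - real 1) = (1 + s\<^sup>2 * x) powr (- (a + 1)) / (1 + s\<^sup>2 * x)"
          using pos powr_diff[of "1 + s\<^sup>2 * x" "- (a + 1)" 1] by simp
        thus "- (a + 1) * (1 + s\<^sup>2 * x) powr (- (a + 1) - real 1) * (2 * s * x)
            = (1 + s\<^sup>2 * x) powr (- (a + 1)) * (- (a + 1) * (2 * s) * eta (s\<^sup>2) x)"
          by (simp only: eta_def) simp
      qed
      have e: "((\<lambda>s. eta (s\<^sup>2) x) has_real_derivative - (eta (s\<^sup>2) x)\<^sup>2 * (2 * s)) (at s)"
        unfolding eta_def using pos
        by (auto intro!: derivative_eq_intros y simp: power2_eq_square)
      have ex: "((\<lambda>s. exp (- (eta (s\<^sup>2) x * \<rho> s / 2))) has_real_derivative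
          exp (- (eta (s\<^sup>2) x * \<rho> s / 2)) * (s * \<rho> s * (eta (s\<^sup>2) x)\<^sup>2 - \<rho>' s / 2 * eta (s\<^sup>2) x)) (at s)"
      proof -
        have "((\<lambda>s. - (eta (s\<^sup>2) x * \<rho> s / 2)) has_real_derivative
            s * \<rho> s * (eta (s\<^sup>2) x)\<^sup>2 - \<rho>' s / 2 * eta (s\<^sup>2) x) (at s)"
          by (rule DERIV_cong[OF DERIV_minus[OF DERIV_cdivide[OF DERIV_mult[OF e \<rho>]]]])
             (simp add: field_simps)
        thus ?thesis by (rule DERIV_fun_exp)
      qed
      show "((\<lambda>s. eta (s\<^sup>2) x ^ 0 * wt (s\<^sup>2) (\<rho> s) x) has_real_derivative ?f' s x) (at s)"
        unfolding wt_def power_0 mult_1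
        by (rule DERIV_cong[OF DERIV_mult[OF p ex]]) (simp add: algebra_simps)
      define n where "n = eta (s\<^sup>2) x"
      define w where "w = wt (s\<^sup>2) (\<rho> s) x"
      have n: "0 \<le> n" "n \<le> M"
        using eta_nonneg[of "s\<^sup>2" x] eta_le[of "s\<^sup>2" x] x by (auto simp: n_def M_def)
      have w: "0 \<le> w" "w \<le> exp (M * C1 / 2)"
        using wt_le_exp[of "s\<^sup>2" x k "\<rho> s" C1] wt_pos[of "s\<^sup>2" x "\<rho> s"] x C1[OF sJ]
        by (auto simp: w_def M_def)
      have n2: "n\<^sup>2 \<le> M\<^sup>2" using n by (intro power_mono)
      have s1: "\<bar>s\<bar> \<le> \<bar>\<epsilon>\<bar> + 1" using s by auto
      have "\<bar>- (a + 1) * n + \<rho> s / 2 * n\<^sup>2\<bar> \<le> \<bar>- (a + 1) * n\<bar> + \<bar>\<rho> s / 2 * n\<^sup>2\<bar>"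
        by (rule abs_triangle_ineq)
      also have "\<dots> = (a + 1) * n + \<bar>\<rho> s\<bar> / 2 * n\<^sup>2"
        using a n by (simp only: abs_mult abs_minus_cancel abs_divide) simp
      also have "\<dots> \<le> (a + 1) * M + C1 / 2 * M\<^sup>2"
        using a n n2 C1[OF sJ] by (intro add_mono mult_mono) auto
      finally have A: "\<bar>- (a + 1) * n + \<rho> s / 2 * n\<^sup>2\<bar> \<le> (a + 1) * M + C1 / 2 * M\<^sup>2" .
      have "\<bar>2 * s * (- (a + 1) * n + \<rho> s / 2 * n\<^sup>2)\<bar> \<le> 2 * (\<bar>\<epsilon>\<bar> + 1) * ((a + 1) * M + C1 / 2 * M\<^sup>2)"
        unfolding abs_mult[of "2 * s"] using A s1 by (intro mult_mono) auto
      moreover have "\<bar>\<rho>' s / 2 * n\<bar> \<le> C2 / 2 * M"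
        unfolding abs_mult using n C2[OF sJ] by (intro mult_mono) auto
      ultimately have Bd: "\<bar>2 * s * (- (a + 1) * n + \<rho> s / 2 * n\<^sup>2) - \<rho>' s / 2 * n\<bar>
          \<le> 2 * (\<bar>\<epsilon>\<bar> + 1) * ((a + 1) * M + C1 / 2 * M\<^sup>2) + C2 / 2 * M" by linarith
      have "\<bar>(2 * s * (- (a + 1) * n + \<rho> s / 2 * n\<^sup>2) - \<rho>' s / 2 * n) * w\<bar> \<le> C"
        unfolding C_def abs_mult[of _ w] using Bd w by (intro mult_mono) auto
      moreover have "?f' s x = (2 * s * (- (a + 1) * n + \<rho> s / 2 * n\<^sup>2) - \<rho>' s / 2 * n) * w"
        unfolding n_def[symmetric] w_def[symmetric] by (simp add: algebra_simps)
      ultimately show "\<bar>?f' s x\<bar> \<le> C" by simp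
    qed
  qed auto
  moreover have "(\<integral>x. ?f' \<epsilon> x \<partial>Q k) = 2 * \<epsilon> * (- (a + 1) * U k 1 (\<epsilon>\<^sup>2) (\<rho> \<epsilon>) + \<rho> \<epsilon> / 2 * U k 2 (\<epsilon>\<^sup>2) (\<rho> \<epsilon>))
      - \<rho>' \<epsilon> / 2 * U k 1 (\<epsilon>\<^sup>2) (\<rho> \<epsilon>)"
    using integrable_U[of "\<epsilon>\<^sup>2" k 1 "\<rho> \<epsilon>"] integrable_U[of "\<epsilon>\<^sup>2" k 2 "\<rho> \<epsilon>"] by (simp add: U_def)
  ultimately show ?thesis by (simp add: U_def)
qed

section \<open>Laplace transform of the power measure and growth of negative powers\<close>

definition laplace :: "real \<Rightarrow> real" where
  "laplace r = (\<integral>\<theta>. exp (- (\<theta> * r / 2)) \<partial>P)"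

lemma laplace_measurable [measurable]: "laplace \<in> borel_measurable borel"
  unfolding laplace_def by measurable

text \<open>The Laplace transform turns convolution into multiplication. This is where k has to be
  an integer: the k-th power of a mixture of exponentials is again such a mixture.\<close>

lemma integral_exp_Q:
  assumes "r \<ge> 0"
  shows "(\<integral>x. exp (- (x * r / 2)) \<partial>Q k) = laplace r ^ k"
proof (induction k)
  case 0
  show ?case using integral_return[of 0 borel "\<lambda>x. exp (- (x * r / 2))"] by simp
next
  case (Suc k)
  have "(\<integral>x. exp (- (x * r / 2)) \<partial>Q (Suc k)) = (\<integral>\<theta>. (\<integral>S. exp (- ((\<theta> + S) * r / 2)) \<partial>Q k) \<partial>P)"
    by (rule integral_Q_Suc(1)[where C = 1]) (use assms in auto)
  also have "\<dots> = (\<integral>\<theta>. exp (- (\<theta> * r / 2)) * (\<integral>S. exp (- (S * r / 2)) \<partial>Q k) \<partial>P)"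
    by (subst integral_mult_right_zero[symmetric])
       (simp add: distrib_right add_divide_distrib exp_add[symmetric] minus_add_distrib)
  also have "\<dots> = laplace r * laplace r ^ k" unfolding Suc.IH by (simp add: laplace_def)
  finally show ?case by simp
qed

lemma U_zero: "r \<ge> 0 \<Longrightarrow> U k 0 0 r = laplace r ^ k"
  by (simp add: integral_exp_Q[symmetric] U_def wt_def eta_def)

text \<open>The measure charges every neighbourhood of 0, so the transform decays more slowly than
  any exponential; c is the mass of an interval on which \<theta> <= \<delta>. Negative powers then
  grow slowly enough to be integrated against any given Gaussian.\<close>

lemma laplace_lower_bound:
  assumes \<delta>: "\<delta> > 0"
  obtains c where "c > 0" "\<And>r. r \<ge> 0 \<Longrightarrow> c * exp (- (\<delta> * r)) \<le> laplace r"
proof -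
  define B' where "B' = min \<delta> B"
  have B': "B' > 0" "B' \<le> B" "B' \<le> \<delta>" using B \<delta> by (auto simp: B'_def)
  \<comment> \<open>A second instance of the locale with a smaller endpoint supplies the mass of
    that interval.\<close>
  interpret B': power_mix a B' by unfold_locales (use a B' in auto)
  have "emeasure P {0..B'} = (\<integral>\<^sup>+\<theta>. ennreal (indicator {0..B} \<theta> * \<theta> powr (a - 1)) * indicator {0..B'} \<theta> \<partial>lborel)"
    unfolding power_measure_def by (subst emeasure_density) auto
  also have "\<dots> = (\<integral>\<^sup>+\<theta>. ennreal (indicator {0..B'} \<theta> * \<theta> powr (a - 1)) \<partial>lborel)"
    using B' by (intro nn_integral_cong) (auto simp: indicator_def)
  also have "\<dots> = ennreal (B' powr a / a)" by (rule B'.nn_integral_powr)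
  finally have m: "measure P {0..B'} = B' powr a / a" using a by (simp add: measure_def)
  show ?thesis
  proof (rule that)
    show "B' powr a / a > 0" using a B' by simp
    fix r :: real assume r: "r \<ge> 0"
    have "(\<integral>\<theta>. exp (- (\<delta> * r)) * indicator {0..B'} \<theta> \<partial>P) \<le> laplace r"
      unfolding laplace_def
    proof (rule integral_mono_AE)
      show "integrable P (\<lambda>\<theta>. exp (- (\<theta> * r / 2)))"
        by (rule integrable_P[where C = 1]) (use r in auto)
      show "AE \<theta> in P. exp (- (\<delta> * r)) * indicator {0..B'} \<theta> \<le> exp (- (\<theta> * r / 2))"
      proof (rule AE_I2)
        fix \<theta> :: real
        have "\<theta> * r \<le> \<delta> * r" "0 \<le> \<delta> * r" if "\<theta> \<in> {0..B'}" using that B' r \<delta> by (auto intro: mult_right_mono)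
        thus "exp (- (\<delta> * r)) * indicator {0..B'} \<theta> \<le> exp (- (\<theta> * r / 2))"
          by (cases "\<theta> \<in> {0..B'}") auto
      qed
    qed (auto intro!: integrable_real_mult_indicator simp: P.emeasure_finite less_top[symmetric])
    thus "B' powr a / a * exp (- (\<delta> * r)) \<le> laplace r"
      by (simp add: m mult.commute)
  qed
qed

lemma laplace_pos:
  assumes r: "r \<ge> 0"
  shows "laplace r > 0"
proof -
  obtain c where c: "c > 0" "\<And>r. r \<ge> 0 \<Longrightarrow> c * exp (- (1 * r)) \<le> laplace r"
    using laplace_lower_bound[OF zero_less_one] by blast
  have "0 < c * exp (- (1 * r))" using c(1) by simp
  also have "\<dots> \<le> laplace r" by (rule c(2)[OF r])
  finally show ?thesis .
qed

lemma U_powr_bound: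
  assumes \<delta>: "\<delta> > 0" and p: "p \<ge> 0" and T: "T \<ge> 0"
  obtains C where "C > 0" "\<And>t r. 0 \<le> t \<Longrightarrow> t \<le> T \<Longrightarrow> r \<ge> 0 \<Longrightarrow> U k 0 t r powr (- p) \<le> C * exp (\<delta> * r)"
proof -
  \<comment> \<open>Raising to the powers k and -p multiplies the rate by pk. Dividing \<delta> by
    pk + 1 keeps the final rate below \<delta>, and q stays positive when pk = 0.\<close>
  define q where "q = p * real k + 1"
  have q: "q > 0" using p by (simp add: q_def add_nonneg_pos)
  obtain c where c: "c > 0" "\<And>r. r \<ge> 0 \<Longrightarrow> c * exp (- (\<delta> / q * r)) \<le> laplace r"
    using laplace_lower_bound[of "\<delta> / q"] \<delta> q by auto
  define c1 where "c1 = (1 + T * (real k * B)) powr (- (a + 1))"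
  have TB: "0 \<le> T * (real k * B)" using T B by simp
  have c1: "c1 > 0" using TB by (simp add: c1_def)
  have low: "c1 * (c * exp (- (\<delta> / q * r))) ^ k \<le> U k 0 t r" if t: "0 \<le> t" "t \<le> T" and r: "r \<ge> 0" for t r
  proof -
    have "c1 * (c * exp (- (\<delta> / q * r))) ^ k \<le> c1 * laplace r ^ k"
      using c r c1 by (intro mult_left_mono power_mono) auto
    also have "\<dots> = (\<integral>x. c1 * exp (- (x * r / 2)) \<partial>Q k)" using integral_exp_Q[OF r, of k] by simp
    also have "\<dots> \<le> U k 0 t r"
      unfolding U_def
    proof (rule Q_integral_mono)
      show "integrable (Q k) (\<lambda>x. c1 * exp (- (x * r / 2)))"
        by (intro integrable_Q_continuous continuous_intros) auto
      fix x assume x: "0 \<le> x" "x \<le> real k * B"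
      have "t * x \<le> T * (real k * B)" using x t by (intro mult_mono) auto
      hence "c1 \<le> (1 + t * x) powr (- (a + 1))"
        unfolding c1_def using t x a by (intro powr_mono2') (auto simp: add_pos_nonneg)
      moreover have "exp (- (x * r / 2)) \<le> exp (- (eta t x * r / 2))"
        using eta_le[OF t(1) x(1)] r by (auto intro: mult_right_mono)
      ultimately show "c1 * exp (- (x * r / 2)) \<le> eta t x ^ 0 * wt t r x"
        unfolding wt_def using c1 by (simp, intro mult_mono) auto
    qed (rule integrable_U[OF t(1)])
    finally show ?thesis .
  qed
  define C where "C = (c1 * c ^ k) powr (- p)"
  show ?thesis
  proof (rule that[of C])
    show "C > 0" using c c1 by (simp add: C_def)
    fix t r assume t: "0 \<le> t" "t \<le> T" and r: "(r::real) \<ge> 0"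
    have "U k 0 t r powr (- p) \<le> (c1 * (c * exp (- (\<delta> / q * r))) ^ k) powr (- p)"
      using low[OF t r] c c1 p by (intro powr_mono2') auto
    also have "c1 * (c * exp (- (\<delta> / q * r))) ^ k = (c1 * c ^ k) * exp (- (real k * (\<delta> / q * r)))"
      by (simp add: power_mult_distrib exp_of_nat_mult[symmetric])
    also have "\<dots> powr (- p) = C * exp (- (real k * (\<delta> / q * r))) powr (- p)"
      unfolding C_def by (rule powr_mult)
    also have "exp (- (real k * (\<delta> / q * r))) powr (- p) = exp (p * real k / q * (\<delta> * r))"
      by (simp add: powr_def)
    also have "\<dots> \<le> exp (\<delta> * r)"
    proof -
      have "p * real k / q \<le> 1" using q by (simp add: q_def)
      hence "p * real k / q * (\<delta> * r) \<le> 1 * (\<delta> * r)"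
        using \<delta> r by (intro mult_right_mono) auto
      thus ?thesis by simp
    qed
    finally show "U k 0 t r powr (- p) \<le> C * exp (\<delta> * r)" using \<open>C > 0\<close> by simp
  qed
qed

end

section \<open>Gaussian integration by parts along dilations\<close>

lemma one_plus_le_exp: "c > 0 \<Longrightarrow> 0 \<le> u \<Longrightarrow> 1 + u \<le> (1 + 1 / c) * exp (c * u)" for u c :: real
proof -
  assume c: "c > 0" and u: "0 \<le> u"
  have "1 + u \<le> (1 + 1 / c) * (1 + c * u)"
    using c u by (simp add: field_simps)
  also have "\<dots> \<le> (1 + 1 / c) * exp (c * u)"
    using c by (intro mult_left_mono exp_ge_add_one_self) auto
  finally show ?thesis .
qed

lemma norm_diff_sq_lower:
  fixes x y :: "'a::real_inner"
  shows "(norm x)\<^sup>2 / 2 - (norm y)\<^sup>2 \<le> (norm (x - y))\<^sup>2"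
proof -
  have "0 \<le> (norm (x - 2 *\<^sub>R y))\<^sup>2" by simp
  thus ?thesis
    by (simp add: power2_norm_eq_inner inner_diff_left inner_diff_right inner_commute algebra_simps)
qed

lemma norm_add_sq_upper:
  fixes x y :: "'a::real_inner"
  shows "(norm (x + y))\<^sup>2 \<le> 2 * (norm x)\<^sup>2 + 2 * (norm y)\<^sup>2"
proof -
  have "0 \<le> (norm (x - y))\<^sup>2" by simp
  thus ?thesis
    by (simp add: power2_norm_eq_inner inner_diff_left inner_diff_right inner_add_left inner_add_right
        inner_commute algebra_simps)
qed

text \<open>
  Differentiating the constant $\lambda \mapsto \int \lambda^d G(\lambda y)\,dy$ at $\lambda = 1$ gives
  $\int (d\,G + y \cdot \nabla G) = 0$, which replaces coordinatewise integration by parts for radial fields.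
\<close>

lemma gaussian_scaling_by_parts:
  fixes w :: "real ^ 'n" and V V' :: "real \<Rightarrow> real"
  assumes \<epsilon>: "\<epsilon> > 0" and \<delta>: "\<delta> > 0" "\<delta> * \<epsilon>\<^sup>2 \<le> 1 / 72"
    and V: "\<And>r. (V has_real_derivative V' r) (at r)"
    and [measurable]: "V' \<in> borel_measurable borel"
    and bV: "\<And>r. r \<ge> 0 \<Longrightarrow> \<bar>V r\<bar> \<le> C * exp (\<delta> * r)"
    and bV': "\<And>r. r \<ge> 0 \<Longrightarrow> \<bar>V' r\<bar> \<le> C * exp (\<delta> * r)"
  defines "I \<equiv> \<lambda>z. phi z 1 * (\<epsilon> * (real CARD('n) * V ((norm (w + \<epsilon> *\<^sub>R z))\<^sup>2)
      + 2 * (norm (w + \<epsilon> *\<^sub>R z))\<^sup>2 * V' ((norm (w + \<epsilon> *\<^sub>R z))\<^sup>2))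
      - (z \<bullet> (w + \<epsilon> *\<^sub>R z)) * V ((norm (w + \<epsilon> *\<^sub>R z))\<^sup>2))"
  shows "integrable lborel I" and "(\<integral>z. I z \<partial>lborel) = 0"
proof -
  have [measurable]: "V \<in> borel_measurable borel"
    by (intro borel_measurable_continuous_onI continuous_at_imp_continuous_on ballI DERIV_isCont[OF V])
  define n where "n = CARD('n)"
  \<comment> \<open>In the variable y = z + w/\<epsilon> the point w + \<epsilon> z is \<epsilon> y,
    so the radial function is centred at 0 and only the Gaussian is shifted.\<close>
  define w' where "w' = (1 / \<epsilon>) *\<^sub>R w"
  define K where "K = (2 * pi) powr (- real n / 2)"
  have K: "K > 0" by (simp add: K_def)
  have C: "C \<ge> 0" using bV[of 0] by simp
  define G where "G = (\<lambda>l y. l ^ n * (phi (l *\<^sub>R y - w') 1 * V (\<epsilon>\<^sup>2 * l\<^sup>2 * (norm y)\<^sup>2)))"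
  define G' where "G' = (\<lambda>l y. phi (l *\<^sub>R y - w') 1 * (real n * l ^ (n - 1) * V (\<epsilon>\<^sup>2 * l\<^sup>2 * (norm y)\<^sup>2)
     + l ^ n * (2 * \<epsilon>\<^sup>2 * l * (norm y)\<^sup>2 * V' (\<epsilon>\<^sup>2 * l\<^sup>2 * (norm y)\<^sup>2)
        - ((l *\<^sub>R y - w') \<bullet> y) * V (\<epsilon>\<^sup>2 * l\<^sup>2 * (norm y)\<^sup>2))))"
  have [measurable]: "G l \<in> borel_measurable borel" "G' l \<in> borel_measurable borel" for l
    unfolding G_def G'_def by measurable
  define A where "A = (3/2) ^ n * (real n + (norm w')\<^sup>2 + 2 + 3 * \<epsilon>\<^sup>2)"
  define K2 where "K2 = K * exp ((norm w')\<^sup>2 / 2)"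
  define g where "g = (\<lambda>y :: real ^ 'n. K2 * C * A * (1 + 1 / (1/64)) * exp (- (1/64) * (norm y)\<^sup>2))"
  have A: "A \<ge> 0" "(3/2) ^ n \<le> A"
  proof -
    have "(3/2) ^ n * 1 \<le> A" unfolding A_def by (intro mult_left_mono) auto
    thus "(3/2) ^ n \<le> A" by simp
    thus "A \<ge> 0" by (rule order_trans[rotated]) simp
  qed
  have K2: "K2 \<ge> 0" using K by (simp add: K2_def)
  have int_g: "integrable lborel g" unfolding g_def
    by (intro integrable_mult_right integrable_exp_norm) simp
  \<comment> \<open>For l >= 1/2 the shifted Gaussian still decays like exp(-|y|^2/16).\<close>
  have phi_le: "phi (l *\<^sub>R y - w') 1 \<le> K2 * exp (- (norm y)\<^sup>2 / 16)" if l: "\<bar>l - 1\<bar> < 1 / 2" for l and y :: "real ^ 'n"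
  proof -
    have "1/2 \<le> l" using l[unfolded abs_less_iff] by linarith
    hence "(1/2)\<^sup>2 \<le> l\<^sup>2" by (intro power_mono) auto
    hence "(1/4) * (norm y)\<^sup>2 \<le> l\<^sup>2 * (norm y)\<^sup>2" by (intro mult_right_mono) (auto simp: power2_eq_square)
    moreover have "l\<^sup>2 * (norm y)\<^sup>2 / 2 - (norm w')\<^sup>2 \<le> (norm (l *\<^sub>R y - w'))\<^sup>2"
      using norm_diff_sq_lower[of "l *\<^sub>R y" w'] by (simp add: power_mult_distrib)
    ultimately have "- (norm (l *\<^sub>R y - w'))\<^sup>2 / 2 \<le> (norm w')\<^sup>2 / 2 + - (norm y)\<^sup>2 / 16" by simp
    hence "exp (- (norm (l *\<^sub>R y - w'))\<^sup>2 / 2) \<le> exp ((norm w')\<^sup>2 / 2) * exp (- (norm y)\<^sup>2 / 16)"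
      unfolding exp_add[symmetric] by simp
    hence "K * exp (- (norm (l *\<^sub>R y - w'))\<^sup>2 / 2) \<le> K * (exp ((norm w')\<^sup>2 / 2) * exp (- (norm y)\<^sup>2 / 16))"
      using K by (intro mult_left_mono) auto
    thus ?thesis by (simp add: phi_def K_def n_def K2_def mult.assoc)
  qed
  have V_le: "\<bar>V (\<epsilon>\<^sup>2 * l\<^sup>2 * (norm y)\<^sup>2)\<bar> \<le> C * exp ((norm y)\<^sup>2 / 32)"
     "\<bar>V' (\<epsilon>\<^sup>2 * l\<^sup>2 * (norm y)\<^sup>2)\<bar> \<le> C * exp ((norm y)\<^sup>2 / 32)" if l: "\<bar>l - 1\<bar> < 1 / 2" for l and y :: "real ^ 'n"
  proof -
    have "0 \<le> l" "l \<le> 3/2" using l[unfolded abs_less_iff] by linarith+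
    hence "l\<^sup>2 \<le> (3/2)\<^sup>2" by (intro power_mono) auto
    \<comment> \<open>For l <= 3/2 the bound 1/72 on the growth rate becomes 9/4 times 1/72 = 1/32,
      half the available decay. Of the other half, 1/64 absorbs the polynomial factor and 1/64
      remains for \<open>g\<close>.\<close>
    hence "\<delta> * \<epsilon>\<^sup>2 * l\<^sup>2 \<le> 1 / 72 * (3/2)\<^sup>2" using \<delta> by (intro mult_mono) auto
    hence "\<delta> * \<epsilon>\<^sup>2 * l\<^sup>2 * (norm y)\<^sup>2 \<le> 1 / 32 * (norm y)\<^sup>2"
      by (intro mult_right_mono) (auto simp: power2_eq_square)
    hence "exp (\<delta> * (\<epsilon>\<^sup>2 * l\<^sup>2 * (norm y)\<^sup>2)) \<le> exp ((norm y)\<^sup>2 / 32)" by (simp add: mult.assoc)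
    hence *: "C * exp (\<delta> * (\<epsilon>\<^sup>2 * l\<^sup>2 * (norm y)\<^sup>2)) \<le> C * exp ((norm y)\<^sup>2 / 32)"
      using C by (rule mult_left_mono)
    show "\<bar>V (\<epsilon>\<^sup>2 * l\<^sup>2 * (norm y)\<^sup>2)\<bar> \<le> C * exp ((norm y)\<^sup>2 / 32)"
      by (rule order_trans[OF bV *]) auto
    show "\<bar>V' (\<epsilon>\<^sup>2 * l\<^sup>2 * (norm y)\<^sup>2)\<bar> \<le> C * exp ((norm y)\<^sup>2 / 32)"
      by (rule order_trans[OF bV' *]) auto
  qed
  have bound: "\<bar>phi (l *\<^sub>R y - w') 1 * X\<bar> \<le> g y"
    if l: "\<bar>l - 1\<bar> < 1 / 2" and X: "\<bar>X\<bar> \<le> A * (1 + (norm y)\<^sup>2) * (C * exp ((norm y)\<^sup>2 / 32))" for l X and y :: "real ^ 'n"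
  proof -
    define N where "N = (norm y)\<^sup>2"
    have "1 + N \<le> (1 + 1 / (1/64)) * exp (1/64 * N)"
      unfolding N_def by (rule one_plus_le_exp) auto
    hence "A * (1 + N) * (C * exp (N / 32)) \<le> A * ((1 + 1 / (1/64)) * exp (1/64 * N)) * (C * exp (N / 32))"
      using A C by (intro mult_right_mono mult_left_mono) auto
    hence X': "\<bar>X\<bar> \<le> A * ((1 + 1 / (1/64)) * exp (1/64 * N)) * (C * exp (N / 32))"
      using X unfolding N_def[symmetric] by linarith
    have "\<bar>phi (l *\<^sub>R y - w') 1 * X\<bar> = phi (l *\<^sub>R y - w') 1 * \<bar>X\<bar>"
      by (simp add: abs_mult phi_nonneg)
    also have "\<dots> \<le> (K2 * exp (- N / 16)) * (A * ((1 + 1 / (1/64)) * exp (1/64 * N)) * (C * exp (N / 32)))"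
      using phi_le[OF l, of y] X' K2 unfolding N_def[symmetric] by (intro mult_mono) (auto simp: phi_nonneg)
    also have "\<dots> = K2 * C * A * (1 + 1 / (1/64)) * (exp (- N / 16) * exp (1/64 * N) * exp (N / 32))"
      by (simp only: mult_ac)
    also have "exp (- N / 16) * exp (1/64 * N) * exp (N / 32) = exp (- (1/64) * N)"
      unfolding exp_add[symmetric] by simp
    finally show ?thesis by (simp add: g_def N_def)
  qed
  have pw: "l ^ n \<le> (3/2) ^ n" "0 \<le> l ^ n" "l ^ (n - 1) \<le> (3/2) ^ n" "0 \<le> l ^ (n - 1)" "0 < l" "l \<le> 3/2"
    if l: "\<bar>l - 1\<bar> < 1 / 2" for l :: real
  proof -
    show l0: "0 < l" "l \<le> 3/2" using l[unfolded abs_less_iff] by linarith+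
    show "l ^ n \<le> (3/2) ^ n" using l0 by (intro power_mono) auto
    have "l ^ (n - 1) \<le> (3/2) ^ (n - 1)" using l0 by (intro power_mono) auto
    also have "\<dots> \<le> (3/2) ^ n" by (intro power_increasing) auto
    finally show "l ^ (n - 1) \<le> (3/2) ^ n" .
    show "0 \<le> l ^ n" "0 \<le> l ^ (n - 1)" using l0 by auto
  qed
  have bG': "\<bar>G' l y\<bar> \<le> g y" if l: "\<bar>l - 1\<bar> < 1 / 2" for l y
    unfolding G'_def
  proof (rule bound[OF l])
    define E where "E = C * exp ((norm y)\<^sup>2 / 32)"
    define v where "v = V (\<epsilon>\<^sup>2 * l\<^sup>2 * (norm y)\<^sup>2)"
    define v' where "v' = V' (\<epsilon>\<^sup>2 * l\<^sup>2 * (norm y)\<^sup>2)"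
    have v: "\<bar>v\<bar> \<le> E" "\<bar>v'\<bar> \<le> E" using V_le[OF l, of y] by (auto simp: v_def v'_def E_def)
    have E: "E \<ge> 0" using C by (simp add: E_def)
    define N where "N = norm y"
    have N: "N \<ge> 0" by (simp add: N_def)
    have 1: "\<bar>real n * l ^ (n - 1) * v\<bar> \<le> real n * (3/2) ^ n * E"
      unfolding abs_mult using v pw[OF l] by (intro mult_mono) auto
    have "\<bar>2 * \<epsilon>\<^sup>2 * l * N\<^sup>2 * v'\<bar> \<le> 2 * \<epsilon>\<^sup>2 * (3/2) * N\<^sup>2 * E"
      unfolding abs_mult using v pw[OF l] \<epsilon> by (intro mult_mono) auto
    moreover have "\<bar>((l *\<^sub>R y - w') \<bullet> y) * v\<bar> \<le> (2 * N\<^sup>2 + (norm w')\<^sup>2) * E"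
      unfolding abs_mult
    proof (intro mult_mono v)
      have "\<bar>(l *\<^sub>R y - w') \<bullet> y\<bar> \<le> norm (l *\<^sub>R y - w') * N"
        unfolding N_def by (rule Cauchy_Schwarz_ineq2)
      also have "norm (l *\<^sub>R y - w') \<le> l * N + norm w'"
        using norm_triangle_ineq4[of "l *\<^sub>R y" w'] pw[OF l] by (simp add: N_def)
      hence "norm (l *\<^sub>R y - w') * N \<le> (l * N + norm w') * N" using N by (rule mult_right_mono)
      also have "\<dots> \<le> (3/2 * N + norm w') * N"
        using pw[OF l] N by (intro mult_right_mono add_right_mono) auto
      also have "\<dots> \<le> 2 * N\<^sup>2 + (norm w')\<^sup>2"
      proof -
        have "2 * (N * norm w') \<le> N\<^sup>2 + (norm w')\<^sup>2"
          using sum_squares_bound[of N "norm w'"] by simp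
        moreover have "(3/2 * N + norm w') * N = 3/2 * N\<^sup>2 + N * norm w'"
          by (simp add: algebra_simps power2_eq_square)
        ultimately show ?thesis using zero_le_power2[of N] zero_le_power2[of "norm w'"] by linarith
      qed
      finally show "\<bar>(l *\<^sub>R y - w') \<bullet> y\<bar> \<le> 2 * N\<^sup>2 + (norm w')\<^sup>2" .
    qed (use E in auto)
    ultimately have "\<bar>2 * \<epsilon>\<^sup>2 * l * N\<^sup>2 * v' - ((l *\<^sub>R y - w') \<bullet> y) * v\<bar>
        \<le> (2 * \<epsilon>\<^sup>2 * (3/2) * N\<^sup>2 + (2 * N\<^sup>2 + (norm w')\<^sup>2)) * E" by (simp add: algebra_simps)
    hence 2: "\<bar>l ^ n * (2 * \<epsilon>\<^sup>2 * l * N\<^sup>2 * v' - ((l *\<^sub>R y - w') \<bullet> y) * v)\<bar>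
        \<le> (3/2) ^ n * ((2 * \<epsilon>\<^sup>2 * (3/2) * N\<^sup>2 + (2 * N\<^sup>2 + (norm w')\<^sup>2)) * E)"
      unfolding abs_mult[of "l ^ n"] using pw[OF l] by (intro mult_mono) auto
    have "\<bar>real n * l ^ (n - 1) * v + l ^ n * (2 * \<epsilon>\<^sup>2 * l * N\<^sup>2 * v' - ((l *\<^sub>R y - w') \<bullet> y) * v)\<bar>
        \<le> real n * (3/2) ^ n * E + (3/2) ^ n * ((2 * \<epsilon>\<^sup>2 * (3/2) * N\<^sup>2 + (2 * N\<^sup>2 + (norm w')\<^sup>2)) * E)"
      using 1 2 by linarith
    also have "\<dots> = (3/2) ^ n * (real n + 3 * \<epsilon>\<^sup>2 * N\<^sup>2 + 2 * N\<^sup>2 + (norm w')\<^sup>2) * E"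
      by (simp add: algebra_simps)
    also have "\<dots> \<le> (3/2) ^ n * ((real n + (norm w')\<^sup>2 + 2 + 3 * \<epsilon>\<^sup>2) * (1 + N\<^sup>2)) * E"
    proof (intro mult_right_mono mult_left_mono)
      have "0 \<le> (real n + (norm w')\<^sup>2) * N\<^sup>2 + 2 + 3 * \<epsilon>\<^sup>2" by simp
      thus "real n + 3 * \<epsilon>\<^sup>2 * N\<^sup>2 + 2 * N\<^sup>2 + (norm w')\<^sup>2 \<le> (real n + (norm w')\<^sup>2 + 2 + 3 * \<epsilon>\<^sup>2) * (1 + N\<^sup>2)"
        by (simp add: algebra_simps)
    qed (use E in auto)
    also have "\<dots> = A * (1 + N\<^sup>2) * E" by (simp add: A_def)
    finally show "\<bar>real n * l ^ (n - 1) * V (\<epsilon>\<^sup>2 * l\<^sup>2 * (norm y)\<^sup>2)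
     + l ^ n * (2 * \<epsilon>\<^sup>2 * l * (norm y)\<^sup>2 * V' (\<epsilon>\<^sup>2 * l\<^sup>2 * (norm y)\<^sup>2)
        - ((l *\<^sub>R y - w') \<bullet> y) * V (\<epsilon>\<^sup>2 * l\<^sup>2 * (norm y)\<^sup>2))\<bar> \<le> A * (1 + (norm y)\<^sup>2) * (C * exp ((norm y)\<^sup>2 / 32))"
      by (simp add: v_def v'_def N_def E_def)
  qed
  have bG: "\<bar>G l y\<bar> \<le> g y" if l: "\<bar>l - 1\<bar> < 1 / 2" for l y
  proof -
    have "\<bar>l ^ n * V (\<epsilon>\<^sup>2 * l\<^sup>2 * (norm y)\<^sup>2)\<bar> \<le> A * (1 + (norm y)\<^sup>2) * (C * exp ((norm y)\<^sup>2 / 32))"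
      unfolding abs_mult
    proof (intro mult_mono V_le[OF l])
      have "\<bar>l ^ n\<bar> \<le> A * 1" using pw[OF l] A by simp
      also have "\<dots> \<le> A * (1 + (norm y)\<^sup>2)" using A by (intro mult_left_mono) auto
      finally show "\<bar>l ^ n\<bar> \<le> A * (1 + (norm y)\<^sup>2)" .
    qed (use A in auto)
    from bound[OF l this] show ?thesis by (simp add: G_def mult_ac)
  qed
  have int_G: "integrable lborel (G l)" if l: "\<bar>l - 1\<bar> < 1 / 2" for l
  proof (rule Bochner_Integration.integrable_bound[OF int_g])
    show "AE y in lborel. norm (G l y) \<le> norm (g y)"
      using order_trans[OF bG[OF l] abs_ge_self] by simp
  qed measurable
  have int_G': "integrable lborel (G' 1)"
  proof (rule Bochner_Integration.integrable_bound[OF int_g])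
    show "AE y in lborel. norm (G' 1 y) \<le> norm (g y)"
      using order_trans[OF bG'[of 1] abs_ge_self] by simp
  qed measurable
  have "((\<lambda>l. \<integral>y. G l y \<partial>lborel) has_real_derivative (\<integral>y. G' 1 y \<partial>lborel)) (at 1)"
  proof (rule has_real_derivative_integral[where \<delta> = "1/2" and g = g])
    show "AE y in lborel. \<forall>l. \<bar>l - 1\<bar> < 1 / 2 \<longrightarrow>
        ((\<lambda>l. G l y) has_real_derivative G' l y) (at l) \<and> \<bar>G' l y\<bar> \<le> g y"
    proof (intro AE_I2 allI impI conjI bG')
      fix l :: real and y :: "real ^ 'n" assume l: "\<bar>l - 1\<bar> < 1 / 2"
      have nrm: "(norm (l *\<^sub>R y - w'))\<^sup>2 = l\<^sup>2 * (norm y)\<^sup>2 - 2 * l * (y \<bullet> w') + (norm w')\<^sup>2" for l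
        by (simp add: power2_norm_eq_inner inner_diff_left inner_diff_right inner_commute)
           (simp add: power2_eq_square algebra_simps)
      have d0: "((\<lambda>l. (norm (l *\<^sub>R y - w'))\<^sup>2) has_real_derivative 2 * ((l *\<^sub>R y - w') \<bullet> y)) (at l)"
        unfolding nrm
        by (auto intro!: derivative_eq_intros simp: inner_diff_left inner_diff_right power2_norm_eq_inner
              inner_commute algebra_simps)
      have d1: "((\<lambda>l. phi (l *\<^sub>R y - w') 1) has_real_derivative
          phi (l *\<^sub>R y - w') 1 * (- ((l *\<^sub>R y - w') \<bullet> y))) (at l)"
        unfolding phi_def
        by (rule DERIV_cong[OF DERIV_cmult[OF DERIV_fun_exp[OF DERIV_cdivide[OF DERIV_minus[OF d0]]]]]) simp
      have d2: "((\<lambda>l. V (\<epsilon>\<^sup>2 * l\<^sup>2 * (norm y)\<^sup>2)) has_real_derivative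
          V' (\<epsilon>\<^sup>2 * l\<^sup>2 * (norm y)\<^sup>2) * (2 * \<epsilon>\<^sup>2 * l * (norm y)\<^sup>2)) (at l)"
        by (rule DERIV_chain2[OF V]) (auto intro!: derivative_eq_intros)
      have d3: "((\<lambda>l. l ^ n) has_real_derivative real n * l ^ (n - 1)) (at l)"
        using DERIV_pow[of n l] by simp
      show "((\<lambda>l. G l y) has_real_derivative G' l y) (at l)"
        unfolding G_def G'_def
        by (rule DERIV_cong, rule DERIV_mult[OF d3 DERIV_mult[OF d1 d2]]) (simp add: algebra_simps)
    qed
  qed (use int_G int_g in auto)
  \<comment> \<open>The factor l^d in \<open>G\<close> is the Jacobian of the dilation, so the
    integral does not depend on l > 0.\<close>
  moreover have "((\<lambda>l. \<integral>y. G l y \<partial>lborel) has_real_derivative 0) (at 1)"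
  proof -
    have "((\<lambda>l. \<integral>y. G 1 y \<partial>lborel) has_real_derivative 0) (at 1)" by simp
    moreover have "eventually (\<lambda>l. (\<integral>y. G 1 y \<partial>lborel) = (\<integral>y. G l y \<partial>lborel)) (nhds 1)"
    proof (rule eventually_nhds_in_open[of "{0<..}" "1::real", THEN eventually_mono])
      fix l :: real assume "l \<in> {0<..}"
      hence l: "l > 0" by simp
      have "(\<integral>y. G 1 y \<partial>lborel) = \<bar>l\<bar> ^ DIM(real ^ 'n) * (\<integral>y. G 1 (0 + l *\<^sub>R y) \<partial>lborel)"
        by (rule lborel_integral_affine) (use l in auto)
      also have "\<dots> = (\<integral>y. G l y \<partial>lborel)"
        using l by (simp add: G_def n_def power_mult_distrib mult.assoc)
      finally show "(\<integral>y. G 1 y \<partial>lborel) = (\<integral>y. G l y \<partial>lborel)" .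
    qed auto
    ultimately show ?thesis
      by (subst DERIV_cong_ev[OF refl _ refl, symmetric]) auto
  qed
  ultimately have zero: "(\<integral>y. G' 1 y \<partial>lborel) = 0" by (rule DERIV_unique)
  \<comment> \<open>At l = 1 the shifted Gaussian is evaluated at z again, and r = \<epsilon>^2
    |y|^2.\<close>
  have I: "I z = \<epsilon> * G' 1 (z + w')" for z
  proof -
    define Y where "Y = z + w'"
    have x: "w + \<epsilon> *\<^sub>R z = \<epsilon> *\<^sub>R Y" using \<epsilon> by (simp add: Y_def w'_def algebra_simps)
    have z: "1 *\<^sub>R Y - w' = z" by (simp add: Y_def)
    have nx: "(norm (\<epsilon> *\<^sub>R Y))\<^sup>2 = \<epsilon>\<^sup>2 * (norm Y)\<^sup>2" by (simp add: power_mult_distrib)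
    show ?thesis unfolding I_def x Y_def[symmetric] G'_def n_def nx z inner_scaleR_right
      by (simp add: algebra_simps)
  qed
  have "integrable lborel (\<lambda>z. G' 1 (z + w'))"
    using int_G' by (subst (asm) lborel_distr_plus[of w', symmetric])
      (simp add: integrable_distr_eq add.commute)
  thus "integrable lborel I" unfolding I by simp
  show "(\<integral>z. I z \<partial>lborel) = 0"
    unfolding I using lborel_integral_translate[of "G' 1" w'] zero by simp
qed

section \<open>Monotonicity along the heat flow\<close>

lemma powr_Suc_neg: "(y::real) > 0 \<Longrightarrow> y powr (- p - 1) * y = y powr (- p)"
  using powr_add[of y "- p - 1" 1] by simp

context power_mix
begin

text \<open>The quotients of \<open>U k 1\<close> and \<open>U k 2\<close> by \<open>U k 0\<close>
  are bounded, so derivatives of U^(-p) inherit the growth bound of U^(-p).\<close>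

lemma U_powr_mult_le:
  assumes "t \<ge> 0"
  shows "U k 0 t r powr (- p - 1) * U k 1 t r \<le> real k * B * U k 0 t r powr (- p)"
    and "U k 0 t r powr (- p - 1) * U k 2 t r \<le> (real k * B)\<^sup>2 * U k 0 t r powr (- p)"
proof -
  have M: "real k * B \<ge> 0" using B by simp
  have 1: "U k 1 t r \<le> real k * B * U k 0 t r" using U_Suc_le[OF assms, of k 0 r] by simp
  have "U k 2 t r \<le> real k * B * U k 1 t r" using U_Suc_le[OF assms, of k 1 r] by (simp add: numeral_2_eq_2)
  also have "\<dots> \<le> real k * B * (real k * B * U k 0 t r)" using 1 M by (rule mult_left_mono)
  finally have 2: "U k 2 t r \<le> (real k * B)\<^sup>2 * U k 0 t r" by (simp add: power2_eq_square mult.assoc)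
  have e: "U k 0 t r powr (- p - 1) * (c * U k 0 t r) = c * U k 0 t r powr (- p)" for c
    using powr_Suc_neg[OF U_0_pos[OF assms], of k r p] by (simp add: mult_ac)
  show "U k 0 t r powr (- p - 1) * U k 1 t r \<le> real k * B * U k 0 t r powr (- p)"
    using mult_left_mono[OF 1, of "U k 0 t r powr (- p - 1)"] unfolding e by simp
  show "U k 0 t r powr (- p - 1) * U k 2 t r \<le> (real k * B)\<^sup>2 * U k 0 t r powr (- p)"
    using mult_left_mono[OF 2, of "U k 0 t r powr (- p - 1)"] unfolding e by simp
qed

text \<open>\<open>F'\<close> is the chain rule along \<epsilon>: the part with 2\<epsilon> is the
  change of time, the part with z \<bullet> (w + \<epsilon> z) the motion of the point. The work
  lies in one Gaussian majorant valid near \<epsilon>.\<close>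

lemma heat_derivative:
  fixes w :: "real ^ 'n" and k :: nat
  assumes p: "p \<ge> 0"
  defines "F \<equiv> \<lambda>\<epsilon> z. phi z 1 * U k 0 (\<epsilon>\<^sup>2) ((norm (w + \<epsilon> *\<^sub>R z))\<^sup>2) powr (- p)"
  defines "F' \<equiv> \<lambda>\<epsilon> z. phi z 1 * (- p * U k 0 (\<epsilon>\<^sup>2) ((norm (w + \<epsilon> *\<^sub>R z))\<^sup>2) powr (- p - 1) *
      (2 * \<epsilon> * (- (a + 1) * U k 1 (\<epsilon>\<^sup>2) ((norm (w + \<epsilon> *\<^sub>R z))\<^sup>2)
        + (norm (w + \<epsilon> *\<^sub>R z))\<^sup>2 / 2 * U k 2 (\<epsilon>\<^sup>2) ((norm (w + \<epsilon> *\<^sub>R z))\<^sup>2))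
       - (z \<bullet> (w + \<epsilon> *\<^sub>R z)) * U k 1 (\<epsilon>\<^sup>2) ((norm (w + \<epsilon> *\<^sub>R z))\<^sup>2)))"
  shows "integrable lborel (F \<epsilon>)" and "integrable lborel (F' \<epsilon>)"
    and "((\<lambda>\<epsilon>. \<integral>z. F \<epsilon> z \<partial>lborel) has_real_derivative (\<integral>z. F' \<epsilon> z \<partial>lborel)) (at \<epsilon>)"
proof -
  define X where "X = \<bar>\<epsilon>\<bar> + 1"
  have X: "X \<ge> 1" by (simp add: X_def)
  \<comment> \<open>With X bounding the nearby parameters, \<delta> times |w + s z|^2 is at most
    |w|^2/8 + |z|^2/8. Another 1/8 pays for the factor 1 + |z|^2, so of the Gaussian exponent 1/2
    there remains 1/4 in \<open>g\<close>.\<close>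
  define \<delta> where "\<delta> = 1 / (16 * X\<^sup>2)"
  have \<delta>: "\<delta> > 0" using X by (simp add: \<delta>_def)
  have \<delta>X: "\<delta> * X\<^sup>2 = 1 / 16" using X by (simp add: \<delta>_def)
  have "1\<^sup>2 \<le> X\<^sup>2" using X by (intro power_mono) auto
  hence "\<delta> * 1 \<le> \<delta> * X\<^sup>2" using \<delta> by (intro mult_left_mono) auto
  hence \<delta>1: "\<delta> \<le> 1 / 16" using \<delta>X by simp
  have X2: "X\<^sup>2 \<ge> 0" by simp
  obtain C where C: "C > 0"
    "\<And>t r. 0 \<le> t \<Longrightarrow> t \<le> X\<^sup>2 \<Longrightarrow> r \<ge> 0 \<Longrightarrow> U k 0 t r powr (- p) \<le> C * exp (\<delta> * r)"
    using U_powr_bound[OF \<delta> p X2, of k] by blast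
  define W where "W = (norm w)\<^sup>2"
  have W: "W \<ge> 0" by (simp add: W_def)
  define M where "M = real k * B"
  have M: "M \<ge> 0" using B by (simp add: M_def)
  define K where "K = (2 * pi) powr (- real CARD('n) / 2)"
  have K: "K > 0" by (simp add: K_def)
  define A where "A = 2 * X * ((a + 1) * M) + X * M\<^sup>2 * (2 * W + 2 * X\<^sup>2) + M * (1/2 + W / 2 + X)"
  have A: "A \<ge> 0" using a M W X unfolding A_def by (intro add_nonneg_nonneg mult_nonneg_nonneg) auto
  define C1 where "C1 = K * (C * exp (W / 8)) * (1 + p * A) * (1 + 1 / (1/8))"
  define g where "g = (\<lambda>z :: real ^ 'n. C1 * exp (- (1/4) * (norm z)\<^sup>2))"
  have int_g: "integrable lborel g" unfolding g_def
    by (intro integrable_mult_right integrable_exp_norm) simp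
  have Um[measurable]: "U k j (s\<^sup>2) \<in> borel_measurable borel" for j s by (rule U_measurable) simp
  have [measurable]: "F s \<in> borel_measurable borel" "F' s \<in> borel_measurable borel" for s
    unfolding F_def F'_def by measurable
  have r_le: "(norm (w + s *\<^sub>R z))\<^sup>2 \<le> 2 * W + 2 * X\<^sup>2 * (norm z)\<^sup>2"
    if s: "\<bar>s - \<epsilon>\<bar> < 1" for s and z :: "real ^ 'n"
  proof -
    have "\<bar>s\<bar>\<^sup>2 \<le> X\<^sup>2" using s by (intro power_mono) (auto simp: X_def)
    hence "s\<^sup>2 * (norm z)\<^sup>2 \<le> X\<^sup>2 * (norm z)\<^sup>2" by (intro mult_right_mono) auto
    thus ?thesis using norm_add_sq_upper[of w "s *\<^sub>R z"] by (simp add: W_def power_mult_distrib)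
  qed
  have bound: "\<bar>phi z 1 * (Y * U k 0 (s\<^sup>2) ((norm (w + s *\<^sub>R z))\<^sup>2) powr (- p))\<bar> \<le> g z"
    if s: "\<bar>s - \<epsilon>\<bar> < 1" and Y: "\<bar>Y\<bar> \<le> (1 + p * A) * (1 + (norm z)\<^sup>2)" for s Y and z :: "real ^ 'n"
  proof -
    define N where "N = (norm z)\<^sup>2"
    define r where "r = (norm (w + s *\<^sub>R z))\<^sup>2"
    have s2: "s\<^sup>2 \<le> X\<^sup>2" using power_mono[of "\<bar>s\<bar>" X 2] s by (auto simp: X_def)
    have "\<delta> * r \<le> \<delta> * (2 * W + 2 * X\<^sup>2 * N)"
      unfolding r_def N_def using \<delta> r_le[OF s] by (intro mult_left_mono) auto
    also have "\<dots> = 2 * (\<delta> * W) + 2 * (\<delta> * X\<^sup>2) * N" by (simp add: algebra_simps)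
    also have "\<dots> \<le> W / 8 + N / 8" unfolding \<delta>X using mult_right_mono[OF \<delta>1 W] by simp
    finally have "exp (\<delta> * r) \<le> exp (W / 8) * exp (N / 8)" unfolding exp_add[symmetric] by simp
    hence "C * exp (\<delta> * r) \<le> C * (exp (W / 8) * exp (N / 8))" using C(1) by (intro mult_left_mono) auto
    moreover have "U k 0 (s\<^sup>2) r powr (- p) \<le> C * exp (\<delta> * r)"
      using s2 by (intro C(2)) (auto simp: r_def)
    ultimately have n: "U k 0 (s\<^sup>2) r powr (- p) \<le> C * exp (W / 8) * exp (N / 8)" by simp
    have "1 + N \<le> (1 + 1 / (1/8)) * exp (1/8 * N)"
      unfolding N_def by (rule one_plus_le_exp) auto
    hence "(1 + p * A) * (1 + N) \<le> (1 + p * A) * ((1 + 1 / (1/8)) * exp (1/8 * N))"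
      using p A by (intro mult_left_mono) auto
    hence Y': "\<bar>Y\<bar> \<le> (1 + p * A) * ((1 + 1 / (1/8)) * exp (1/8 * N))"
      using Y unfolding N_def[symmetric] by linarith
    have "\<bar>phi z 1 * (Y * U k 0 (s\<^sup>2) r powr (- p))\<bar> = (K * exp (- N / 2)) * (\<bar>Y\<bar> * U k 0 (s\<^sup>2) r powr (- p))"
      by (simp add: abs_mult phi_def K_def N_def)
    also have "\<dots> \<le> (K * exp (- N / 2)) * ((1 + p * A) * ((1 + 1 / (1/8)) * exp (1/8 * N)) * (C * exp (W / 8) * exp (N / 8)))"
      using n Y' K C(1) p A by (intro mult_left_mono mult_mono) auto
    also have "\<dots> = C1 * (exp (- N / 2) * exp (1/8 * N) * exp (N / 8))"
      unfolding C1_def by (simp only: mult_ac)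
    also have "exp (- N / 2) * exp (1/8 * N) * exp (N / 8) = exp (- (1/4) * N)"
      unfolding exp_add[symmetric] by simp
    finally show ?thesis by (simp add: g_def N_def r_def)
  qed
  have bF: "\<bar>F s z\<bar> \<le> g z" if s: "\<bar>s - \<epsilon>\<bar> < 1" for s z
  proof -
    have "1 * 1 \<le> (1 + p * A) * (1 + (norm z)\<^sup>2)" using p A by (intro mult_mono) auto
    thus ?thesis using bound[OF s, of 1 z] by (simp add: F_def)
  qed
  have bF': "\<bar>F' s z\<bar> \<le> g z" if s: "\<bar>s - \<epsilon>\<bar> < 1" for s z
  proof -
    define N where "N = (norm z)\<^sup>2"
    have N: "N \<ge> 0" by (simp add: N_def)
    define x where "x = w + s *\<^sub>R z"
    define r where "r = (norm x)\<^sup>2"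
    define u0 where "u0 = U k 0 (s\<^sup>2) r"
    define u1 where "u1 = U k 1 (s\<^sup>2) r"
    define u2 where "u2 = U k 2 (s\<^sup>2) r"
    define n where "n = u0 powr (- p)"
    define m where "m = u0 powr (- p - 1)"
    have u: "u0 > 0" "u1 \<ge> 0" "u2 \<ge> 0"
      unfolding u0_def u1_def u2_def by (auto intro!: U_0_pos U_nonneg)
    have n: "n > 0" using u by (simp add: n_def)
    have m: "m \<ge> 0" by (simp add: m_def)
    have mu1: "m * u1 \<le> M * n" and mu2: "m * u2 \<le> M\<^sup>2 * n"
      using U_powr_mult_le[of "s\<^sup>2" k r p] by (simp_all add: m_def n_def u0_def u1_def u2_def M_def)
    have s1: "\<bar>s\<bar> \<le> X" using s by (auto simp: X_def)
    have r: "0 \<le> r" "r \<le> 2 * W + 2 * X\<^sup>2 * N" using r_le[OF s, of z] by (auto simp: r_def x_def N_def)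
    have zx: "\<bar>z \<bullet> x\<bar> \<le> N / 2 + W / 2 + X * N"
    proof -
      have "norm x \<le> norm w + \<bar>s\<bar> * norm z" unfolding x_def
        using norm_triangle_ineq[of w "s *\<^sub>R z"] by simp
      also have "\<bar>s\<bar> * norm z \<le> X * norm z" using s1 by (rule mult_right_mono) simp
      finally have nx: "norm x \<le> norm w + X * norm z" by simp
      have "\<bar>z \<bullet> x\<bar> \<le> norm z * norm x" by (rule Cauchy_Schwarz_ineq2)
      also have "\<dots> \<le> norm z * (norm w + X * norm z)" using nx by (rule mult_left_mono) simp
      also have "\<dots> = norm z * norm w + X * N" by (simp add: N_def power2_eq_square algebra_simps)
      also have "norm z * norm w \<le> N / 2 + W / 2"
        using sum_squares_bound[of "norm z" "norm w"] by (simp add: N_def W_def)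
      finally show ?thesis by simp
    qed
    have "\<bar>m * (2 * s * (- (a + 1) * u1 + r / 2 * u2) - (z \<bullet> x) * u1)\<bar>
        = \<bar>2 * s * (- (a + 1) * (m * u1) + r / 2 * (m * u2)) - (z \<bullet> x) * (m * u1)\<bar>"
      by (simp add: algebra_simps)
    also have "\<dots> \<le> 2 * X * ((a + 1) * (M * n) + (2 * W + 2 * X\<^sup>2 * N) / 2 * (M\<^sup>2 * n)) + (N / 2 + W / 2 + X * N) * (M * n)"
    proof -
      have "\<bar>- (a + 1) * (m * u1) + r / 2 * (m * u2)\<bar> \<le> (a + 1) * (m * u1) + r / 2 * (m * u2)"
        using a m u r by (intro abs_leI) (auto simp: algebra_simps intro!: add_nonneg_nonneg)
      also have "\<dots> \<le> (a + 1) * (M * n) + (2 * W + 2 * X\<^sup>2 * N) / 2 * (M\<^sup>2 * n)"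
      proof (rule add_mono)
        show "(a + 1) * (m * u1) \<le> (a + 1) * (M * n)" using mu1 a by (intro mult_left_mono) auto
        show "r / 2 * (m * u2) \<le> (2 * W + 2 * X\<^sup>2 * N) / 2 * (M\<^sup>2 * n)"
          using r m u by (intro mult_mono[OF _ mu2]) auto
      qed
      finally have "\<bar>2 * s * (- (a + 1) * (m * u1) + r / 2 * (m * u2))\<bar>
          \<le> 2 * X * ((a + 1) * (M * n) + (2 * W + 2 * X\<^sup>2 * N) / 2 * (M\<^sup>2 * n))"
        unfolding abs_mult[of "2 * s"] using s1 by (intro mult_mono) auto
      moreover have "\<bar>(z \<bullet> x) * (m * u1)\<bar> \<le> (N / 2 + W / 2 + X * N) * (M * n)"
        unfolding abs_mult[of "z \<bullet> x"] using zx mu1 m u N W X by (intro mult_mono) auto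
      ultimately show ?thesis by linarith
    qed
    also have "\<dots> = (2 * X * ((a + 1) * M) + X * M\<^sup>2 * (2 * W + 2 * X\<^sup>2 * N) + M * (N / 2 + W / 2 + X * N)) * n"
      by (simp add: algebra_simps)
    also have "\<dots> \<le> (A * (1 + N)) * n"
    proof (rule mult_right_mono)
      have "2 * X * ((a + 1) * M) * 1 \<le> 2 * X * ((a + 1) * M) * (1 + N)"
        using X a M N by (intro mult_left_mono) auto
      moreover have "X * M\<^sup>2 * (2 * W + 2 * X\<^sup>2 * N) \<le> X * M\<^sup>2 * ((2 * W + 2 * X\<^sup>2) * (1 + N))"
        using X W N by (intro mult_left_mono) (auto simp: algebra_simps)
      moreover have "M * (N / 2 + W / 2 + X * N) \<le> M * ((1/2 + W / 2 + X) * (1 + N))"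
        using M X mult_nonneg_nonneg[OF N W]
        by (intro mult_left_mono) (auto simp: algebra_simps add_divide_distrib)
      moreover have "A * (1 + N) = 2 * X * ((a + 1) * M) * (1 + N)
          + X * M\<^sup>2 * ((2 * W + 2 * X\<^sup>2) * (1 + N)) + M * ((1/2 + W / 2 + X) * (1 + N))"
        unfolding A_def by (simp only: distrib_right mult.assoc)
      ultimately show "2 * X * ((a + 1) * M) + X * M\<^sup>2 * (2 * W + 2 * X\<^sup>2 * N) + M * (N / 2 + W / 2 + X * N) \<le> A * (1 + N)"
        by linarith
    qed (use n in simp)
    finally have b: "\<bar>m * (2 * s * (- (a + 1) * u1 + r / 2 * u2) - (z \<bullet> x) * u1)\<bar> \<le> A * (1 + N) * n" .
    \<comment> \<open>Dividing by the negative power of U brings \<open>F'\<close> into the form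
      covered by \<open>bound\<close>.\<close>
    define Y where "Y = - p * (m * (2 * s * (- (a + 1) * u1 + r / 2 * u2) - (z \<bullet> x) * u1)) / n"
    have "\<bar>Y\<bar> = p * (\<bar>m * (2 * s * (- (a + 1) * u1 + r / 2 * u2) - (z \<bullet> x) * u1)\<bar> / n)"
      using p n by (simp add: Y_def abs_mult)
    also have "\<dots> \<le> p * (A * (1 + N))"
      using b n p by (intro mult_left_mono) (auto simp: divide_le_eq)
    also have "\<dots> \<le> (1 + p * A) * (1 + N)" using N by (simp add: algebra_simps)
    finally have "\<bar>phi z 1 * (Y * n)\<bar> \<le> g z"
      using bound[OF s, of Y z] by (simp add: n_def u0_def r_def x_def N_def)
    moreover have "F' s z = phi z 1 * (Y * n)"
      using n unfolding F'_def x_def[symmetric] r_def[symmetric]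
      unfolding u0_def[symmetric] u1_def[symmetric] u2_def[symmetric] m_def[symmetric] Y_def by simp
    ultimately show ?thesis by simp
  qed
  have int_F: "integrable lborel (F s)" if s: "\<bar>s - \<epsilon>\<bar> < 1" for s
  proof (rule Bochner_Integration.integrable_bound[OF int_g])
    show "AE y in lborel. norm (F s y) \<le> norm (g y)"
      using order_trans[OF bF[OF s] abs_ge_self] by simp
  qed measurable
  thus "integrable lborel (F \<epsilon>)" by simp
  show "integrable lborel (F' \<epsilon>)"
  proof (rule Bochner_Integration.integrable_bound[OF int_g])
    show "AE y in lborel. norm (F' \<epsilon> y) \<le> norm (g y)"
      using order_trans[OF bF'[of \<epsilon>] abs_ge_self] by simp
  qed measurable
  show "((\<lambda>\<epsilon>. \<integral>z. F \<epsilon> z \<partial>lborel) has_real_derivative (\<integral>z. F' \<epsilon> z \<partial>lborel)) (at \<epsilon>)"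
  proof (rule has_real_derivative_integral[where \<delta> = 1 and g = g])
    show "AE z in lborel. \<forall>s. \<bar>s - \<epsilon>\<bar> < 1 \<longrightarrow>
        ((\<lambda>s. F s z) has_real_derivative F' s z) (at s) \<and> \<bar>F' s z\<bar> \<le> g z"
    proof (intro AE_I2 allI impI conjI bF')
      fix s :: real and z :: "real ^ 'n"
      let ?\<rho> = "\<lambda>s. (norm (w + s *\<^sub>R z))\<^sup>2"
      let ?\<rho>' = "\<lambda>s. 2 * (z \<bullet> (w + s *\<^sub>R z))"
      have nrm: "?\<rho> = (\<lambda>s. (norm w)\<^sup>2 + 2 * s * (w \<bullet> z) + s\<^sup>2 * (norm z)\<^sup>2)"
        by (rule ext, simp add: power2_norm_eq_inner inner_add_left inner_add_right inner_commute)
           (simp add: power2_eq_square algebra_simps)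
      have d: "(?\<rho> has_real_derivative ?\<rho>' s) (at s)" for s
        unfolding nrm
        by (auto intro!: derivative_eq_intros simp: inner_add_right power2_norm_eq_inner inner_commute algebra_simps)
      have c: "continuous_on UNIV ?\<rho>'" by (intro continuous_intros)
      have "U k 0 (s\<^sup>2) (?\<rho> s) > 0" by (rule U_0_pos) simp
      note D = DERIV_fun_powr[OF DERIV_U_path[OF d c, of k s] this, of "- p"]
      show "((\<lambda>s. F s z) has_real_derivative F' s z) (at s)"
        unfolding F_def F'_def
        by (rule DERIV_cong[OF DERIV_cmult[OF D]]) (simp add: mult.assoc)
    qed
  qed (use int_F int_g in auto)
qed

text \<open>\<Psi> is the interpolating expectation at time \<epsilon>^2. At \<epsilon> = 0 the
  point no longer depends on z and the Gaussian integrates to one, which gives the left-hand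
  side.\<close>

theorem heat_monotone:
  fixes w :: "real ^ 'n"
  assumes D: "real CARD('n) = 2 * a + 2" and k: "k \<ge> 1" and s: "s \<ge> 0"
    and sk: "s * (real k * (real k - 1)) * B \<le> (a + 2) / (2 * (a + 1))"
  defines "p \<equiv> 1 - 1 / real k"
  shows "U k 0 0 ((norm w)\<^sup>2) powr (- p)
    \<le> (\<integral>z. phi z 1 * U k 0 s ((norm (w + sqrt s *\<^sub>R z))\<^sup>2) powr (- p) \<partial>lborel)"
    and "integrable lborel (\<lambda>z. phi z 1 * U k 0 s ((norm (w + sqrt s *\<^sub>R z))\<^sup>2) powr (- p))"
proof -
  have p: "p \<ge> 0" using k by (simp add: p_def)
  define F where "F = (\<lambda>\<epsilon> z. phi z 1 * U k 0 (\<epsilon>\<^sup>2) ((norm (w + \<epsilon> *\<^sub>R z))\<^sup>2) powr (- p))"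
  define F' where "F' = (\<lambda>\<epsilon> z. phi z 1 * (- p * U k 0 (\<epsilon>\<^sup>2) ((norm (w + \<epsilon> *\<^sub>R z))\<^sup>2) powr (- p - 1) *
      (2 * \<epsilon> * (- (a + 1) * U k 1 (\<epsilon>\<^sup>2) ((norm (w + \<epsilon> *\<^sub>R z))\<^sup>2)
        + (norm (w + \<epsilon> *\<^sub>R z))\<^sup>2 / 2 * U k 2 (\<epsilon>\<^sup>2) ((norm (w + \<epsilon> *\<^sub>R z))\<^sup>2))
       - (z \<bullet> (w + \<epsilon> *\<^sub>R z)) * U k 1 (\<epsilon>\<^sup>2) ((norm (w + \<epsilon> *\<^sub>R z))\<^sup>2))))"
  define \<Psi> where "\<Psi> = (\<lambda>\<epsilon>. \<integral>z. F \<epsilon> z \<partial>lborel)"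
  have int_F: "integrable lborel (F \<epsilon>)" and int_F': "integrable lborel (F' \<epsilon>)"
    and der: "(\<Psi> has_real_derivative (\<integral>z. F' \<epsilon> z \<partial>lborel)) (at \<epsilon>)" for \<epsilon>
    unfolding F_def F'_def \<Psi>_def by (rule heat_derivative[OF p])+
  have nonneg: "(\<integral>z. F' \<epsilon> z \<partial>lborel) \<ge> 0" if \<epsilon>: "\<epsilon> > 0" "\<epsilon> < sqrt s" for \<epsilon>
  proof -
    define t where "t = \<epsilon>\<^sup>2"
    have t: "t \<ge> 0" by (simp add: t_def)
    have "\<epsilon>\<^sup>2 \<le> (sqrt s)\<^sup>2" using \<epsilon> by (intro power_mono) auto
    hence ts: "t \<le> s" using s by (simp add: t_def)
    have "t * (real k * (real k - 1)) * B \<le> s * (real k * (real k - 1)) * B"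
      using ts k B by (intro mult_right_mono) auto
    hence tk: "t * (real k * (real k - 1)) * B \<le> (a + 2) / (2 * (a + 1))" using sk by linarith
    \<comment> \<open>The gradient of u^(-p) at x is p V(|x|^2) x, and the divergence of V(|x|^2) x
      is d V + 2 r V'.\<close>
    define V where "V = (\<lambda>r. U k 0 t r powr (- p - 1) * U k 1 t r)"
    define V' where "V' = (\<lambda>r. (p + 1) / 2 * (U k 0 t r powr (- p - 2) * (U k 1 t r)\<^sup>2)
      - (U k 0 t r powr (- p - 1) * U k 2 t r) / 2)"
    have Um[measurable]: "U k j t \<in> borel_measurable borel" for j by (rule U_measurable[OF t])
    have [measurable]: "V' \<in> borel_measurable borel" unfolding V'_def by measurable
    have dV: "(V has_real_derivative V' r) (at r)" for r
    proof -
      have "((\<lambda>r. U k 0 t r powr (- p - 1)) has_real_derivative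
          (- p - 1) * U k 0 t r powr (- p - 1 - real 1) * (- (U k (Suc 0) t r / 2))) (at r)"
        by (rule DERIV_fun_powr[OF DERIV_U[OF t] U_0_pos[OF t]])
      moreover have "(U k 1 t has_real_derivative - (U k 2 t r / 2)) (at r)"
        using DERIV_U[OF t, of k 1 r] by (simp add: numeral_2_eq_2)
      ultimately show ?thesis unfolding V_def V'_def
        by (rule DERIV_cong[OF DERIV_mult]) (simp add: power2_eq_square field_simps)
    qed
    \<comment> \<open>The largest growth rate that the scaling argument tolerates at this
      \<epsilon>.\<close>
    define \<delta> where "\<delta> = 1 / (72 * \<epsilon>\<^sup>2)"
    have \<delta>: "\<delta> > 0" "\<delta> * \<epsilon>\<^sup>2 \<le> 1 / 72" using \<epsilon> by (auto simp: \<delta>_def)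
    obtain C where C: "C > 0"
      "\<And>t' r. 0 \<le> t' \<Longrightarrow> t' \<le> t \<Longrightarrow> r \<ge> 0 \<Longrightarrow> U k 0 t' r powr (- p) \<le> C * exp (\<delta> * r)"
      using U_powr_bound[OF \<delta>(1) p t, of k] by blast
    define M where "M = real k * B"
    have M: "M \<ge> 0" using B by (simp add: M_def)
    define C' where "C' = (M + (p + 2) * M\<^sup>2) * C"
    have bn: "c * U k 0 t r powr (- p) \<le> C' * exp (\<delta> * r)"
      if "r \<ge> 0" "0 \<le> c" "c \<le> M + (p + 2) * M\<^sup>2" for c r
    proof -
      have "c * U k 0 t r powr (- p) \<le> (M + (p + 2) * M\<^sup>2) * (C * exp (\<delta> * r))"
        using that C(2)[OF t order_refl that(1)] by (intro mult_mono) auto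
      thus ?thesis by (simp add: C'_def mult.assoc)
    qed
    have V0: "V r \<ge> 0" for r unfolding V_def using U_nonneg[OF t] by simp
    have bV: "\<bar>V r\<bar> \<le> C' * exp (\<delta> * r)" if r: "r \<ge> 0" for r
    proof -
      have "V r \<le> M * U k 0 t r powr (- p)"
        unfolding V_def M_def by (rule U_powr_mult_le[OF t])
      also have "\<dots> \<le> C' * exp (\<delta> * r)" using M p by (intro bn[OF r]) auto
      finally show ?thesis using V0 by simp
    qed
    have bV': "\<bar>V' r\<bar> \<le> C' * exp (\<delta> * r)" if r: "r \<ge> 0" for r
    proof -
      define n where "n = U k 0 t r powr (- p)"
      have n: "n \<ge> 0" by (simp add: n_def)
      have "U k 0 t r powr (- p - 2) * (U k 1 t r)\<^sup>2 = (U k 0 t r powr (- (p + 1) - 1) * U k 1 t r) * U k 1 t r"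
        by (simp add: power2_eq_square algebra_simps)
      also have "\<dots> \<le> (M * U k 0 t r powr (- (p + 1))) * U k 1 t r"
        unfolding M_def by (intro mult_right_mono U_powr_mult_le[OF t] U_nonneg[OF t])
      also have "\<dots> = M * (U k 0 t r powr (- p - 1) * U k 1 t r)" by (simp add: mult.assoc)
      also have "\<dots> \<le> M * (M * n)"
        unfolding M_def n_def using M by (intro mult_left_mono U_powr_mult_le[OF t]) (simp add: M_def)
      finally have 1: "U k 0 t r powr (- p - 2) * (U k 1 t r)\<^sup>2 \<le> M\<^sup>2 * n"
        by (simp add: power2_eq_square mult.assoc)
      have 2: "U k 0 t r powr (- p - 1) * U k 2 t r \<le> M\<^sup>2 * n"
        unfolding M_def n_def by (rule U_powr_mult_le[OF t])
      have 3: "0 \<le> U k 0 t r powr (- p - 2) * (U k 1 t r)\<^sup>2" "0 \<le> U k 0 t r powr (- p - 1) * U k 2 t r"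
        using U_nonneg[OF t] by auto
      have 4: "(p + 1) / 2 * (U k 0 t r powr (- p - 2) * (U k 1 t r)\<^sup>2) \<le> (p + 1) / 2 * (M\<^sup>2 * n)"
        using 1 p by (intro mult_left_mono) auto
      have 5: "0 \<le> (p + 1) / 2 * (U k 0 t r powr (- p - 2) * (U k 1 t r)\<^sup>2)"
        using 3 p by (intro mult_nonneg_nonneg) auto
      have "\<bar>V' r\<bar> \<le> (p + 1) / 2 * (M\<^sup>2 * n) + M\<^sup>2 * n / 2"
        unfolding V'_def using 2 3 4 5 by linarith
      also have "\<dots> = ((p + 2) / 2 * M\<^sup>2) * n" by (simp add: algebra_simps add_divide_distrib)
      also have "\<dots> \<le> C' * exp (\<delta> * r)"
        unfolding n_def
      proof (rule bn[OF r])
        have "(p + 2) / 2 * M\<^sup>2 \<le> (p + 2) * M\<^sup>2" using p by (intro mult_right_mono) auto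
        thus "(p + 2) / 2 * M\<^sup>2 \<le> M + (p + 2) * M\<^sup>2" using M by simp
      qed (use p in auto)
      finally show ?thesis .
    qed
    \<comment> \<open>\<open>I\<close> integrates to zero and turns the first-order term $z \cdot \nabla$ of \<open>F'\<close> into a Laplacian,
      after which the integrand is pointwise nonnegative.\<close>
    define I where "I = (\<lambda>z :: real ^ 'n. phi z 1 * (\<epsilon> * (real CARD('n) * V ((norm (w + \<epsilon> *\<^sub>R z))\<^sup>2)
      + 2 * (norm (w + \<epsilon> *\<^sub>R z))\<^sup>2 * V' ((norm (w + \<epsilon> *\<^sub>R z))\<^sup>2))
      - (z \<bullet> (w + \<epsilon> *\<^sub>R z)) * V ((norm (w + \<epsilon> *\<^sub>R z))\<^sup>2)))"
    have I: "integrable lborel I" "(\<integral>z. I z \<partial>lborel) = 0"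
      unfolding I_def
      by (rule gaussian_scaling_by_parts[where C = C', OF \<epsilon>(1) \<delta> dV _ bV bV']; simp)+
    have "(\<integral>z. F' \<epsilon> z \<partial>lborel) = (\<integral>z. F' \<epsilon> z + p * I z \<partial>lborel)"
      using I int_F'[of \<epsilon>] by simp
    also have "\<dots> \<ge> 0"
    proof (rule integral_nonneg_AE, rule AE_I2)
      fix z :: "real ^ 'n"
      define r where "r = (norm (w + \<epsilon> *\<^sub>R z))\<^sup>2"
      define u0 where "u0 = U k 0 t r"
      define u1 where "u1 = U k 1 t r"
      define u2 where "u2 = U k 2 t r"
      define q where "q = u0 powr (- p - 2)"
      define \<sigma> where "\<sigma> = z \<bullet> (w + \<epsilon> *\<^sub>R z)"
      have r: "r \<ge> 0" by (simp add: r_def)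
      have u0: "u0 > 0" unfolding u0_def by (rule U_0_pos[OF t])
      have q1: "u0 powr (- p - 1) = q * u0"
      proof -
        have "- p - 1 = (- p - 2) + 1" by simp
        thus ?thesis using u0 by (simp only: powr_add q_def) simp
      qed
      have key: "r * (u0 * u2 - (1 - 1 / (2 * real k)) * u1\<^sup>2) \<le> (2 * a + 2) * (u0 * u1)"
        unfolding u0_def u1_def u2_def by (rule U_inequality[OF t r k tk])
      \<comment> \<open>The coefficient of the squared gradient produced by differentiating u^(-p)
        matches the constant of the superharmonicity inequality.\<close>
      have pk: "(p + 1) / 2 = 1 - 1 / (2 * real k)" using k by (simp add: p_def field_simps)
      define \<kappa> where "\<kappa> = (p + 1) / 2"
      have F'_eq: "F' \<epsilon> z = phi z 1 * (- p * (q * u0) * (2 * \<epsilon> * (- (a + 1) * u1 + r / 2 * u2) - \<sigma> * u1))"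
        unfolding F'_def t_def[symmetric] r_def[symmetric] \<sigma>_def[symmetric]
        unfolding u0_def[symmetric] u1_def[symmetric] u2_def[symmetric] q1 ..
      have I_eq: "I z = phi z 1 * (\<epsilon> * ((2 * a + 2) * (q * u0 * u1)
          + 2 * r * (\<kappa> * (q * u1\<^sup>2) - (q * u0 * u2) / 2)) - \<sigma> * (q * u0 * u1))"
        unfolding I_def D r_def[symmetric] \<sigma>_def[symmetric] V_def V'_def
        unfolding u0_def[symmetric] u1_def[symmetric] u2_def[symmetric] q1 q_def[symmetric] \<kappa>_def ..
      \<comment> \<open>The terms in \<sigma> cancel; what remains is a nonnegative factor times the
        defect in \<open>key\<close>.\<close>
      have "F' \<epsilon> z + p * I z = phi z 1 * p * \<epsilon> * q * (2 * ((2 * a + 2) * (u0 * u1) - r * (u0 * u2 - \<kappa> * u1\<^sup>2)))"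
        unfolding F'_eq I_eq by (simp add: algebra_simps)
      also have "\<dots> \<ge> 0"
        using key p \<epsilon> unfolding \<kappa>_def pk by (intro mult_nonneg_nonneg) (auto simp: phi_nonneg q_def)
      finally show "F' \<epsilon> z + p * I z \<ge> 0" .
    qed
    finally show ?thesis .
  qed
  \<comment> \<open>The sign of the derivative is known only for \<epsilon> > 0, where division by
    \<epsilon> was possible; continuity covers the endpoints.\<close>
  have "\<Psi> 0 \<le> \<Psi> (sqrt s)"
  proof (rule DERIV_nonneg_imp_increasing_open[of 0 "sqrt s" \<Psi>])
    show "continuous_on {0..sqrt s} \<Psi>"
      by (intro continuous_at_imp_continuous_on ballI DERIV_isCont[OF der])
  qed (use s der nonneg in auto)
  moreover have "\<Psi> 0 = U k 0 0 ((norm w)\<^sup>2) powr (- p)"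
    using integral_phi[of 1, where 'n = 'n] by (simp add: \<Psi>_def F_def)
  ultimately have "U k 0 0 ((norm w)\<^sup>2) powr (- p) \<le> \<Psi> (sqrt s)" by simp
  thus "U k 0 0 ((norm w)\<^sup>2) powr (- p)
    \<le> (\<integral>z. phi z 1 * U k 0 s ((norm (w + sqrt s *\<^sub>R z))\<^sup>2) powr (- p) \<partial>lborel)"
    using s by (simp add: \<Psi>_def F_def)
  show "integrable lborel (\<lambda>z. phi z 1 * U k 0 s ((norm (w + sqrt s *\<^sub>R z))\<^sup>2) powr (- p))"
    using int_F[of "sqrt s"] s by (simp add: F_def)
qed

end

section \<open>The marginal density as a Laplace transform\<close>

lemma nn_integral_Gamma_scaled:
  fixes a y :: real
  assumes a: "a > 0" and y: "y > 0"
  shows "(\<integral>\<^sup>+\<theta>. ennreal (indicator {0..} \<theta> * \<theta> powr (a - 1) * exp (- (\<theta> * y))) \<partial>lborel)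
    = ennreal (Gamma a * y powr (- a))"
proof -
  let ?I = "\<integral>\<^sup>+\<theta>. ennreal (indicator {0..} \<theta> * \<theta> powr (a - 1) * exp (- (\<theta> * y))) \<partial>lborel"
  have "ennreal (Gamma a) = (\<integral>\<^sup>+t. ennreal (indicator {0..} t * t powr (a - 1) / exp t) \<partial>lborel)"
    using Gamma_conv_nn_integral_real[OF a] .
  also have "\<dots> = ennreal \<bar>y\<bar> * (\<integral>\<^sup>+\<theta>. ennreal (indicator {0..} (0 + y * \<theta>) * (0 + y * \<theta>) powr (a - 1) / exp (0 + y * \<theta>)) \<partial>lborel)"
    by (rule nn_integral_real_affine) (use y in auto)
  also have "(\<integral>\<^sup>+\<theta>. ennreal (indicator {0..} (0 + y * \<theta>) * (0 + y * \<theta>) powr (a - 1) / exp (0 + y * \<theta>)) \<partial>lborel)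
      = (\<integral>\<^sup>+\<theta>. ennreal (y powr (a - 1)) * ennreal (indicator {0..} \<theta> * \<theta> powr (a - 1) * exp (- (\<theta> * y))) \<partial>lborel)"
  proof (rule nn_integral_cong)
    fix \<theta> :: real
    have "indicator {0..} (0 + y * \<theta>) * (0 + y * \<theta>) powr (a - 1) / exp (0 + y * \<theta>)
        = y powr (a - 1) * (indicator {0..} \<theta> * \<theta> powr (a - 1) * exp (- (\<theta> * y)))"
      using y by (cases "\<theta> \<ge> 0")
        (auto simp: indicator_def zero_le_mult_iff powr_mult exp_minus field_simps)
    thus "ennreal (indicator {0..} (0 + y * \<theta>) * (0 + y * \<theta>) powr (a - 1) / exp (0 + y * \<theta>))
        = ennreal (y powr (a - 1)) * ennreal (indicator {0..} \<theta> * \<theta> powr (a - 1) * exp (- (\<theta> * y)))"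
      by (simp add: ennreal_mult')
  qed
  also have "\<dots> = ennreal (y powr (a - 1)) * ?I"
    by (rule nn_integral_cmult) measurable
  also have "ennreal \<bar>y\<bar> * (ennreal (y powr (a - 1)) * ?I) = ennreal (y powr a) * ?I"
  proof -
    have "y * y powr (a - 1) = y powr a" using y by (simp add: powr_diff)
    thus ?thesis using y by (simp add: mult.assoc[symmetric] ennreal_mult'[symmetric])
  qed
  finally have "ennreal (y powr (- a)) * ennreal (Gamma a) = ennreal (y powr (- a)) * (ennreal (y powr a) * ?I)"
    by simp
  also have "\<dots> = ?I"
    using y by (simp add: mult.assoc[symmetric] ennreal_mult'[symmetric] powr_add[symmetric])
  finally show ?thesis using a by (simp add: ennreal_mult' mult.commute)
qed

lemma nn_integral_gaussian_exp:
  fixes x :: "real ^ 'n"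
  assumes s: "s > 0" and \<theta>: "\<theta> \<ge> 0"
  shows "(\<integral>\<^sup>+z. ennreal (phi z 1 * exp (- (\<theta> * (norm (x + sqrt s *\<^sub>R z))\<^sup>2 / 2))) \<partial>lborel)
    = ennreal ((1 + s * \<theta>) powr (- real CARD('n) / 2) * exp (- (eta s \<theta> * (norm x)\<^sup>2 / 2)))"
proof -
  have "ennreal ((1 + s * \<theta>) powr (- real CARD('n) / 2) * exp (- (eta s \<theta> * (norm x)\<^sup>2 / 2)))
      = (\<integral>\<^sup>+y. ennreal (phi (x - y) s * exp (- (\<theta> * (norm y)\<^sup>2 / 2))) \<partial>lborel)"
    by (rule nn_integral_gaussian_product[OF s \<theta>, symmetric])
  also have "\<dots> = ennreal (\<bar>sqrt s\<bar> ^ DIM(real ^ 'n)) * (\<integral>\<^sup>+z. ennreal (phi (x - (x + sqrt s *\<^sub>R z)) s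
      * exp (- (\<theta> * (norm (x + sqrt s *\<^sub>R z))\<^sup>2 / 2))) \<partial>lborel)"
    by (rule nn_integral_affine) (use s in auto)
  also have "\<dots> = (\<integral>\<^sup>+z. ennreal (\<bar>sqrt s\<bar> ^ DIM(real ^ 'n)) * ennreal (phi (x - (x + sqrt s *\<^sub>R z)) s
      * exp (- (\<theta> * (norm (x + sqrt s *\<^sub>R z))\<^sup>2 / 2))) \<partial>lborel)"
    by (rule nn_integral_cmult[symmetric]) measurable
  also have "\<dots> = (\<integral>\<^sup>+z. ennreal (phi z 1 * exp (- (\<theta> * (norm (x + sqrt s *\<^sub>R z))\<^sup>2 / 2))) \<partial>lborel)"
  proof (rule nn_integral_cong)
    fix z :: "real ^ 'n"
    show "ennreal (\<bar>sqrt s\<bar> ^ DIM(real ^ 'n)) * ennreal (phi (x - (x + sqrt s *\<^sub>R z)) s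
      * exp (- (\<theta> * (norm (x + sqrt s *\<^sub>R z))\<^sup>2 / 2))) = ennreal (phi z 1 * exp (- (\<theta> * (norm (x + sqrt s *\<^sub>R z))\<^sup>2 / 2)))"
      using s phi_scale[OF s, of z]
      by (simp add: phi_minus ennreal_mult'[symmetric] mult.assoc[symmetric])
  qed
  finally show ?thesis ..
qed

context power_mix
begin

lemma laplace_eq_has_integral:
  assumes r: "r \<ge> 0"
  shows "((\<lambda>x. x powr (a - 1) * exp (- (x * r / 2))) has_integral laplace r) {0..B}"
proof -
  have "integrable P (\<lambda>\<theta>. exp (- (\<theta> * r / 2)))"
    by (rule integrable_P[where C = 1]) (use r in auto)
  hence i: "integrable lborel (\<lambda>x. (indicator {0..B} x * x powr (a - 1)) * exp (- (x * r / 2)))"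
    unfolding power_measure_def by (subst (asm) integrable_density) auto
  have "laplace r = (\<integral>x. (indicator {0..B} x * x powr (a - 1)) * exp (- (x * r / 2)) \<partial>lborel)"
    unfolding laplace_def power_measure_def by (subst integral_density) auto
  hence "((\<lambda>x. (indicator {0..B} x * x powr (a - 1)) * exp (- (x * r / 2))) has_integral laplace r) UNIV"
    using has_integral_integral_lborel[OF i] by simp
  thus ?thesis
    by (subst has_integral_restrict_UNIV[symmetric])
       (simp add: indicator_def of_bool_def if_distrib if_distribR cong: if_cong)
qed

text \<open>The substitution \<eta> = \<theta>/(1 + \<theta>/B) maps (0, \<infinity>) onto (0, B).
  It absorbs the Gaussian normalisation, and this is why the power measure is cut off at B =
  1/v.\<close>

lemma nn_integral_laplace:
  assumes r: "r \<ge> 0"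
  shows "(\<integral>\<^sup>+\<theta>. ennreal (indicator {0..} \<theta> * \<theta> powr (a - 1)
      * ((1 + \<theta> / B) powr (- (a + 1)) * exp (- (eta (1 / B) \<theta> * r / 2)))) \<partial>lborel) = ennreal (laplace r)"
proof -
  define v where "v = 1 / B"
  have v: "v > 0" using B by (simp add: v_def)
  define f where "f = (\<lambda>x. x powr (a - 1) * exp (- (x * r / 2)))"
  let ?S = "{0<..} :: real set"
  have hf: "(f has_integral laplace r) {0<..<B}"
    using laplace_eq_has_integral[OF r] unfolding f_def by (simp add: has_integral_Icc_iff_Ioo)
  have af: "f absolutely_integrable_on {0<..<B}"
    using hf by (intro nonnegative_absolutely_integrable_1) (auto simp: f_def integrable_on_def)
  have pos: "1 + v * x > 0" if "x > 0" for x using v that by (simp add: add_pos_pos)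
  have img: "eta v ` ?S = {0<..<B}"
  proof (intro equalityI subsetI)
    fix y assume "y \<in> eta v ` ?S"
    then obtain x where x: "x > 0" "y = eta v x" by auto
    have "x < B * (1 + v * x)" using B x by (simp add: v_def algebra_simps)
    thus "y \<in> {0<..<B}" using x pos[of x] by (simp add: eta_def divide_less_eq)
  next
    fix y assume y: "y \<in> {0<..<B}"
    define x where "x = y / (1 - v * y)"
    have q: "1 - v * y > 0" using y B by (simp add: v_def)
    have "1 + v * x = 1 / (1 - v * y)" using q by (simp add: x_def field_simps)
    hence "eta v x = y" using q by (simp add: eta_def x_def)
    moreover have "x > 0" using y q by (simp add: x_def)
    ultimately show "y \<in> eta v ` ?S" by (metis greaterThan_iff image_eqI)
  qed
  have inj: "inj_on (eta v) ?S"
  proof (rule inj_onI)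
    fix x y assume "x \<in> ?S" "y \<in> ?S" "eta v x = eta v y"
    thus "x = y" using eta_le_iff[of v x y] eta_le_iff[of v y x] v by auto
  qed
  have der: "(eta v has_field_derivative 1 / (1 + v * x)\<^sup>2) (at x within ?S)" if "x \<in> ?S" for x
    unfolding eta_def using pos[of x] that
    by (auto intro!: derivative_eq_intros simp: power2_eq_square field_simps)
  have "(\<lambda>x. \<bar>1 / (1 + v * x)\<^sup>2\<bar> * f (eta v x)) absolutely_integrable_on ?S \<and>
      integral ?S (\<lambda>x. \<bar>1 / (1 + v * x)\<^sup>2\<bar> * f (eta v x)) = laplace r"
    using has_absolute_integral_change_of_variables_1'[OF _ der inj, of f "laplace r"] af hf
    unfolding img by (auto intro: integral_unique)
  hence h: "((\<lambda>x. \<bar>1 / (1 + v * x)\<^sup>2\<bar> * f (eta v x)) has_integral laplace r) ?S"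
    using set_lebesgue_integral_eq_integral(1) by (auto simp: has_integral_iff)
  let ?E = "\<lambda>x. (1 + x / B) powr (- (a + 1)) * exp (- (eta (1 / B) x * r / 2))"
  have eq: "\<bar>1 / (1 + v * x)\<^sup>2\<bar> * f (eta v x)
      = x powr (a - 1) * ?E x" if "x > 0" for x
  proof -
    define y where "y = 1 + v * x"
    have y: "y > 0" using pos[OF that] by (simp add: y_def)
    \<comment> \<open>The Jacobian contributes exponent -2 of y and \<eta>^(a-1) contributes -(a-1):
      together exactly -(a+1) = -d/2.\<close>
    have "\<bar>1 / y\<^sup>2\<bar> * (x / y) powr (a - 1) = x powr (a - 1) * y powr (- (a + 1))"
    proof -
      have "- (a + 1) = - (a - 1) + - 2" by simp
      hence "y powr (- (a + 1)) = y powr (- (a - 1)) * y powr (- 2)"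
        by (simp only: powr_add)
      also have "y powr (- 2) = 1 / y\<^sup>2" using y by (simp add: powr_minus_divide powr_numeral)
      also have "y powr (- (a - 1)) = 1 / y powr (a - 1)" by (rule powr_minus_divide)
      finally have e: "y powr (- (a + 1)) = 1 / y powr (a - 1) * (1 / y\<^sup>2)" .
      have "(x / y) powr (a - 1) = x powr (a - 1) / y powr (a - 1)"
        using y that by (simp add: powr_divide)
      thus ?thesis unfolding e by simp
    qed
    thus ?thesis unfolding f_def using that
      by (simp add: eta_def y_def[symmetric] v_def[symmetric] mult.assoc[symmetric])
         (simp add: y_def v_def)
  qed
  have "((\<lambda>x. x powr (a - 1) * ?E x) has_integral laplace r) ?S"
    using h by (rule has_integral_eq[rotated]) (use eq in auto)
  from nn_integral_has_integral_lebesgue[OF _ this]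
  have "(\<integral>\<^sup>+x. ennreal (indicator ?S x * (x powr (a - 1) * ?E x)) \<partial>lborel)
      = ennreal (laplace r)" by simp
  moreover have "indicator ?S x * (x powr (a - 1) * ?E x)
      = indicator {0..} x * x powr (a - 1) * ?E x" for x
    by (cases "x = 0") (auto simp: indicator_def)
  ultimately show ?thesis by (simp only:)
qed

text \<open>By the Gamma integral |\<mu>|^(-2a) is c times the integral of \<theta>^(a-1)
  exp(-\<theta> |\<mu>|^2/2) over \<theta> > 0. Tonelli then reduces the claim to Gaussian
  marginals. That 2a = d - 2 is the harmonic exponent fits the normalisation to the preceding
  substitution.\<close>

lemma m_H_eq_laplace:
  fixes w :: "real ^ 'n"
  assumes D: "real CARD('n) = 2 * a + 2"
  shows "m_H w (1 / B) = 1 / (Gamma a * 2 powr a) * laplace ((norm w)\<^sup>2)"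
proof -
  define v where "v = 1 / B"
  have v: "v > 0" using B by (simp add: v_def)
  define c where "c = 1 / (Gamma a * 2 powr a)"
  have c: "c > 0" using a by (simp add: c_def Gamma_real_pos)
  define g where "g = (\<lambda>\<theta>::real. indicator {0..} \<theta> * \<theta> powr (a - 1))"
  have g: "g \<theta> \<ge> 0" for \<theta> by (simp add: g_def)
  have [measurable]: "g \<in> borel_measurable borel" unfolding g_def by measurable
  let ?h = "\<lambda>\<theta> \<mu>. ennreal (phi (w - \<mu>) v * exp (- (\<theta> * (norm \<mu>)\<^sup>2 / 2)))"
  have "(\<integral>\<^sup>+\<mu>. ennreal (phi (w - \<mu>) v * norm \<mu> powr (- (real CARD('n) - 2))) \<partial>lborel)
      = (\<integral>\<^sup>+\<mu>. (\<integral>\<^sup>+\<theta>. ennreal (c * g \<theta>) * ?h \<theta> \<mu> \<partial>lborel) \<partial>lborel)"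
  proof (rule nn_integral_cong_AE)
    \<comment> \<open>At \<mu> = 0 \<open>powr\<close> returns 0 whereas the mixture diverges; a
      single point is negligible.\<close>
    have "AE \<mu> in lborel. \<mu> \<noteq> (0 :: real ^ 'n)" by (rule AE_lborel_singleton)
    thus "AE \<mu> in lborel. ennreal (phi (w - \<mu>) v * norm \<mu> powr (- (real CARD('n) - 2)))
        = (\<integral>\<^sup>+\<theta>. ennreal (c * g \<theta>) * ?h \<theta> \<mu> \<partial>lborel)"
    proof eventually_elim
      case (elim \<mu>)
      define y where "y = (norm \<mu>)\<^sup>2 / 2"
      have y: "y > 0" using elim by (simp add: y_def)
      have "(\<integral>\<^sup>+\<theta>. ennreal (c * g \<theta>) * ?h \<theta> \<mu> \<partial>lborel)
          = (\<integral>\<^sup>+\<theta>. ennreal (c * phi (w - \<mu>) v) * ennreal (indicator {0..} \<theta> * \<theta> powr (a - 1) * exp (- (\<theta> * y))) \<partial>lborel)"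
        using c phi_nonneg[of "w - \<mu>" v]
        by (intro nn_integral_cong) (simp add: g_def ennreal_mult'[symmetric] y_def mult_ac)
      also have "\<dots> = ennreal (c * phi (w - \<mu>) v) * ennreal (Gamma a * y powr (- a))"
        by (subst nn_integral_cmult) (auto simp: nn_integral_Gamma_scaled[OF a y])
      also have "\<dots> = ennreal (phi (w - \<mu>) v * (c * Gamma a * y powr (- a)))"
        using c phi_nonneg[of "w - \<mu>" v] by (simp add: ennreal_mult'[symmetric] mult_ac)
      also have "c * Gamma a * y powr (- a) = norm \<mu> powr (- (real CARD('n) - 2))"
      proof -
        have "y powr (- a) = (norm \<mu>)\<^sup>2 powr (- a) * 2 powr a"
          unfolding y_def using elim by (simp add: powr_divide powr_minus field_simps)
        also have "(norm \<mu>)\<^sup>2 powr (- a) = norm \<mu> powr (2 * (- a))"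
          using powr_powr[of "norm \<mu>" 2 "- a"] by simp
        finally show ?thesis using a by (simp add: c_def D Gamma_real_pos less_imp_neq[symmetric])
      qed
      finally show ?case by simp
    qed
  qed
  also have "\<dots> = (\<integral>\<^sup>+\<theta>. (\<integral>\<^sup>+\<mu>. ennreal (c * g \<theta>) * ?h \<theta> \<mu> \<partial>lborel) \<partial>lborel)"
    by (rule lborel_pair.Fubini') measurable
  also have "\<dots> = (\<integral>\<^sup>+\<theta>. ennreal c * ennreal (indicator {0..} \<theta> * \<theta> powr (a - 1)
      * ((1 + \<theta> / B) powr (- (a + 1)) * exp (- (eta (1 / B) \<theta> * (norm w)\<^sup>2 / 2)))) \<partial>lborel)"
  proof (rule nn_integral_cong)
    fix \<theta> :: real
    show "(\<integral>\<^sup>+\<mu>. ennreal (c * g \<theta>) * ?h \<theta> \<mu> \<partial>lborel)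
      = ennreal c * ennreal (indicator {0..} \<theta> * \<theta> powr (a - 1)
      * ((1 + \<theta> / B) powr (- (a + 1)) * exp (- (eta (1 / B) \<theta> * (norm w)\<^sup>2 / 2))))"
    proof (cases "\<theta> \<ge> 0")
      case True
      have D2: "- real CARD('n) / 2 = - (a + 1)" using D by simp
      have "(\<integral>\<^sup>+\<mu>. ennreal (c * g \<theta>) * ?h \<theta> \<mu> \<partial>lborel) = ennreal (c * g \<theta>) * (\<integral>\<^sup>+\<mu>. ?h \<theta> \<mu> \<partial>lborel)"
        by (rule nn_integral_cmult) measurable
      also have "(\<integral>\<^sup>+\<mu>. ?h \<theta> \<mu> \<partial>lborel) = ennreal ((1 + v * \<theta>) powr (- (a + 1)) * exp (- (eta v \<theta> * (norm w)\<^sup>2 / 2)))"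
        unfolding nn_integral_gaussian_product[OF v True] D2 ..
      finally show ?thesis using c g[of \<theta>]
        by (simp add: g_def v_def ennreal_mult'[symmetric] mult_ac)
    next
      case False
      thus ?thesis by (simp add: g_def)
    qed
  qed
  also have "\<dots> = ennreal c * ennreal (laplace ((norm w)\<^sup>2))"
    by (subst nn_integral_cmult) (measurable, simp only: nn_integral_laplace[OF zero_le_power2])
  also have "\<dots> = ennreal (c * laplace ((norm w)\<^sup>2))" using c by (simp add: ennreal_mult')
  finally have nn: "(\<integral>\<^sup>+\<mu>. ennreal (phi (w - \<mu>) v * norm \<mu> powr (- (real CARD('n) - 2))) \<partial>lborel)
      = ennreal (c * laplace ((norm w)\<^sup>2))" .
  have "m_H w v = enn2real (\<integral>\<^sup>+\<mu>. ennreal (phi (w - \<mu>) v * norm \<mu> powr (- (real CARD('n) - 2))) \<partial>lborel)"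
    unfolding m_H_def by (rule integral_eq_nn_integral) (auto simp: phi_nonneg)
  also have "\<dots> = c * laplace ((norm w)\<^sup>2)"
    unfolding nn using c laplace_pos[of "(norm w)\<^sup>2"] by simp
  finally show ?thesis by (simp add: v_def c_def)
qed

text \<open>Identifies the normalising expectation in the harmonic predictive density, up to c^k:
  the k-th power is a mixture over \<open>Q k\<close>, and each Gaussian in it is smoothed
  separately.\<close>

lemma nn_integral_laplace_power:
  fixes x :: "real ^ 'n"
  assumes D: "real CARD('n) = 2 * a + 2" and s: "s > 0"
  shows "(\<integral>\<^sup>+z. ennreal (laplace ((norm (x + sqrt s *\<^sub>R z))\<^sup>2) ^ k * phi z 1) \<partial>lborel)
    = ennreal (U k 0 s ((norm x)\<^sup>2))"
proof -
  interpret LQ: pair_sigma_finite lborel "Q k" ..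
  let ?e = "\<lambda>z \<theta>. phi z 1 * exp (- (\<theta> * (norm (x + sqrt s *\<^sub>R z))\<^sup>2 / 2))"
  have D2: "- real CARD('n) / 2 = - (a + 1)" using D by simp
  have "(\<integral>\<^sup>+z. ennreal (laplace ((norm (x + sqrt s *\<^sub>R z))\<^sup>2) ^ k * phi z 1) \<partial>lborel)
      = (\<integral>\<^sup>+z. (\<integral>\<^sup>+\<theta>. ennreal (?e z \<theta>) \<partial>Q k) \<partial>lborel)"
  proof (rule nn_integral_cong)
    fix z :: "real ^ 'n"
    define r where "r = (norm (x + sqrt s *\<^sub>R z))\<^sup>2"
    have r: "r \<ge> 0" by (simp add: r_def)
    have "integrable (Q k) (\<lambda>\<theta>. phi z 1 * exp (- (\<theta> * r / 2)))"
      by (intro integrable_mult_right integrable_Q[where C = 1]) (use r in auto)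
    hence "(\<integral>\<^sup>+\<theta>. ennreal (phi z 1 * exp (- (\<theta> * r / 2))) \<partial>Q k) = ennreal (\<integral>\<theta>. phi z 1 * exp (- (\<theta> * r / 2)) \<partial>Q k)"
      by (rule nn_integral_eq_integral) (simp add: phi_nonneg)
    also have "(\<integral>\<theta>. phi z 1 * exp (- (\<theta> * r / 2)) \<partial>Q k) = laplace r ^ k * phi z 1"
      using integral_exp_Q[OF r, of k] by simp
    finally show "ennreal (laplace ((norm (x + sqrt s *\<^sub>R z))\<^sup>2) ^ k * phi z 1) = (\<integral>\<^sup>+\<theta>. ennreal (?e z \<theta>) \<partial>Q k)"
      by (simp add: r_def)
  qed
  also have "\<dots> = (\<integral>\<^sup>+\<theta>. (\<integral>\<^sup>+z. ennreal (?e z \<theta>) \<partial>lborel) \<partial>Q k)"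
    by (rule LQ.Fubini'[symmetric]) measurable
  also have "\<dots> = (\<integral>\<^sup>+\<theta>. ennreal (eta s \<theta> ^ 0 * wt s ((norm x)\<^sup>2) \<theta>) \<partial>Q k)"
  proof (rule nn_integral_cong_AE)
    show "AE \<theta> in Q k. (\<integral>\<^sup>+z. ennreal (?e z \<theta>) \<partial>lborel) = ennreal (eta s \<theta> ^ 0 * wt s ((norm x)\<^sup>2) \<theta>)"
      using AE_Q
    proof eventually_elim
      case (elim \<theta>)
      hence \<theta>: "\<theta> \<ge> 0" by simp
      show ?case unfolding nn_integral_gaussian_exp[OF s \<theta>] D2 by (simp add: wt_def)
    qed
  qed
  also have "\<dots> = ennreal (U k 0 s ((norm x)\<^sup>2))"
    unfolding U_def
  proof (rule nn_integral_eq_integral)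
    show "integrable (Q k) (\<lambda>\<theta>. eta s \<theta> ^ 0 * wt s ((norm x)\<^sup>2) \<theta>)"
      by (rule integrable_U) (use s in simp)
    show "AE \<theta> in Q k. 0 \<le> eta s \<theta> ^ 0 * wt s ((norm x)\<^sup>2) \<theta>" by (simp add: wt_def)
  qed
  finally show ?thesis .
qed

end

section \<open>Reduction of the risk\<close>

text \<open>The geometric mean is at most the larger number. This crude bound is enough to make the
  affinity of two densities integrable.\<close>

lemma powr_mult_powr_le_add:
  fixes x y :: real
  assumes "x \<ge> 0" "y > 0" "0 \<le> p" "p \<le> 1"
  shows "x powr p * y powr (1 - p) \<le> x + y"
proof (cases "x \<le> y")
  case True
  have "x powr p * y powr (1 - p) \<le> y powr p * y powr (1 - p)"
    using True assms by (intro mult_right_mono powr_mono2) auto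
  also have "\<dots> = y" using assms by (simp add: powr_add[symmetric])
  finally show ?thesis using assms by simp
next
  case False
  have "x powr p * y powr (1 - p) \<le> x powr p * x powr (1 - p)"
    using False assms by (intro mult_left_mono powr_mono2) auto
  also have "\<dots> = x" using assms False by (simp add: powr_add[symmetric])
  finally show ?thesis using assms by simp
qed

text \<open>Only the power in \<open>f_alpha\<close> is not constant, so the risk is a decreasing
  affine function of the averaged affinity J. A Bochner integral of a nonintegrable function is 0 by
  convention, so integrability is settled here once; J is exposed as a nonnegative integral, to
  which Tonelli applies freely.\<close>

lemma risk_alpha_eq:
  fixes q :: "real ^ 'n \<Rightarrow> real ^ 'n \<Rightarrow> real"
  assumes \<alpha>: "-1 < \<alpha>" "\<alpha> < 1" and vx: "vx > 0" and vy: "vy > 0"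
    and [measurable]: "(\<lambda>(x, y). q x y) \<in> borel_measurable (borel \<Otimes>\<^sub>M borel)"
    and pos: "\<And>x y. q x y > 0" and one: "\<And>x. (\<integral>\<^sup>+y. ennreal (q x y) \<partial>lborel) = 1"
  obtains J where "risk_alpha \<alpha> vx vy \<mu> q = 4 / (1 - \<alpha>\<^sup>2) * (1 - J)" "J \<ge> 0"
    "ennreal J = (\<integral>\<^sup>+x. (\<integral>\<^sup>+y. ennreal (q x y powr ((1 + \<alpha>) / 2) * phi (y - \<mu>) vy powr ((1 - \<alpha>) / 2)
        * phi (x - \<mu>) vx) \<partial>lborel) \<partial>lborel)"
proof -
  define p where "p = (1 + \<alpha>) / 2"
  have p: "0 \<le> p" "p \<le> 1" "(1 - \<alpha>) / 2 = 1 - p" using \<alpha> by (auto simp: p_def field_simps)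
  define C where "C = 4 / (1 - \<alpha>\<^sup>2)"
  define f where "f = (\<lambda>x y. q x y powr p * phi (y - \<mu>) vy powr (1 - p))"
  have [measurable]: "(\<lambda>(x, y). f x y) \<in> borel_measurable (borel \<Otimes>\<^sub>M borel)"
    unfolding f_def by measurable
  have fm[measurable]: "f x \<in> borel_measurable borel" for x unfolding f_def by measurable
  have f0: "f x y \<ge> 0" for x y by (simp add: f_def)
  have int_q: "integrable lborel (q x)" for x
  proof (rule integrableI_nonneg)
    show "(\<integral>\<^sup>+y. ennreal (q x y) \<partial>lborel) < \<infinity>" by (simp only: one) simp
    show "AE y in lborel. 0 \<le> q x y" using pos[of x] by (intro AE_I2) (simp add: less_imp_le)
  qed measurable
  note int_phi = integrable_phi_translate[OF vy, of \<mu>] and iphi = integral_phi_translate[OF vy, of \<mu>]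
  note int_phi' = integrable_phi_translate[OF vx, of \<mu>] and iphi' = integral_phi_translate[OF vx, of \<mu>]
  have fle: "f x y \<le> q x y + phi (y - \<mu>) vy" for x y
    unfolding f_def using p pos[of x y] phi_pos[OF vy, of "y - \<mu>"] by (intro powr_mult_powr_le_add) auto
  have int_f: "integrable lborel (f x)" for x
  proof (rule Bochner_Integration.integrable_bound[OF Bochner_Integration.integrable_add[OF int_q[of x] int_phi]])
    show "AE y in lborel. norm (f x y) \<le> norm (q x y + phi (y - \<mu>) vy)"
      using fle[of x] f0[of x] by (intro AE_I2) (simp add: abs_of_nonneg order_trans[OF _ abs_ge_self])
  qed measurable
  define I where "I = (\<lambda>x. \<integral>y. f x y \<partial>lborel)"
  have [measurable]: "I \<in> borel_measurable borel" unfolding I_def by measurable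
  have iq: "(\<integral>y. q x y \<partial>lborel) = 1" for x
  proof -
    have "(\<integral>\<^sup>+y. ennreal (q x y) \<partial>lborel) = ennreal (\<integral>y. q x y \<partial>lborel)"
      by (rule nn_integral_eq_integral[OF int_q]) (use pos in \<open>simp add: less_imp_le\<close>)
    thus ?thesis by (simp only: one) simp
  qed
  have I0: "I x \<ge> 0" for x unfolding I_def by (rule integral_nonneg_AE) (simp add: f0)
  \<comment> \<open>Both densities have mass one, so the affinity is bounded by 2 and integrable
    against the law of X.\<close>
  have "I x \<le> (\<integral>y. q x y + phi (y - \<mu>) vy \<partial>lborel)" for x
    unfolding I_def by (rule integral_mono[OF int_f Bochner_Integration.integrable_add[OF int_q int_phi]]) (rule fle)
  hence I2: "I x \<le> 2" for x using int_q int_phi by (simp add: iq iphi)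
  have int_I: "integrable lborel (\<lambda>x. I x * phi (x - \<mu>) vx)"
  proof (rule Bochner_Integration.integrable_bound[OF integrable_mult_right[OF int_phi', of 2]])
    show "AE x in lborel. norm (I x * phi (x - \<mu>) vx) \<le> norm (2 * phi (x - \<mu>) vx)"
      using I0 I2 by (intro AE_I2) (simp add: abs_mult mult_right_mono)
  qed measurable
  have D: "D_alpha \<alpha> vy \<mu> (q x) = C * (1 - I x)" for x
  proof -
    have "f_alpha \<alpha> (q x y / phi (y - \<mu>) vy) * phi (y - \<mu>) vy = C * (phi (y - \<mu>) vy - f x y)" for y
    proof -
      have ph: "phi (y - \<mu>) vy > 0" by (rule phi_pos[OF vy])
      have "(q x y / phi (y - \<mu>) vy) powr p * phi (y - \<mu>) vy = f x y"
        unfolding f_def using ph pos[of x y] by (simp add: powr_divide powr_diff)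
      thus ?thesis by (simp add: f_alpha_def C_def p_def right_diff_distrib left_diff_distrib mult.assoc
            flip: p_def)
    qed
    hence "D_alpha \<alpha> vy \<mu> (q x) = (\<integral>y. C * (phi (y - \<mu>) vy - f x y) \<partial>lborel)"
      by (simp add: D_alpha_def)
    also have "\<dots> = C * (1 - I x)" using int_phi int_f[of x] by (simp add: iphi I_def)
    finally show ?thesis .
  qed
  define J where "J = (\<integral>x. I x * phi (x - \<mu>) vx \<partial>lborel)"
  show ?thesis
  proof (rule that)
    have "risk_alpha \<alpha> vx vy \<mu> q = (\<integral>x. C * (phi (x - \<mu>) vx - I x * phi (x - \<mu>) vx) \<partial>lborel)"
      unfolding risk_alpha_def D by (simp add: algebra_simps)
    also have "\<dots> = C * (1 - J)" using int_phi' int_I by (simp add: iphi' J_def)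
    finally show "risk_alpha \<alpha> vx vy \<mu> q = 4 / (1 - \<alpha>\<^sup>2) * (1 - J)" by (simp add: C_def)
    show "J \<ge> 0" unfolding J_def by (rule integral_nonneg_AE) (simp add: I0 phi_nonneg)
    have "ennreal J = (\<integral>\<^sup>+x. ennreal (I x * phi (x - \<mu>) vx) \<partial>lborel)"
      unfolding J_def by (rule nn_integral_eq_integral[OF int_I, symmetric]) (simp add: I0 phi_nonneg)
    also have "\<dots> = (\<integral>\<^sup>+x. (\<integral>\<^sup>+y. ennreal (f x y * phi (x - \<mu>) vx) \<partial>lborel) \<partial>lborel)"
    proof (rule nn_integral_cong)
      fix x
      have "(\<integral>\<^sup>+y. ennreal (f x y * phi (x - \<mu>) vx) \<partial>lborel) = ennreal (\<integral>y. f x y * phi (x - \<mu>) vx \<partial>lborel)"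
        by (rule nn_integral_eq_integral) (use int_f in \<open>auto simp: f0 phi_nonneg\<close>)
      thus "ennreal (I x * phi (x - \<mu>) vx) = (\<integral>\<^sup>+y. ennreal (f x y * phi (x - \<mu>) vx) \<partial>lborel)"
        by (simp add: I_def)
    qed
    finally show "ennreal J = (\<integral>\<^sup>+x. (\<integral>\<^sup>+y. ennreal (q x y powr ((1 + \<alpha>) / 2) * phi (y - \<mu>) vy powr ((1 - \<alpha>) / 2)
        * phi (x - \<mu>) vx) \<partial>lborel) \<partial>lborel)"
      by (simp add: f_def p(3) p_def)
  qed
qed

text \<open>With d = y - x one has w = x + (1 - g) d, so the map is a composition of two shears and
  has determinant one for every g.\<close>

lemma nn_integral_mean_difference:
  fixes f :: "'a::euclidean_space \<times> 'a \<Rightarrow> ennreal"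
  assumes [measurable]: "f \<in> borel_measurable (borel \<Otimes>\<^sub>M borel)"
  shows "(\<integral>\<^sup>+x. (\<integral>\<^sup>+y. f (g *\<^sub>R x + (1 - g) *\<^sub>R y, y - x) \<partial>lborel) \<partial>lborel)
    = (\<integral>\<^sup>+w. (\<integral>\<^sup>+d. f (w, d) \<partial>lborel) \<partial>lborel)"
proof -
  have "(\<integral>\<^sup>+y. f (g *\<^sub>R x + (1 - g) *\<^sub>R y, y - x) \<partial>lborel) = (\<integral>\<^sup>+d. f (x + (1 - g) *\<^sub>R d, d) \<partial>lborel)" for x
    using nn_integral_translate[of "\<lambda>y. f (g *\<^sub>R x + (1 - g) *\<^sub>R y, y - x)" x]
    by (simp add: algebra_simps)
  hence "(\<integral>\<^sup>+x. (\<integral>\<^sup>+y. f (g *\<^sub>R x + (1 - g) *\<^sub>R y, y - x) \<partial>lborel) \<partial>lborel)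
      = (\<integral>\<^sup>+x. (\<integral>\<^sup>+d. f (x + (1 - g) *\<^sub>R d, d) \<partial>lborel) \<partial>lborel)" by simp
  also have "\<dots> = (\<integral>\<^sup>+d. (\<integral>\<^sup>+x. f (x + (1 - g) *\<^sub>R d, d) \<partial>lborel) \<partial>lborel)"
    by (rule lborel_pair.Fubini'[symmetric]) measurable
  also have "\<dots> = (\<integral>\<^sup>+d. (\<integral>\<^sup>+w. f (w, d) \<partial>lborel) \<partial>lborel)"
    by (intro nn_integral_cong nn_integral_translate) measurable
  also have "\<dots> = (\<integral>\<^sup>+w. (\<integral>\<^sup>+d. f (w, d) \<partial>lborel) \<partial>lborel)"
    by (rule lborel_pair.Fubini') measurable
  finally show ?thesis .
qed

text \<open>The negative root serves the reflected variable: x = w - (1 - \<gamma>) d carries a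
  minus sign, while the heat flow uses w + \<xi> z.\<close>

lemma nn_integral_phi_rescale:
  fixes f :: "real ^ 'n \<Rightarrow> real"
  assumes s: "s > 0" and c: "c = sqrt s \<or> c = - sqrt s" and [measurable]: "f \<in> borel_measurable borel"
  shows "(\<integral>\<^sup>+y. ennreal (f (y - t) * phi (y - t) s) \<partial>lborel) = (\<integral>\<^sup>+z. ennreal (f (c *\<^sub>R z) * phi z 1) \<partial>lborel)"
proof -
  have c0: "c \<noteq> 0" "\<bar>c\<bar> = sqrt s" using s c by auto
  have ph: "sqrt s ^ CARD('n) * phi (c *\<^sub>R z) s = phi z 1" for z :: "real ^ 'n"
    using phi_scale[OF s, of z] c by (auto simp: phi_minus)
  have "(\<integral>\<^sup>+y. ennreal (f (y - t) * phi (y - t) s) \<partial>lborel)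
      = ennreal (\<bar>c\<bar> ^ DIM(real ^ 'n)) * (\<integral>\<^sup>+z. ennreal (f (t + c *\<^sub>R z - t) * phi (t + c *\<^sub>R z - t) s) \<partial>lborel)"
    by (rule nn_integral_affine) (use c0 in auto)
  also have "\<dots> = (\<integral>\<^sup>+z. ennreal (\<bar>c\<bar> ^ DIM(real ^ 'n)) * ennreal (f (t + c *\<^sub>R z - t) * phi (t + c *\<^sub>R z - t) s) \<partial>lborel)"
    by (rule nn_integral_cmult[symmetric]) measurable
  also have "\<dots> = (\<integral>\<^sup>+z. ennreal (f (c *\<^sub>R z) * phi z 1) \<partial>lborel)"
  proof (rule nn_integral_cong)
    fix z :: "real ^ 'n"
    have "f (c *\<^sub>R z) * phi z 1 = \<bar>c\<bar> ^ DIM(real ^ 'n) * (f (t + c *\<^sub>R z - t) * phi (t + c *\<^sub>R z - t) s)"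
      by (simp add: c0 ph[symmetric])
    thus "ennreal (\<bar>c\<bar> ^ DIM(real ^ 'n)) * ennreal (f (t + c *\<^sub>R z - t) * phi (t + c *\<^sub>R z - t) s)
        = ennreal (f (c *\<^sub>R z) * phi z 1)"
      by (subst ennreal_mult'[symmetric]) (simp, simp only:)
  qed
  finally show ?thesis .
qed

text \<open>The relation between \<beta> and \<gamma> is the definition of \<gamma> cleared of
  fractions; it is what removes the cross term between w and y - x.\<close>

lemma gaussian_risk_factor:
  fixes x y \<mu> :: "real ^ 'n"
  assumes vx: "vx > 0" and vy: "vy > 0" and \<gamma>: "0 < \<gamma>" "\<gamma> < 1" and \<beta>: "\<beta> * \<gamma> * vx = (1 - \<gamma>) * vy"
  shows "phi (y - x) (vy / \<gamma>) powr (1 - \<beta>) * phi (y - \<mu>) vy powr \<beta> * phi (x - \<mu>) vx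
    = (2 * pi * (vy / \<gamma>)) powr (- real CARD('n) / 2 * (1 - \<beta>)) * (2 * pi * vy) powr (- real CARD('n) / 2 * \<beta>)
      * (2 * pi * vx) powr (- real CARD('n) / 2)
      / ((2 * pi * (vx * \<gamma>)) powr (- real CARD('n) / 2) * (2 * pi * (vy / \<gamma>)) powr (- real CARD('n) / 2))
      * (phi (\<gamma> *\<^sub>R x + (1 - \<gamma>) *\<^sub>R y - \<mu>) (vx * \<gamma>) * phi (y - x) (vy / \<gamma>))"
proof -
  define X where "X = x - \<mu>"
  define Y where "Y = y - \<mu>"
  have xy: "y - x = Y - X" "y - \<mu> = Y" "x - \<mu> = X" by (simp_all add: X_def Y_def)
  have w: "\<gamma> *\<^sub>R x + (1 - \<gamma>) *\<^sub>R y - \<mu> = \<gamma> *\<^sub>R X + (1 - \<gamma>) *\<^sub>R Y"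
    by (simp add: X_def Y_def algebra_simps)
  define A where "A = X \<bullet> X" define C where "C = Y \<bullet> Y" define E where "E = X \<bullet> Y"
  have n1: "(norm (Y - X))\<^sup>2 = C - 2 * E + A"
    by (simp add: power2_norm_eq_inner inner_diff_left inner_diff_right A_def C_def E_def inner_commute)
  have n2: "(norm Y)\<^sup>2 = C" "(norm X)\<^sup>2 = A" by (simp_all add: power2_norm_eq_inner A_def C_def)
  have n3: "(norm (\<gamma> *\<^sub>R X + (1 - \<gamma>) *\<^sub>R Y))\<^sup>2 = \<gamma>\<^sup>2 * A + 2 * \<gamma> * (1 - \<gamma>) * E + (1 - \<gamma>)\<^sup>2 * C"
    by (simp add: power2_norm_eq_inner inner_add_left inner_add_right A_def C_def E_def inner_commute)
       (simp add: power2_eq_square algebra_simps)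
  have bv: "\<beta> / vy = (1 - \<gamma>) / (\<gamma> * vx)" using vx vy \<gamma> \<beta> by (simp add: field_simps)
  \<comment> \<open>With b = \<beta>/vy and u = 1/(\<gamma> vx) the relation reads b = (1 -
    \<gamma>) u, and the exponents agree by a polynomial identity.\<close>
  have ex: "(1 - \<beta>) * ((C - 2 * E + A) / (2 * (vy / \<gamma>))) + \<beta> * (C / (2 * vy)) + A / (2 * vx)
      = (\<gamma>\<^sup>2 * A + 2 * \<gamma> * (1 - \<gamma>) * E + (1 - \<gamma>)\<^sup>2 * C) / (2 * (vx * \<gamma>)) + (C - 2 * E + A) / (2 * (vy / \<gamma>))"
  proof -
    define b where "b = \<beta> / vy"
    define u where "u = 1 / (\<gamma> * vx)"
    have b: "b = (1 - \<gamma>) * u" using bv by (simp add: b_def u_def)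
    have "(1 - \<beta>) * ((C - 2 * E + A) / (2 * (vy / \<gamma>))) + \<beta> * (C / (2 * vy)) + A / (2 * vx)
        = (C - 2 * E + A) / (2 * (vy / \<gamma>)) - b * \<gamma> * (C - 2 * E + A) / 2 + b * C / 2 + A * \<gamma> * u / 2"
    proof -
      define Z where "Z = C - 2 * E + A"
      have "(1 - \<beta>) * (Z / (2 * (vy / \<gamma>))) = Z / (2 * (vy / \<gamma>)) - b * \<gamma> * Z / 2"
        by (simp add: b_def algebra_simps diff_divide_distrib)
      moreover have "\<beta> * (C / (2 * vy)) = b * C / 2" by (simp add: b_def mult_ac)
      moreover have "A / (2 * vx) = A * \<gamma> * u / 2" using \<gamma> by (simp add: u_def mult_ac)
      ultimately show ?thesis unfolding Z_def by (simp only:)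
    qed
    also have "\<dots> = (\<gamma>\<^sup>2 * A + 2 * \<gamma> * (1 - \<gamma>) * E + (1 - \<gamma>)\<^sup>2 * C) * u / 2 + (C - 2 * E + A) / (2 * (vy / \<gamma>))"
      unfolding b by (simp add: field_simps power2_eq_square)
    finally show ?thesis by (simp add: u_def mult.commute)
  qed
  have pw: "(c powr (- real CARD('n) / 2) * exp (- t)) powr l = c powr (- real CARD('n) / 2 * l) * exp (- (l * t))"
    if "c > 0" for c t l :: real
    using that by (simp add: powr_mult powr_powr) (simp add: powr_def)
  have ph: "phi x s = (2 * pi * s) powr (- real CARD('n) / 2) * exp (- ((norm x)\<^sup>2 / (2 * s)))"
    for x :: "real ^ 'n" and s by (simp add: phi_def)
  have pos: "2 * pi * (vy / \<gamma>) > 0" "2 * pi * vy > 0" "2 * pi * (vx * \<gamma>) > 0" using vx vy \<gamma> by auto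
  have e: "exp (- ((1 - \<beta>) * ((C - 2 * E + A) / (2 * (vy / \<gamma>))))) * exp (- (\<beta> * (C / (2 * vy)))) * exp (- (A / (2 * vx)))
      = exp (- ((\<gamma>\<^sup>2 * A + 2 * \<gamma> * (1 - \<gamma>) * E + (1 - \<gamma>)\<^sup>2 * C) / (2 * (vx * \<gamma>)))) * exp (- ((C - 2 * E + A) / (2 * (vy / \<gamma>))))"
    unfolding exp_add[symmetric] using ex by (intro arg_cong[where f = exp]) linarith
  define k1 where "k1 = (2 * pi * (vy / \<gamma>)) powr (- real CARD('n) / 2 * (1 - \<beta>))"
  define k2 where "k2 = (2 * pi * vy) powr (- real CARD('n) / 2 * \<beta>)"
  define k3 where "k3 = (2 * pi * vx) powr (- real CARD('n) / 2)"
  define k4 where "k4 = (2 * pi * (vx * \<gamma>)) powr (- real CARD('n) / 2)"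
  define k5 where "k5 = (2 * pi * (vy / \<gamma>)) powr (- real CARD('n) / 2)"
  have k45: "k4 > 0" "k5 > 0" using pos by (auto simp: k4_def k5_def)
  have "phi (y - x) (vy / \<gamma>) powr (1 - \<beta>) * phi (y - \<mu>) vy powr \<beta> * phi (x - \<mu>) vx
      = k1 * k2 * k3 * (exp (- ((1 - \<beta>) * ((C - 2 * E + A) / (2 * (vy / \<gamma>))))) * exp (- (\<beta> * (C / (2 * vy)))) * exp (- (A / (2 * vx))))"
    unfolding ph xy n1 n2 pw[OF pos(1)] pw[OF pos(2)] k1_def k2_def k3_def
    by (simp only: mult_ac)
  also have "\<dots> = k1 * k2 * k3 / (k4 * k5) * (phi (\<gamma> *\<^sub>R x + (1 - \<gamma>) *\<^sub>R y - \<mu>) (vx * \<gamma>) * phi (y - x) (vy / \<gamma>))"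
    unfolding e w xy ph n1 n3 k4_def[symmetric] k5_def[symmetric] using k45
    by simp
  finally show ?thesis unfolding k1_def k2_def k3_def k4_def k5_def .
qed

theorem theorem5:
  fixes \<alpha> vx vy :: real
  assumes "CARD('n) \<ge> 3"
    and "vx > 0" and "vy > 0"
    and "-1 < \<alpha>" and "\<alpha> < 1"
    and "\<exists>k::nat. k > 0 \<and> 2 / (1 - \<alpha>) = real k"
    and "vx / vy \<le> (real CARD('n) + 2) / (real CARD('n) * (1 + \<alpha>))"
  shows "\<forall>\<mu> :: real ^ 'n.
           risk_alpha \<alpha> vx vy \<mu> (p_H \<alpha> vx vy) \<le> risk_alpha \<alpha> vx vy \<mu> (p_U \<alpha> vx vy)"
proof
  fix \<mu> :: "real ^ 'n"
  note vx = assms(2) and vy = assms(3)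
  obtain k :: nat where k: "k > 0" "2 / (1 - \<alpha>) = real k" using assms(6) by blast
  define \<beta> where "\<beta> = beta_of \<alpha>"
  define \<gamma> where "\<gamma> = gamma_of \<alpha> vx vy"
  define \<xi> where "\<xi> = xi_of \<alpha> vx vy"
  have \<beta>k: "\<beta> = 1 / real k" "1 / \<beta> = real k"
    using k assms(5) by (auto simp: \<beta>_def beta_of_def field_simps)
  have \<beta>: "0 < \<beta>" "\<beta> < 1" using assms(4,5) by (auto simp: \<beta>_def beta_of_def)
  have \<alpha>\<beta>: "(1 + \<alpha>) / 2 = 1 - \<beta>" "(1 - \<alpha>) / 2 = \<beta>" by (auto simp: \<beta>_def beta_of_def field_simps)
  have \<gamma>_eq: "\<gamma> = 1 / (1 + \<beta> * vx / vy)" by (simp add: \<gamma>_def gamma_of_def \<beta>_def)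
  have \<beta>v: "\<beta> * vx / vy > 0" using \<beta> vx vy by simp
  have \<gamma>: "0 < \<gamma>" "\<gamma> < 1" using \<beta>v by (auto simp: \<gamma>_eq add_pos_pos)
  have "\<gamma> * (1 + \<beta> * vx / vy) = 1" using \<beta>v by (simp add: \<gamma>_eq)
  hence "\<gamma> * (vy + \<beta> * vx) = vy" using vy by (simp add: field_simps)
  hence \<gamma>\<beta>: "\<beta> * \<gamma> * vx = (1 - \<gamma>) * vy" by (simp add: algebra_simps)
  define \<sigma> where "\<sigma> = vy / \<gamma>"
  have \<sigma>: "\<sigma> > 0" using vy \<gamma> by (simp add: \<sigma>_def)
  have \<xi>_eq: "\<xi> = (1 - \<gamma>) * sqrt \<sigma>" by (simp add: \<xi>_def xi_of_def \<gamma>_def \<sigma>_def)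
  have \<xi>: "\<xi> > 0" using \<gamma> \<sigma> by (simp add: \<xi>_eq)
  define s where "s = \<xi>\<^sup>2"
  have s: "s > 0" "sqrt s = \<xi>" using \<xi> by (auto simp: s_def)
  define a where "a = real CARD('n) / 2 - 1"
  have D: "real CARD('n) = 2 * a + 2" by (simp add: a_def)
  define B where "B = 1 / (vx * \<gamma>)"
  have a0: "a > 0" using assms(1) by (simp add: a_def)
  have B0: "B > 0" "1 / B = vx * \<gamma>" using vx \<gamma> by (auto simp: B_def)
  interpret power_mix a B by unfold_locales (use a0 B0 in auto)
  define p where "p = 1 - 1 / real k"
  have p\<beta>: "p = 1 - \<beta>" by (simp add: p_def \<beta>k)
  \<comment> \<open>Here s B = \<beta>^2 vx/vy and \<beta>^2 k(k-1) = 1 - \<beta> = (1 +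
    \<alpha>)/2. The factor 1 + \<alpha> of the hypothesis cancels, leaving (d+2)/(2d).\<close>
  have sk: "s * (real k * (real k - 1)) * B \<le> (a + 2) / (2 * (a + 1))"
  proof -
    have "s * B = \<beta>\<^sup>2 * (vx / vy)"
    proof -
      have "s = (1 - \<gamma>)\<^sup>2 * (vy / \<gamma>)" using \<sigma> by (simp add: s_def \<xi>_eq power_mult_distrib \<sigma>_def)
      also have "\<dots> = ((1 - \<gamma>) * vy)\<^sup>2 / (vy * \<gamma>)" using vy by (simp add: power2_eq_square)
      also have "\<dots> = (\<beta> * \<gamma> * vx)\<^sup>2 / (vy * \<gamma>)" by (simp only: \<gamma>\<beta>)
      finally show ?thesis using vx vy \<gamma> by (simp add: B_def power2_eq_square)
    qed
    moreover have "\<beta>\<^sup>2 * (real k * (real k - 1)) = 1 - \<beta>"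
      using k by (simp add: \<beta>k(1) power2_eq_square field_simps)
    ultimately have "s * (real k * (real k - 1)) * B = (1 - \<beta>) * (vx / vy)"
      by (metis mult.commute mult.left_commute)
    also have "\<dots> \<le> (1 - \<beta>) * ((real CARD('n) + 2) / (real CARD('n) * (1 + \<alpha>)))"
      using assms(7) \<beta> by (intro mult_left_mono) auto
    also have "1 + \<alpha> = 2 * (1 - \<beta>)" using \<alpha>\<beta> by simp
    also have "(1 - \<beta>) * ((real CARD('n) + 2) / (real CARD('n) * (2 * (1 - \<beta>)))) = (a + 2) / (2 * (a + 1))"
    proof -
      have "(1 - \<beta>) * ((real CARD('n) + 2) / (real CARD('n) * (2 * (1 - \<beta>)))) = (real CARD('n) + 2) / (real CARD('n) * 2)"
      proof -
        have "e * (x / (y * (2 * e))) = x / (y * 2)" if "e \<noteq> 0" for e x y :: real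
          using that by simp
        from this[of "1 - \<beta>"] show ?thesis using \<beta> by simp
      qed
      also have "\<dots> = (2 * (a + 2)) / (2 * (2 * (a + 1)))" by (simp add: D algebra_simps)
      also have "\<dots> = (a + 2) / (2 * (a + 1))" by (rule mult_divide_mult_cancel_left) simp
      finally show ?thesis .
    qed
    finally show ?thesis .
  qed

  \<comment> \<open>Both predictive densities in terms of the mixtures\<close>
  define c where "c = 1 / (Gamma a * 2 powr a)"
  have c: "c > 0" using a0 by (simp add: c_def Gamma_real_pos)
  define L where "L = (\<lambda>w :: real ^ 'n. laplace ((norm w)\<^sup>2))"
  define W where "W = (\<lambda>x :: real ^ 'n. U k 0 s ((norm x)\<^sup>2))"
  have Um[measurable]: "U k 0 s \<in> borel_measurable borel" using s by (intro U_measurable) simp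
  have [measurable]: "L \<in> borel_measurable borel" "W \<in> borel_measurable borel"
    unfolding L_def W_def by measurable
  have L: "L w > 0" for w by (simp add: L_def laplace_pos)
  have W: "W x > 0" for x unfolding W_def using s by (intro U_0_pos) simp
  have mH: "m_H w (vx * \<gamma>) powr (1 / \<beta>) = c ^ k * L w ^ k" for w :: "real ^ 'n"
  proof -
    have "m_H w (vx * \<gamma>) = c * L w" using m_H_eq_laplace[OF D, of w] by (simp add: B0 c_def L_def)
    moreover have "c * L w > 0" using c L by simp
    ultimately show ?thesis unfolding \<beta>k(2) by (simp add: powr_realpow power_mult_distrib)
  qed
  have nnW: "(\<integral>\<^sup>+z. ennreal (L (x + \<xi> *\<^sub>R z) ^ k * phi z 1) \<partial>lborel) = ennreal (W x)" for x
    using nn_integral_laplace_power[OF D s(1), of x k] by (simp add: L_def W_def s)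
  have EmH: "(\<integral>z. m_H (x + \<xi> *\<^sub>R z) (vx * \<gamma>) powr (1 / \<beta>) * phi z 1 \<partial>lborel) = c ^ k * W x" for x :: "real ^ 'n"
  proof -
    have "(\<integral>z. L (x + \<xi> *\<^sub>R z) ^ k * phi z 1 \<partial>lborel) = W x"
      using W[of x] L[of "x + \<xi> *\<^sub>R _"] by (subst integral_eq_nn_integral)
        (auto simp: nnW phi_nonneg less_imp_le intro!: mult_nonneg_nonneg)
    thus ?thesis unfolding mH by (simp add: mult.assoc)
  qed
  have pH: "p_H \<alpha> vx vy x y = L (\<gamma> *\<^sub>R x + (1 - \<gamma>) *\<^sub>R y) ^ k / W x * phi (y - x) \<sigma>" for x y :: "real ^ 'n"
    unfolding p_H_def Let_def \<beta>_def[symmetric] \<gamma>_def[symmetric] \<xi>_def[symmetric] EmH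
    unfolding mH using c by (simp add: \<sigma>_def)
  have pU: "p_U \<alpha> vx vy x y = phi (y - x) \<sigma>" for x y :: "real ^ 'n"
    by (simp add: p_U_def \<gamma>_def \<sigma>_def)
  \<comment> \<open>Normalisation holds because \<xi> = (1 - \<gamma>) sqrt \<sigma>: moving y by
    sqrt \<sigma> z moves w by \<xi> z.\<close>
  have oneH: "(\<integral>\<^sup>+y. ennreal (p_H \<alpha> vx vy x y) \<partial>lborel) = 1" for x :: "real ^ 'n"
  proof -
    have "p_H \<alpha> vx vy x y = (\<lambda>u. L (x + (1 - \<gamma>) *\<^sub>R u) ^ k / W x) (y - x) * phi (y - x) \<sigma>" for y
      unfolding pH by (simp add: algebra_simps)
    hence "(\<integral>\<^sup>+y. ennreal (p_H \<alpha> vx vy x y) \<partial>lborel)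
        = (\<integral>\<^sup>+z. ennreal (L (x + (1 - \<gamma>) *\<^sub>R (sqrt \<sigma> *\<^sub>R z)) ^ k / W x * phi z 1) \<partial>lborel)"
      using nn_integral_phi_rescale[OF \<sigma>, of "sqrt \<sigma>" "\<lambda>u. L (x + (1 - \<gamma>) *\<^sub>R u) ^ k / W x" x] by simp
    also have "\<dots> = (\<integral>\<^sup>+z. ennreal (1 / W x) * ennreal (L (x + \<xi> *\<^sub>R z) ^ k * phi z 1) \<partial>lborel)"
      using W[of x] by (intro nn_integral_cong) (simp add: \<xi>_eq ennreal_mult'[symmetric])
    also have "\<dots> = ennreal (1 / W x) * ennreal (W x)"
      by (subst nn_integral_cmult) (auto simp: nnW)
    also have "\<dots> = 1" using W[of x] by (simp add: ennreal_mult'[symmetric])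
    finally show ?thesis .
  qed

  \<comment> \<open>Affinities of the two densities\<close>
  obtain JH where JH: "risk_alpha \<alpha> vx vy \<mu> (p_H \<alpha> vx vy) = 4 / (1 - \<alpha>\<^sup>2) * (1 - JH)" "JH \<ge> 0"
    "ennreal JH = (\<integral>\<^sup>+x. (\<integral>\<^sup>+y. ennreal (p_H \<alpha> vx vy x y powr ((1 + \<alpha>) / 2) * phi (y - \<mu>) vy powr ((1 - \<alpha>) / 2)
        * phi (x - \<mu>) vx) \<partial>lborel) \<partial>lborel)"
  proof (rule risk_alpha_eq[OF assms(4,5) vx vy, of "p_H \<alpha> vx vy" \<mu>])
    show "(\<lambda>(x, y). p_H \<alpha> vx vy (x :: real ^ 'n) y) \<in> borel_measurable (borel \<Otimes>\<^sub>M borel)"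
      unfolding pH by measurable
    show "p_H \<alpha> vx vy x y > 0" for x y :: "real ^ 'n" unfolding pH
      by (intro mult_pos_pos divide_pos_pos zero_less_power L W phi_pos[OF \<sigma>])
  qed (use oneH in auto)
  obtain JU where JU: "risk_alpha \<alpha> vx vy \<mu> (p_U \<alpha> vx vy) = 4 / (1 - \<alpha>\<^sup>2) * (1 - JU)" "JU \<ge> 0"
    "ennreal JU = (\<integral>\<^sup>+x. (\<integral>\<^sup>+y. ennreal (p_U \<alpha> vx vy x y powr ((1 + \<alpha>) / 2) * phi (y - \<mu>) vy powr ((1 - \<alpha>) / 2)
        * phi (x - \<mu>) vx) \<partial>lborel) \<partial>lborel)"
  proof (rule risk_alpha_eq[OF assms(4,5) vx vy, of "p_U \<alpha> vx vy" \<mu>])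
    show "(\<lambda>(x, y). p_U \<alpha> vx vy (x :: real ^ 'n) y) \<in> borel_measurable (borel \<Otimes>\<^sub>M borel)"
      unfolding pU by measurable
    show "p_U \<alpha> vx vy x y > 0" for x y :: "real ^ 'n" unfolding pU by (rule phi_pos[OF \<sigma>])
    show "(\<integral>\<^sup>+y. ennreal (p_U \<alpha> vx vy x y) \<partial>lborel) = 1" for x :: "real ^ 'n"
      unfolding pU by (rule nn_integral_phi_translate[OF \<sigma>])
  qed auto
  \<comment> \<open>The same constant occurs in both affinities, so only its sign matters.\<close>
  obtain K :: real where K: "K \<ge> 0" "\<And>x y :: real ^ 'n. phi (y - x) \<sigma> powr (1 - \<beta>) * phi (y - \<mu>) vy powr \<beta> * phi (x - \<mu>) vx
      = K * (phi (\<gamma> *\<^sub>R x + (1 - \<gamma>) *\<^sub>R y - \<mu>) (vx * \<gamma>) * phi (y - x) \<sigma>)"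
  proof (rule that)
    show "0 \<le> (2 * pi * (vy / \<gamma>)) powr (- real CARD('n) / 2 * (1 - \<beta>)) * (2 * pi * vy) powr (- real CARD('n) / 2 * \<beta>)
      * (2 * pi * vx) powr (- real CARD('n) / 2)
      / ((2 * pi * (vx * \<gamma>)) powr (- real CARD('n) / 2) * (2 * pi * (vy / \<gamma>)) powr (- real CARD('n) / 2))"
      by (intro divide_nonneg_nonneg mult_nonneg_nonneg) auto
  qed (unfold \<sigma>_def, rule gaussian_risk_factor[OF vx vy \<gamma> \<gamma>\<beta>])

  \<comment> \<open>Comparison of the affinities for fixed w\<close>
  let ?H = "\<lambda>(w :: real ^ 'n) d. ennreal (K * (phi (w - \<mu>) (vx * \<gamma>) * phi d \<sigma>)
      * (L w ^ (k - 1) * W (w - (1 - \<gamma>) *\<^sub>R d) powr (- p)))"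
  have "ennreal JU = (\<integral>\<^sup>+x. (\<integral>\<^sup>+y. (\<lambda>(w, d). ennreal (K * (phi (w - \<mu>) (vx * \<gamma>) * phi d \<sigma>)))
      (\<gamma> *\<^sub>R x + (1 - \<gamma>) *\<^sub>R y, y - x) \<partial>lborel) \<partial>lborel)"
    unfolding JU(3) pU \<alpha>\<beta> by (simp add: K(2))
  also have "\<dots> = (\<integral>\<^sup>+w. (\<integral>\<^sup>+d. ennreal (K * (phi (w - \<mu>) (vx * \<gamma>) * phi (d :: real ^ 'n) \<sigma>)) \<partial>lborel) \<partial>lborel)"
    by (subst nn_integral_mean_difference) simp_all
  also have "\<dots> \<le> (\<integral>\<^sup>+w. (\<integral>\<^sup>+d. ?H w d \<partial>lborel) \<partial>lborel)"
  proof (rule nn_integral_mono)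
    fix w :: "real ^ 'n"
    have kp: "real k * p = real (k - 1)" using k by (simp add: p_def right_diff_distrib of_nat_diff)
    define G where "G = K * phi (w - \<mu>) (vx * \<gamma>)"
    have G: "G \<ge> 0" using K by (simp add: G_def phi_nonneg)
    define H where "H = (\<integral>\<^sup>+z. ennreal (phi z 1 * W (w + \<xi> *\<^sub>R z) powr (- p)) \<partial>lborel)"
    have "ennreal (U k 0 0 ((norm w)\<^sup>2) powr (- p)) \<le> H"
    proof -
      have hm: "U k 0 0 ((norm w)\<^sup>2) powr (- p) \<le> (\<integral>z. phi z 1 * W (w + \<xi> *\<^sub>R z) powr (- p) \<partial>lborel)"
        "integrable lborel (\<lambda>z. phi z 1 * W (w + \<xi> *\<^sub>R z) powr (- p))"
        using heat_monotone[OF D, of k s w] k s sk by (simp_all add: W_def p_def)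
      have "H = ennreal (\<integral>z. phi z 1 * W (w + \<xi> *\<^sub>R z) powr (- p) \<partial>lborel)"
        unfolding H_def by (rule nn_integral_eq_integral[OF hm(2)]) (simp add: phi_nonneg)
      thus ?thesis using hm(1) by (simp add: ennreal_leI)
    qed
    moreover have "U k 0 0 ((norm w)\<^sup>2) powr (- p) = 1 / L w ^ (k - 1)"
    proof -
      have "U k 0 0 ((norm w)\<^sup>2) = L w powr real k" using L[of w] by (simp add: U_zero L_def powr_realpow)
      hence "U k 0 0 ((norm w)\<^sup>2) powr (- p) = L w powr (- real (k - 1))"
        by (simp only: powr_powr kp[symmetric] mult_minus_right)
      thus ?thesis using L[of w] by (simp add: powr_minus_divide powr_realpow)
    qed
    ultimately have H: "ennreal (1 / L w ^ (k - 1)) \<le> H" by simp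
    have "(\<integral>\<^sup>+d. ennreal (K * (phi (w - \<mu>) (vx * \<gamma>) * phi (d :: real ^ 'n) \<sigma>)) \<partial>lborel)
        = (\<integral>\<^sup>+d. ennreal G * ennreal (phi (d :: real ^ 'n) \<sigma>) \<partial>lborel)"
      using G by (intro nn_integral_cong) (simp add: G_def ennreal_mult'[symmetric] mult.assoc)
    also have "\<dots> = ennreal G * 1"
      using nn_integral_phi[OF \<sigma>, where 'n = 'n] by (subst nn_integral_cmult) auto
    \<comment> \<open>The weight L^(k-1) of the harmonic density is inserted with its inverse; the
      inverse is then replaced by the larger expectation \<open>H\<close>.\<close>
    also have "\<dots> = ennreal (G * L w ^ (k - 1)) * ennreal (1 / L w ^ (k - 1))"
      using G L[of w] by (simp add: ennreal_mult'[symmetric])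
    also have "\<dots> \<le> ennreal (G * L w ^ (k - 1)) * H"
      using H by (rule mult_left_mono) simp
    also have "H = (\<integral>\<^sup>+z. ennreal (W (w - (1 - \<gamma>) *\<^sub>R (- sqrt \<sigma> *\<^sub>R z)) powr (- p) * phi z 1) \<partial>lborel)"
      unfolding H_def by (simp add: \<xi>_eq mult.commute)
    also have "\<dots> = (\<integral>\<^sup>+d. ennreal (W (w - (1 - \<gamma>) *\<^sub>R d) powr (- p) * phi d \<sigma>) \<partial>lborel)"
      using nn_integral_phi_rescale[OF \<sigma>, of "- sqrt \<sigma>" "\<lambda>d. W (w - (1 - \<gamma>) *\<^sub>R d) powr (- p)" 0] by simp
    also have "ennreal (G * L w ^ (k - 1)) * \<dots>
        = (\<integral>\<^sup>+d. ennreal (G * L w ^ (k - 1)) * ennreal (W (w - (1 - \<gamma>) *\<^sub>R d) powr (- p) * phi d \<sigma>) \<partial>lborel)"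
      by (rule nn_integral_cmult[symmetric]) measurable
    also have "\<dots> = (\<integral>\<^sup>+d. ?H w d \<partial>lborel)"
    proof -
      have GL: "0 \<le> G * L w ^ (k - 1)" using G L[of w] by simp
      show ?thesis unfolding ennreal_mult'[OF GL, symmetric] unfolding G_def by (simp only: mult_ac)
    qed
    finally show "(\<integral>\<^sup>+d. ennreal (K * (phi (w - \<mu>) (vx * \<gamma>) * phi (d :: real ^ 'n) \<sigma>)) \<partial>lborel)
        \<le> (\<integral>\<^sup>+d. ?H w d \<partial>lborel)" .
  qed
  also have "\<dots> = (\<integral>\<^sup>+x. (\<integral>\<^sup>+y. (\<lambda>(w, d). ?H w d) (\<gamma> *\<^sub>R x + (1 - \<gamma>) *\<^sub>R y, y - x) \<partial>lborel) \<partial>lborel)"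
    by (subst nn_integral_mean_difference) simp_all
  also have "\<dots> = ennreal JH"
    unfolding JH(3)
  proof (intro nn_integral_cong)
    fix x y :: "real ^ 'n"
    define w where "w = \<gamma> *\<^sub>R x + (1 - \<gamma>) *\<^sub>R y"
    \<comment> \<open>The argument of \<open>W\<close> in the (w, d) coordinates is the original
      observation x.\<close>
    have x: "w - (1 - \<gamma>) *\<^sub>R (y - x) = x" by (simp add: w_def algebra_simps)
    have "p_H \<alpha> vx vy x y powr (1 - \<beta>) = L w ^ (k - 1) * W x powr (- p) * phi (y - x) \<sigma> powr (1 - \<beta>)"
    proof -
      have kp: "real k * p = real (k - 1)" using k by (simp add: p_def right_diff_distrib of_nat_diff)
      have "(L w ^ k) powr p = L w ^ (k - 1)"
        using L[of w] by (simp add: powr_realpow[symmetric] powr_powr kp)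
      thus ?thesis unfolding pH w_def[symmetric] p\<beta>[symmetric]
        using L[of w] W[of x] phi_pos[OF \<sigma>, of "y - x"] by (simp add: powr_mult powr_divide powr_minus_divide)
    qed
    hence "p_H \<alpha> vx vy x y powr ((1 + \<alpha>) / 2) * phi (y - \<mu>) vy powr ((1 - \<alpha>) / 2) * phi (x - \<mu>) vx
        = L w ^ (k - 1) * W x powr (- p) * (phi (y - x) \<sigma> powr (1 - \<beta>) * phi (y - \<mu>) vy powr \<beta> * phi (x - \<mu>) vx)"
      by (simp add: \<alpha>\<beta> mult_ac)
    thus "(\<lambda>(w, d). ?H w d) (\<gamma> *\<^sub>R x + (1 - \<gamma>) *\<^sub>R y, y - x)
      = ennreal (p_H \<alpha> vx vy x y powr ((1 + \<alpha>) / 2) * phi (y - \<mu>) vy powr ((1 - \<alpha>) / 2) * phi (x - \<mu>) vx)"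
      unfolding K(2) w_def[symmetric] by (simp add: x mult_ac)
  qed
  \<comment> \<open>A larger affinity means a smaller risk, the prefactor 4/(1 - \<alpha>^2) being
    nonnegative.\<close>
  finally have "JU \<le> JH" using JH(2) by simp
  moreover have "4 / (1 - \<alpha>\<^sup>2) \<ge> 0"
  proof -
    have "\<bar>\<alpha>\<bar> < 1" using assms(4,5) by auto
    hence "\<alpha>\<^sup>2 < 1" by (simp add: abs_square_less_1)
    thus ?thesis by simp
  qed
  ultimately show "risk_alpha \<alpha> vx vy \<mu> (p_H \<alpha> vx vy) \<le> risk_alpha \<alpha> vx vy \<mu> (p_U \<alpha> vx vy)"
    unfolding JH(1) JU(1) by (intro mult_left_mono) auto
qed

end
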